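(* Let $X$ be a one-dimensional two-sided 1-step mixing shift of finite type over a finite alphabet $\mathcal{A}$, let $Y$ be a sofic shift over $\mathcal{A}$, and let $\pi:X\to Y$ be a 1-block factor map onto $Y$. If there is a point $y\in Y$ which admits a right transition between distinct right classes (i.e. there are right classes $C\neq C'$ over $y$ with $C\to^r C'$), then there is a fully supported Markov measure $\mu$ on $X$ such that the image measure $\pi\mu$ is not a Gibbs measure on $Y$ (for any continuous potential).
   Context: Notation: $\mathcal{B}(X)$ is the set of words occurring in points of $X$; $X$ is 1-step if $uv,vw\in\mathcal{B}(X)$ with $|v|=1$ implies $uvw\in\mathcal{B}(X)$. $\sigma$ is the shift. For a point $x$ and an interval $I\subset\mathbb{Z}$, $x|_I$ is the restriction of $x$ to $I$. $[w]_i$ denotes the cylinder set of points $x$ with $x|_{[i,i+|w|-1]}=w$. A 1-block map $\pi$ is induced by a map on symbols, also denoted $\pi$. Right classes: Let $y\in Y$ and $x,x'\in\pi^{-1}(y)$. For $m\in\mathbb{Z}$ a right $m$-bridge from $x$ to $x'$ is a point $\vec x\in\pi^{-1}(y)$ such that for some $n>m$, $\vec x|_{(-\infty,m]}=x|_{(-\infty,m]}$ and $\vec x|_{[n,\infty)}=x'|_{[n,\infty)}$. Write $x\to^r x'$ (a right transition) if for every $m\in\mathbb{Z}$ there is a right $m$-bridge from $x$ to $x'$. Write $x\sim^r x'$ if $x\to^r x'$ and $x'\to^r x$; this is an equivalence relation on $\pi^{-1}(y)$ and its classes $[x]^r$ are the right (transition) classes over $y$. For right classes $C,C'$ over $y$,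 $C\to^r C'$ means $x\to^r x'$ for $x\in C,x'\in C'$ (independent of the choice of representatives). Measures: All measures are Borel probability measures. A $\sigma$-invariant measure $\mu$ on a shift of finite type over alphabet $\mathcal{A}$ is a 1-step Markov measure if there are a probability vector $p$ on $\mathcal{A}$ and an $\mathcal{A}\times\mathcal{A}$ stochastic matrix $P$ with $\mu[a_1\cdots a_n]_0=p_{a_1}P_{a_1,a_2}\cdots P_{a_{n-1},a_n}$ for all words $a_1\cdots a_n$ of the shift. A Markov measure on $X$ is a measure conjugate (via a topological conjugacy) to a 1-step Markov measure on a shift of finite type. Fully supported means positive on every nonempty cylinder of $X$. A $\sigma$-invariant measure $\nu$ on a shift space $Z$ is a Gibbs measure for a continuous $f:Z\to\mathbb{R}$ if there are $K_1,K_2>0$ and $P\in\mathbb{R}$ with $K_1<\nu[z|_{[0,n-1]}]_0/\exp(-nP+\sum_{j=0}^{n-1}f(\sigma^j z))<K_2$ for all $z\in Z$, $n\in\mathbb{N}$; it is a Gibbs measure if it is so for some continuous $f$. $\pi\mu$ denotes the push-forward $\mu\circ\pi^{-1}$. *)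

theory Defs
  imports "HOL-Probability.Probability"
begin

text \<open>
  Symbols live in a type of class \<open>discrete_topology\<close>, so that \<open>int \<Rightarrow> 'a\<close> carries the product of
  discrete topologies. The alphabet is an explicit finite set \<open>A\<close> of symbols. For such an \<open>A\<close> the
  topology and the Borel sets of a subset of \<open>full_shift A\<close> are the usual ones.
\<close>

type_synonym 'a point = "int \<Rightarrow> 'a"

section \<open>Shift spaces\<close>

definition shift_map :: "'a point \<Rightarrow> 'a point" where
  "shift_map x = (\<lambda>i. x (i + 1))"

definition full_shift :: "'a set \<Rightarrow> 'a point set" where
  "full_shift A = {x. \<forall>i. x i \<in> A}"

text \<open>\<open>word_at x i n\<close> is the restriction of \<open>x\<close> to the interval \<open>[i, i + n - 1]\<close>.\<close>

definition word_at :: "'a point \<Rightarrow> int \<Rightarrow> nat \<Rightarrow> 'a list" where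
  "word_at x i n = map (\<lambda>k. x (i + int k)) [0..<n]"

definition language :: "'a point set \<Rightarrow> 'a list set" where
  "language X = {w. \<exists>x\<in>X. \<exists>i. word_at x i (length w) = w}"

definition cylinder :: "'a point set \<Rightarrow> int \<Rightarrow> 'a list \<Rightarrow> 'a point set" where
  "cylinder X i w = {x \<in> X. word_at x i (length w) = w}"

definition shift_space :: "'a::discrete_topology set \<Rightarrow> 'a point set \<Rightarrow> bool" where
  "shift_space A X \<longleftrightarrow> finite A \<and> X \<subseteq> full_shift A \<and> closed X \<and> shift_map ` X = X"

definition shift_of_finite_type :: "'a set \<Rightarrow> 'a point set \<Rightarrow> bool" where
  "shift_of_finite_type A X \<longleftrightarrow> finite A \<and>
     (\<exists>F. finite F \<and> F \<subseteq> lists A \<and>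
        X = {x \<in> full_shift A. \<forall>w\<in>F. \<forall>i. word_at x i (length w) \<noteq> w})"

definition one_step :: "'a point set \<Rightarrow> bool" where
  "one_step X \<longleftrightarrow>
     (\<forall>u v w. length v = 1 \<longrightarrow> u @ v \<in> language X \<longrightarrow> v @ w \<in> language X
        \<longrightarrow> u @ v @ w \<in> language X)"

definition mixing :: "'a point set \<Rightarrow> bool" where
  "mixing X \<longleftrightarrow>
     (\<forall>u\<in>language X. \<forall>w\<in>language X. \<exists>N. \<forall>n\<ge>N.
        \<exists>v. length v = n \<and> u @ v @ w \<in> language X)"

definition factor_map ::
    "('a::discrete_topology point \<Rightarrow> 'b::discrete_topology point) \<Rightarrow> 'a point set \<Rightarrow> 'b point set \<Rightarrow> bool"
  where
  "factor_map \<phi> X Y \<longleftrightarrow>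
     continuous_on X \<phi> \<and> \<phi> ` X = Y \<and> (\<forall>x\<in>X. \<phi> (shift_map x) = shift_map (\<phi> x))"

definition conjugacy ::
    "('a::discrete_topology point \<Rightarrow> 'b::discrete_topology point) \<Rightarrow> 'a point set \<Rightarrow> 'b point set \<Rightarrow> bool"
  where
  "conjugacy \<phi> X Y \<longleftrightarrow>
     (\<exists>\<psi>. homeomorphism X Y \<phi> \<psi>) \<and> (\<forall>x\<in>X. \<phi> (shift_map x) = shift_map (\<phi> x))"

text \<open>
  The covering shift of finite type may have any finite alphabet; since HOL does not quantify over
  types inside a definition, its symbols are natural numbers, which covers all finite alphabets up
  to renaming.
\<close>

definition sofic :: "'a::discrete_topology set \<Rightarrow> 'a point set \<Rightarrow> bool" where
  "sofic A Y \<longleftrightarrow> shift_space A Y \<and>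
     (\<exists>(B :: nat set) Z \<phi>. shift_of_finite_type B Z \<and> factor_map \<phi> Z Y)"

definition block_map :: "('a \<Rightarrow> 'b) \<Rightarrow> 'a point \<Rightarrow> 'b point" where
  "block_map p x = (\<lambda>i. p (x i))"

section \<open>Right transition classes\<close>

definition fibre :: "'a point set \<Rightarrow> ('a point \<Rightarrow> 'b point) \<Rightarrow> 'b point \<Rightarrow> 'a point set" where
  "fibre X \<phi> y = {x \<in> X. \<phi> x = y}"

definition right_bridge ::
    "'a point set \<Rightarrow> ('a point \<Rightarrow> 'b point) \<Rightarrow> 'b point \<Rightarrow> int \<Rightarrow> 'a point \<Rightarrow> 'a point \<Rightarrow> 'a point \<Rightarrow> bool"
  where
  "right_bridge X \<phi> y m x x' z \<longleftrightarrow> z \<in> fibre X \<phi> y \<and>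
     (\<exists>n>m. (\<forall>i\<le>m. z i = x i) \<and> (\<forall>i\<ge>n. z i = x' i))"

definition right_transition ::
    "'a point set \<Rightarrow> ('a point \<Rightarrow> 'b point) \<Rightarrow> 'b point \<Rightarrow> 'a point \<Rightarrow> 'a point \<Rightarrow> bool" where
  "right_transition X \<phi> y x x' \<longleftrightarrow> (\<forall>m. \<exists>z. right_bridge X \<phi> y m x x' z)"

definition right_equivalence ::
    "'a point set \<Rightarrow> ('a point \<Rightarrow> 'b point) \<Rightarrow> 'b point \<Rightarrow> ('a point \<times> 'a point) set" where
  "right_equivalence X \<phi> y =
     {(x, x') \<in> fibre X \<phi> y \<times> fibre X \<phi> y.
        right_transition X \<phi> y x x' \<and> right_transition X \<phi> y x' x}"

definition right_classes ::
    "'a point set \<Rightarrow> ('a point \<Rightarrow> 'b point) \<Rightarrow> 'b point \<Rightarrow> 'a point set set" where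
  "right_classes X \<phi> y = fibre X \<phi> y // right_equivalence X \<phi> y"

definition class_transition ::
    "'a point set \<Rightarrow> ('a point \<Rightarrow> 'b point) \<Rightarrow> 'b point \<Rightarrow> 'a point set \<Rightarrow> 'a point set \<Rightarrow> bool" where
  "class_transition X \<phi> y C C' \<longleftrightarrow> (\<forall>x\<in>C. \<forall>x'\<in>C'. right_transition X \<phi> y x x')"

section \<open>Measures\<close>

abbreviation borel_on :: "'a::discrete_topology point set \<Rightarrow> 'a point measure" where
  "borel_on X \<equiv> restrict_space borel X"

definition invariant_measure :: "'a::discrete_topology point set \<Rightarrow> 'a point measure \<Rightarrow> bool" where
  "invariant_measure X \<mu> \<longleftrightarrow>
     prob_space \<mu> \<and> sets \<mu> = sets (borel_on X) \<and>
     shift_map \<in> measurable \<mu> \<mu> \<and> distr \<mu> \<mu> shift_map = \<mu>"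

definition probability_vector :: "'a set \<Rightarrow> ('a \<Rightarrow> real) \<Rightarrow> bool" where
  "probability_vector A p \<longleftrightarrow> (\<forall>a\<in>A. 0 \<le> p a) \<and> (\<Sum>a\<in>A. p a) = 1"

definition stochastic_matrix :: "'a set \<Rightarrow> ('a \<Rightarrow> 'a \<Rightarrow> real) \<Rightarrow> bool" where
  "stochastic_matrix A P \<longleftrightarrow> (\<forall>a\<in>A. probability_vector A (P a))"

definition one_step_markov_measure ::
    "'a::discrete_topology set \<Rightarrow> 'a point set \<Rightarrow> 'a point measure \<Rightarrow> bool" where
  "one_step_markov_measure A X \<mu> \<longleftrightarrow> invariant_measure X \<mu> \<and>
     (\<exists>p P. probability_vector A p \<and> stochastic_matrix A P \<and>
        (\<forall>w\<in>language X. w \<noteq> [] \<longrightarrow>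
           measure \<mu> (cylinder X 0 w) = p (hd w) * (\<Prod>k<length w - 1. P (w ! k) (w ! Suc k))))"

text \<open>As in \<open>sofic\<close>, the conjugate shift of finite type is taken over a finite set of naturals.\<close>

definition markov_measure :: "'a::discrete_topology point set \<Rightarrow> 'a point measure \<Rightarrow> bool" where
  "markov_measure X \<mu> \<longleftrightarrow>
     (\<exists>(B :: nat set) Z \<nu> \<phi>. shift_of_finite_type B Z \<and> one_step_markov_measure B Z \<nu> \<and>
        conjugacy \<phi> Z X \<and> \<mu> = distr \<nu> (borel_on X) \<phi>)"

definition fully_supported :: "'a::discrete_topology point set \<Rightarrow> 'a point measure \<Rightarrow> bool" where
  "fully_supported X \<mu> \<longleftrightarrow>
     (\<forall>i w. cylinder X i w \<noteq> {} \<longrightarrow> 0 < measure \<mu> (cylinder X i w))"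

definition gibbs_measure_for ::
    "'a::discrete_topology point set \<Rightarrow> ('a point \<Rightarrow> real) \<Rightarrow> 'a point measure \<Rightarrow> bool" where
  "gibbs_measure_for Z f \<nu> \<longleftrightarrow> invariant_measure Z \<nu> \<and>
     (\<exists>K1 K2 P :: real. 0 < K1 \<and> 0 < K2 \<and>
        (\<forall>z\<in>Z. \<forall>n\<ge>1.
           let r = measure \<nu> (cylinder Z 0 (word_at z 0 n))
                   / exp (- real n * P + (\<Sum>j<n. f ((shift_map ^^ j) z)))
           in K1 < r \<and> r < K2))"

definition gibbs_measure :: "'a::discrete_topology point set \<Rightarrow> 'a point measure \<Rightarrow> bool" where
  "gibbs_measure Z \<nu> \<longleftrightarrow> (\<exists>f. continuous_on Z f \<and> gibbs_measure_for Z f \<nu>)"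

end

theory Submission
  imports Defs "HOL-Library.Ramsey"
begin

text \<open>
  A Gibbs measure gives the cylinder over the first \<open>n\<close> periods of a periodic point a measure of exact
  exponential order in \<open>n\<close>. Ramsey's theorem, applied to the transition relations of the words
  \<open>y|[i, j)\<close>, turns the one-way transition over \<open>y\<close> into one over a periodic point \<open>U\<close> of least period
  \<open>q\<close>: there are \<open>q\<close>-blocks \<open>a\<close>, \<open>b\<close> over \<open>U\<close> that both return to themselves along \<open>U\<close>, and \<open>a\<close> leads
  to \<open>b\<close> but not conversely. Give every occurrence of \<open>a\<close> weight \<open>x\<close> and of \<open>b\<close> weight \<open>y\<close>. As \<open>q\<close> is the
  least period, these blocks only occur at multiples of \<open>q\<close> in the words over \<open>U\<close>, so the weighted number
  of words over \<open>n\<close> periods is a matrix power; for suitable \<open>x\<close>, \<open>y\<close> the matrix has a Jordan block at its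
  spectral radius \<open>l\<close>, and this number is at least of order \<open>n l^n\<close> with exponential rate \<open>l\<close>. Perron-Frobenius
  eigenvectors of the weighted \<open>q\<close>-block graph of \<open>X\<close> give a Markov measure whose cylinders have, up to
  constants and a factor \<open>\<rho>^n\<close>, these weights; its image is therefore not Gibbs.
\<close>

section \<open>Nonnegative matrices with two linked recurrent states\<close>

text \<open>Without weights the recurrent parts around \<open>a\<close> and \<open>b\<close> may
  have different spectral radii, and the number of words over \<open>n\<close> periods may then be
  purely exponential and compatible with a Gibbs bound. The weights balance the two parts: each is
  chosen so that its weighted first returns have generating function 1 at one common argument
  \<open>z\<close>. Taking \<open>z\<close> so small that the paths avoiding \<open>a\<close> and
  \<open>b\<close> form convergent series keeps the rest of the graph subordinate and lets these
  series replace spectral theory. The missing path from \<open>b\<close> to \<open>a\<close> makes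
  the resulting system triangular; the path from \<open>a\<close> to \<open>b\<close> couples the
  two equal eigenvalues. The Ramsey argument controls transitions only over multiples of the length
  of the repeated word, while the least period of the periodic point may be a proper divisor of it.
  The absence of a way back therefore has to be extended to all multiples of the least
  period.\<close>

definition mat_app :: "'b set \<Rightarrow> ('b \<Rightarrow> 'b \<Rightarrow> real) \<Rightarrow> ('b \<Rightarrow> real) \<Rightarrow> 'b \<Rightarrow> real" where
  "mat_app S M f i = (\<Sum>j\<in>S. M i j * f j)"

lemma mat_app_mono:
  assumes "\<And>j. j \<in> S \<Longrightarrow> f j \<le> h j" and "\<And>j. j \<in> S \<Longrightarrow> 0 \<le> M i j"
  shows "mat_app S M f i \<le> mat_app S M h i"
  unfolding mat_app_def by (intro sum_mono mult_left_mono) (use assms in auto)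

lemma mat_app_cong:
  assumes "\<And>j. j \<in> S \<Longrightarrow> f j = h j"
  shows "mat_app S M f = mat_app S M h"
  using assms by (simp add: mat_app_def fun_eq_iff)

lemma mat_app_nonneg:
  assumes "\<And>j. j \<in> S \<Longrightarrow> 0 \<le> f j" and "\<And>j. j \<in> S \<Longrightarrow> 0 \<le> M i j"
  shows "0 \<le> mat_app S M f i"
  unfolding mat_app_def by (intro sum_nonneg mult_nonneg_nonneg) (use assms in auto)

lemma mat_app_add: "mat_app S M (\<lambda>j. f j + h j) i = mat_app S M f i + mat_app S M h i"
  unfolding mat_app_def by (simp add: distrib_left sum.distrib)

lemma mat_app_scale: "mat_app S M (\<lambda>j. c * f j) i = c * mat_app S M f i"
  unfolding mat_app_def by (simp add: sum_distrib_left mult_ac)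

lemma mat_app_ge_term:
  assumes "finite S" "\<And>j. j \<in> S \<Longrightarrow> 0 \<le> f j" and "\<And>j. j \<in> S \<Longrightarrow> 0 \<le> M i j" and "j \<in> S"
  shows "M i j * f j \<le> mat_app S M f i"
  unfolding mat_app_def
  by (rule member_le_sum[where f = "\<lambda>j. M i j * f j"]) (use assms in auto)

lemma mat_pow_mono:
  assumes "\<And>j. j \<in> S \<Longrightarrow> f j \<le> h j" and "\<And>i j. i \<in> S \<Longrightarrow> j \<in> S \<Longrightarrow> 0 \<le> M i j" and "i \<in> S"
  shows "(mat_app S M ^^ k) f i \<le> (mat_app S M ^^ k) h i"
  using assms(3) by (induction k arbitrary: i) (use assms(1,2) in \<open>auto intro!: mat_app_mono\<close>)

lemma mat_pow_scale: "(mat_app S M ^^ k) (\<lambda>j. c * f j) = (\<lambda>i. c * (mat_app S M ^^ k) f i)"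
  by (induction k) (auto simp: mat_app_scale)

lemma mat_pow_nonneg:
  assumes "\<And>j. j \<in> S \<Longrightarrow> 0 \<le> f j" and "\<And>i j. i \<in> S \<Longrightarrow> j \<in> S \<Longrightarrow> 0 \<le> M i j" and "i \<in> S"
  shows "0 \<le> (mat_app S M ^^ k) f i"
  using assms(3) by (induction k arbitrary: i) (use assms(1,2) in \<open>auto intro!: mat_app_nonneg\<close>)

section \<open>Neumann series of a nonnegative matrix at a small argument\<close>

definition resolvent :: "'b set \<Rightarrow> ('b \<Rightarrow> 'b \<Rightarrow> real) \<Rightarrow> real \<Rightarrow> ('b \<Rightarrow> real) \<Rightarrow> 'b \<Rightarrow> real" where
  "resolvent S B t w = (\<lambda>i. \<Sum>k. t ^ k * (mat_app S B ^^ k) w i)"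

text \<open>The bound on \<open>z * R\<close> makes the terms of the series decay at least like
  powers of 1/2, so that (I - tB) is inverted for every \<open>t\<close> in (0, z] by an explicit
  geometric majorant, without reference to the spectral radius.\<close>

locale small_resolvent =
  fixes S :: "'b set" and B :: "'b \<Rightarrow> 'b \<Rightarrow> real" and R z :: real
  assumes fin: "finite S" and nonneg: "\<And>i j. i \<in> S \<Longrightarrow> j \<in> S \<Longrightarrow> 0 \<le> B i j"
    and rows: "\<And>i. i \<in> S \<Longrightarrow> (\<Sum>j\<in>S. B i j) \<le> R" and z: "0 < z" "z * R \<le> 1 / 2"
begin

lemma pow_bound:
  assumes "\<And>j. j \<in> S \<Longrightarrow> 0 \<le> w j" "\<And>j. j \<in> S \<Longrightarrow> w j \<le> W" "0 \<le> W" "i \<in> S"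
  shows "z ^ k * (mat_app S B ^^ k) w i \<le> W * (1 / 2) ^ k"
  using assms(4)
proof (induction k arbitrary: i)
  case 0
  then show ?case using assms by simp
next
  case (Suc k)
  have "z ^ Suc k * (mat_app S B ^^ Suc k) w i
      = z * (\<Sum>j\<in>S. B i j * (z ^ k * (mat_app S B ^^ k) w j))"
    by (simp add: mat_app_def sum_distrib_left mult_ac)
  also have "\<dots> \<le> z * (\<Sum>j\<in>S. B i j * (W * (1 / 2) ^ k))"
    using Suc z nonneg by (intro mult_left_mono sum_mono) auto
  also have "\<dots> = z * (\<Sum>j\<in>S. B i j) * (W * (1 / 2) ^ k)"
    by (simp only: sum_distrib_right mult.assoc)
  also have "\<dots> \<le> (1 / 2) * (W * (1 / 2) ^ k)"
  proof (rule mult_right_mono)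
    have "z * (\<Sum>j\<in>S. B i j) \<le> z * R" using rows[OF Suc.prems] z by simp
    then show "z * (\<Sum>j\<in>S. B i j) \<le> 1 / 2" using z by linarith
  qed (use assms in auto)
  finally show ?case by simp
qed

lemma resolvent_summable:
  assumes "\<And>j. j \<in> S \<Longrightarrow> 0 \<le> w j" "i \<in> S" "0 < t" "t \<le> z"
  shows "summable (\<lambda>k. t ^ k * (mat_app S B ^^ k) w i)"
proof (rule summable_comparison_test')
  define W where "W = (\<Sum>j\<in>S. w j)"
  have W: "w j \<le> W" if "j \<in> S" for j
    unfolding W_def using that assms fin by (intro member_le_sum) auto
  have W0: "0 \<le> W" unfolding W_def using assms by (intro sum_nonneg)
  show "summable (\<lambda>k. W * (1 / 2) ^ k)" by (intro summable_mult summable_geometric) simp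
  show "norm (t ^ k * (mat_app S B ^^ k) w i) \<le> W * (1 / 2) ^ k" for k
  proof -
    have 0: "0 \<le> (mat_app S B ^^ k) w i" using assms nonneg by (intro mat_pow_nonneg) auto
    have "t ^ k * (mat_app S B ^^ k) w i \<le> z ^ k * (mat_app S B ^^ k) w i"
      using 0 assms by (intro mult_right_mono power_mono) auto
    also have "\<dots> \<le> W * (1 / 2) ^ k" using pow_bound[OF assms(1) W W0 assms(2)] .
    finally show ?thesis using 0 assms by simp
  qed
qed

lemma resolvent_ge:
  assumes "\<And>j. j \<in> S \<Longrightarrow> 0 \<le> w j" "i \<in> S" "0 < t" "t \<le> z"
  shows "w i \<le> resolvent S B t w i"
proof -
  have "(\<Sum>k\<in>{0::nat}. t ^ k * (mat_app S B ^^ k) w i) \<le> resolvent S B t w i"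
    unfolding resolvent_def
    using assms nonneg by (intro sum_le_suminf resolvent_summable mult_nonneg_nonneg mat_pow_nonneg) auto
  then show ?thesis by simp
qed

lemma resolvent_mono:
  assumes "\<And>j. j \<in> S \<Longrightarrow> 0 \<le> w j" "i \<in> S" "0 < t" "t \<le> z"
  shows "resolvent S B t w i \<le> resolvent S B z w i"
  unfolding resolvent_def
proof (rule suminf_le)
  show "t ^ k * (mat_app S B ^^ k) w i \<le> z ^ k * (mat_app S B ^^ k) w i" for k
    using assms nonneg by (intro mult_right_mono power_mono mat_pow_nonneg) auto
qed (use assms z in \<open>auto intro!: resolvent_summable\<close>)

lemma resolvent_eq:
  assumes "\<And>j. j \<in> S \<Longrightarrow> 0 \<le> w j" "i \<in> S" "0 < t" "t \<le> z"
  shows "mat_app S B (resolvent S B t w) i = (resolvent S B t w i - w i) / t"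
proof -
  have "resolvent S B t w i = w i + (\<Sum>k. t ^ Suc k * (mat_app S B ^^ Suc k) w i)"
    unfolding resolvent_def using suminf_split_head[OF resolvent_summable[OF assms]] by simp
  also have "(\<Sum>k. t ^ Suc k * (mat_app S B ^^ Suc k) w i)
      = (\<Sum>k. \<Sum>j\<in>S. t * B i j * (t ^ k * (mat_app S B ^^ k) w j))"
    by (simp add: mat_app_def sum_distrib_left mult_ac)
  also have "\<dots> = (\<Sum>j\<in>S. \<Sum>k. t * B i j * (t ^ k * (mat_app S B ^^ k) w j))"
    using assms by (intro suminf_sum summable_mult resolvent_summable) auto
  also have "\<dots> = (\<Sum>j\<in>S. t * B i j * resolvent S B t w j)"
    unfolding resolvent_def using assms by (intro sum.cong refl suminf_mult resolvent_summable) auto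
  also have "\<dots> = t * mat_app S B (resolvent S B t w) i"
    by (simp add: mat_app_def sum_distrib_left mult_ac)
  finally show ?thesis using assms by simp
qed

text \<open>The resolvent equals \<open>w\<close> plus \<open>t\<close> times its image under
  \<open>B\<close>, so positivity travels backwards along each edge of \<open>B\<close>.\<close>

lemma resolvent_pos_step:
  assumes w: "\<And>j. j \<in> S \<Longrightarrow> 0 \<le> w j" and "i \<in> S" "j \<in> S" "0 < t" "t \<le> z"
    and "0 < B i j" "0 < resolvent S B t w j"
  shows "0 < resolvent S B t w i"
proof -
  have "0 \<le> resolvent S B t w k" if "k \<in> S" for k
    using resolvent_ge[of w k t] w that assms(4,5) by force
  then have "B i j * resolvent S B t w j \<le> mat_app S B (resolvent S B t w) i"
    using fin assms nonneg by (intro mat_app_ge_term) auto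
  then have "0 < mat_app S B (resolvent S B t w) i" using assms by (smt (verit) mult_pos_pos)
  also have "\<dots> = (resolvent S B t w i - w i) / t"
    using assms by (intro resolvent_eq) auto
  finally show ?thesis using assms(4) w[OF \<open>i \<in> S\<close>] by (simp add: zero_less_divide_iff)
qed

text \<open>No edge leaves \<open>Z\<close>, so a source that vanishes on \<open>Z\<close> never
  reaches it, and every term of the series is zero there.\<close>

lemma resolvent_zero:
  assumes "\<And>i. i \<in> Z \<Longrightarrow> w i = 0" "Z \<subseteq> S"
    and "\<And>i j. i \<in> Z \<Longrightarrow> j \<in> S \<Longrightarrow> j \<notin> Z \<Longrightarrow> B i j = 0" and "i \<in> Z"
  shows "resolvent S B t w i = 0"
proof -
  have "(mat_app S B ^^ k) w i = 0" for k
    using \<open>i \<in> Z\<close>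
  proof (induction k arbitrary: i)
    case (Suc k)
    have "B i j * (mat_app S B ^^ k) w j = 0" if "j \<in> S" for j
      using Suc assms(3) that by (cases "j \<in> Z") auto
    then show ?case by (simp add: mat_app_def[of S B "(mat_app S B ^^ k) w"] sum.neutral del: mult_eq_0_iff)
  qed (use assms in auto)
  then show ?thesis by (simp add: resolvent_def)
qed

end

text \<open>
  With first-passage generating functions \<open>f\<close> to \<open>a\<close> and \<open>h\<close> to \<open>b\<close> avoiding \<open>{a, b}\<close>, the column
  weights \<open>x = 1 / f a\<close>, \<open>y = 1 / h b\<close> at a common small argument \<open>z\<close> turn \<open>f\<close> into an eigenvector for
  \<open>1 / z\<close> and complete it, by \<open>q\<close>, to a Jordan chain of length two.
\<close>

lemma jordan_growth:
  fixes V :: "'b \<Rightarrow> 'b \<Rightarrow> real"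
  defines "E S \<equiv> {(i, j). i \<in> S \<and> j \<in> S \<and> 0 < V i j}"
  assumes fin: "finite S" and V0: "\<And>i j. i \<in> S \<Longrightarrow> j \<in> S \<Longrightarrow> 0 \<le> V i j"
    and ab: "(a, a) \<in> (E S)\<^sup>+" "(b, b) \<in> (E S)\<^sup>+" "(a, b) \<in> (E S)\<^sup>+" "(b, a) \<notin> (E S)\<^sup>+"
  obtains x y l c C :: real where "0 < x" "0 < y" "0 < l" "0 < c"
    and "\<And>k. (real k * c - C) * l ^ k
      \<le> (mat_app S (\<lambda>i j. V i j * (if j = a then x else if j = b then y else 1)) ^^ k) (\<lambda>_. 1) a"
    and "\<And>l'. l < l' \<Longrightarrow> \<exists>K. \<forall>k. \<forall>i\<in>S.
      (mat_app S (\<lambda>i j. V i j * (if j = a then x else if j = b then y else 1)) ^^ k) (\<lambda>_. 1) i \<le> K * l' ^ k"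
proof -
  have aS: "a \<in> S" and bS: "b \<in> S"
    using ab(1,2) by (auto simp: E_def elim!: tranclE)
  have neq: "a \<noteq> b" using ab by auto
  define R where "R = (\<Sum>i\<in>S. \<Sum>j\<in>S. V i j)"
  have R0: "0 \<le> R" unfolding R_def by (intro sum_nonneg V0)
  \<comment> \<open>\<open>R\<close> bounds every row sum; the added 1 makes the denominator
    positive without a lower bound on \<open>R\<close>.\<close>
  define z where "z = 1 / (2 * (R + 1))"
  have z: "0 < z" "z * R \<le> 1 / 2" using R0 by (auto simp: z_def field_simps)
  define B where "B = (\<lambda>i j. if j = a \<or> j = b then 0 else V i j)"
  interpret small_resolvent S B R z
  proof
    fix i assume i: "i \<in> S"
    have "(\<Sum>j\<in>S. B i j) \<le> (\<Sum>j\<in>S. V i j)"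
      using V0 i by (intro sum_mono) (auto simp: B_def)
    also have "\<dots> \<le> R"
      unfolding R_def using fin i V0
      by (intro member_le_sum[where f = "\<lambda>i. \<Sum>j\<in>S. V i j"]) (auto intro!: sum_nonneg)
    finally show "(\<Sum>j\<in>S. B i j) \<le> R" .
  qed (use z fin V0 in \<open>auto simp: B_def\<close>)
  \<comment> \<open>The paths that end with their first visit to \<open>a\<close>, respectively
    \<open>b\<close>, and avoid both states in between, weighted by \<open>t\<close> to the number
    of edges. The factor \<open>t\<close> in front counts the last edge.\<close>
  define f where "f t = (\<lambda>i. t * resolvent S B t (\<lambda>i. V i a) i)" for t
  define h where "h t = (\<lambda>i. t * resolvent S B t (\<lambda>i. V i b) i)" for t
  have Va: "0 \<le> V i a" and Vb: "0 \<le> V i b" if "i \<in> S" for i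
    using V0 that aS bS by auto
  have f_ge: "t * V i a \<le> f t i" and h_ge: "t * V i b \<le> h t i" if "i \<in> S" "0 < t" "t \<le> z" for i t
    using that resolvent_ge[of "\<lambda>i. V i a" i t] resolvent_ge[of "\<lambda>i. V i b" i t] Va Vb
    by (auto simp: f_def h_def)
  have f0: "0 \<le> f t i" and h0: "0 \<le> h t i" if "i \<in> S" "0 < t" "t \<le> z" for i t
    using f_ge[OF that] h_ge[OF that] Va Vb that by (smt (verit) mult_nonneg_nonneg)+
  have f_eq: "mat_app S B (f t) i = f t i / t - V i a"
    and h_eq: "mat_app S B (h t) i = h t i / t - V i b" if "i \<in> S" "0 < t" "t \<le> z" for i t
    using resolvent_eq[of "\<lambda>i. V i a" i t] resolvent_eq[of "\<lambda>i. V i b" i t] Va Vb that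
    by (simp_all add: f_def h_def mat_app_scale)
  have f_pos_step: "0 < f t i"
    if "i \<in> S" "j \<in> S" "0 < t" "t \<le> z" "0 < B i j" "0 < f t j" for i j t
    using resolvent_pos_step[of "\<lambda>i. V i a" i j t] that Va
    by (auto simp: f_def zero_less_mult_iff)
  have h_pos_step: "0 < h t i"
    if "i \<in> S" "j \<in> S" "0 < t" "t \<le> z" "0 < B i j" "0 < h t j" for i j t
    using resolvent_pos_step[of "\<lambda>i. V i b" i j t] that Vb
    by (auto simp: h_def zero_less_mult_iff)
  \<comment> \<open>A path to \<open>a\<close> never meets \<open>b\<close>, as \<open>b\<close>
    does not lead to \<open>a\<close>; its part up to the first visit to \<open>a\<close> is
    therefore counted by \<open>f\<close>.\<close>
  have f_pos: "0 < f z i" if "(i, a) \<in> (E S)\<^sup>+" for i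
    using that
  proof (induction rule: converse_trancl_induct)
    case (base i)
    then have "i \<in> S" "0 < z * V i a" using z by (auto simp: E_def)
    then show ?case using f_ge[of i z] z by linarith
  next
    case (step i j)
    then have "j \<noteq> b" using ab by auto
    show ?case
    proof (cases "j = a")
      case True
      then have "i \<in> S" "0 < z * V i a" using step z by (auto simp: E_def)
      then show ?thesis using f_ge[of i z] z by linarith
    next
      case False
      then show ?thesis using step \<open>j \<noteq> b\<close> z by (intro f_pos_step[of i j]) (auto simp: E_def B_def)
    qed
  qed
  \<comment> \<open>A path to \<open>b\<close> may meet \<open>a\<close> before, which the second
    alternative records. At \<open>a\<close> both alternatives give \<open>0 < h z a\<close>, and at
    \<open>b\<close> the second is impossible.\<close>
  have h_pos: "0 < h z i \<or> 0 < h z a \<and> (i, a) \<in> (E S)\<^sup>+" if "(i, b) \<in> (E S)\<^sup>+" for i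
    using that
  proof (induction rule: converse_trancl_induct)
    case (base i)
    then have "i \<in> S" "0 < z * V i b" using z by (auto simp: E_def)
    then show ?case using h_ge[of i z] z by linarith
  next
    case (step i j)
    show ?case
    proof (cases "j = a \<or> j = b")
      case True
      then show ?thesis
      proof
        assume "j = b"
        then have "i \<in> S" "0 < z * V i b" using step z by (auto simp: E_def)
        then show ?thesis using h_ge[of i z] z by linarith
      qed (use step in auto)
    next
      case False
      show ?thesis
        using step.IH
      proof
        assume "0 < h z j"
        then show ?thesis using step False z h_pos_step[of i j z] by (auto simp: E_def B_def)
      qed (use step in \<open>auto intro: trancl_into_trancl2\<close>)
    qed
  qed
  have fa: "0 < f z a" using f_pos ab by auto
  have ha: "0 < h z a" using h_pos ab by blast
  have hb: "0 < h z b" using h_pos ab by blast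
  \<comment> \<open>The states that do not lead to \<open>a\<close> are closed under edges, so
    \<open>f\<close> and later \<open>f1\<close> vanish on them, in particular at \<open>b\<close>.
    This is what makes the system triangular.\<close>
  define U where "U = {i \<in> S. (i, a) \<notin> (E S)\<^sup>+}"
  have U_closed: "B i j = 0" if "i \<in> U" "j \<in> S" "j \<notin> U" for i j
  proof (rule ccontr)
    assume "B i j \<noteq> 0"
    then have "(i, j) \<in> E S" using that V0[of i j] by (auto simp: E_def B_def U_def split: if_splits)
    then show False using that by (auto simp: U_def intro: trancl_into_trancl2)
  qed
  have bU: "b \<in> U" using bS ab by (auto simp: U_def)
  have VU: "V i a = 0" if "i \<in> U" for i
    using that V0[of i a] aS by (force simp: U_def E_def)
  have f_U: "f t i = 0" if "i \<in> U" for t i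
    unfolding f_def using resolvent_zero[of U "\<lambda>i. V i a" i t] U_closed VU that
    by (auto simp: U_def)
  define x where "x = 1 / f z a"
  define y where "y = 1 / h z b"
  define l where "l = 1 / z"
  define M where "M = (\<lambda>i j. V i j * (if j = a then x else if j = b then y else 1))"
  have xyl: "0 < x" "0 < y" "0 < l" using fa hb z by (auto simp: x_def y_def l_def)
  have M0: "0 \<le> M i j" if "i \<in> S" "j \<in> S" for i j
    using that V0 xyl by (auto simp: M_def)
  have M_app: "mat_app S M w i = V i a * x * w a + V i b * y * w b + mat_app S B w i" for w i
  proof -
    have "mat_app S M w i = (\<Sum>j\<in>{a, b}. M i j * w j) + (\<Sum>j\<in>S - {a, b}. M i j * w j)"
      unfolding mat_app_def using fin aS bS by (subst sum.subset_diff[of "{a, b}" S]) auto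
    moreover have "mat_app S B w i = (\<Sum>j\<in>{a, b}. B i j * w j) + (\<Sum>j\<in>S - {a, b}. B i j * w j)"
      unfolding mat_app_def using fin aS bS by (subst sum.subset_diff[of "{a, b}" S]) auto
    moreover have "(\<Sum>j\<in>S - {a, b}. M i j * w j) = (\<Sum>j\<in>S - {a, b}. B i j * w j)"
      by (intro sum.cong) (auto simp: M_def B_def)
    ultimately show ?thesis using neq by (simp add: M_def B_def)
  qed
  \<comment> \<open>Column \<open>a\<close> contributes \<open>V i a * x * f z a = V i a\<close>,
    exactly the source missing in \<open>f_eq\<close>, and column \<open>b\<close> contributes
    nothing because \<open>f z b = 0\<close>.\<close>
  have Mf: "mat_app S M (f z) i = l * f z i" if "i \<in> S" for i
    using that z fa by (simp add: M_app f_eq f_U[OF bU] x_def l_def)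
  have f_z0: "0 \<le> f z i" if "i \<in> S" for i using f0 z that by auto
  \<comment> \<open>Solves (I - zB) f1 = f z: it supplies the generalized part of the Jordan chain,
    with \<open>f z\<close> as its source.\<close>
  define f1 where "f1 = resolvent S B z (f z)"
  have f1_eq: "mat_app S B f1 i = l * (f1 i - f z i)" if "i \<in> S" for i
    using resolvent_eq[of "f z" i z] that f_z0 z by (simp add: f1_def l_def)
  have f1_b: "f1 b = 0"
    unfolding f1_def using resolvent_zero[of U "f z" b z] U_closed f_U bU by (auto simp: U_def)
  \<comment> \<open>The combination vanishes at \<open>a\<close>, so column \<open>a\<close> drops
    out. At \<open>b\<close> it is \<open>f1 a * h z b\<close>, which \<open>y\<close> turns into
    \<open>f1 a\<close> and thus cancels the source of \<open>h\<close>. Only the source of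
    \<open>f1\<close> is left, a positive multiple of the eigenvector \<open>f z\<close>.\<close>
  define q where "q = (\<lambda>i. f1 a * h z i - h z a * f1 i)"
  have Bq: "mat_app S B q i = f1 a * mat_app S B (h z) i - h z a * mat_app S B f1 i" for i
    by (simp add: q_def mat_app_def right_diff_distrib sum_subtractf sum_distrib_left mult_ac)
  have Mq: "mat_app S M q i = l * q i + l * h z a * f z i" if "i \<in> S" for i
    using that z hb by (simp add: M_app Bq h_eq f1_eq f1_b)
      (simp add: q_def f1_b l_def y_def algebra_simps)
  have powq: "(mat_app S M ^^ k) q i = l ^ k * (q i + real k * (h z a * f z i))" if "i \<in> S" for k i
    using that
  proof (induction k arbitrary: i)
    case (Suc k)
    have "(mat_app S M ^^ Suc k) q i = mat_app S M (\<lambda>j. l ^ k * (q j + real k * (h z a * f z j))) i"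
      using Suc.IH by (simp cong: mat_app_cong)
    also have "\<dots> = l ^ k * (mat_app S M q i + real k * (h z a * mat_app S M (f z) i))"
      by (simp only: mat_app_scale mat_app_add)
    finally show ?case using Suc.prems by (simp add: Mq Mf algebra_simps)
  qed simp
  \<comment> \<open>Dividing by \<open>K\<close> puts \<open>q\<close> below the constant vector 1,
    so the linear growth of the Jordan chain is inherited by the row sums of the powers.\<close>
  define K where "K = 1 + (\<Sum>j\<in>S. \<bar>q j\<bar>)"
  have K0: "0 < K" unfolding K_def by (smt (verit) sum_nonneg abs_ge_zero)
  have Kq: "q j \<le> K * 1" if "j \<in> S" for j
    using member_le_sum[of j S "\<lambda>j. \<bar>q j\<bar>"] that fin by (simp add: K_def)
  show ?thesis
  proof (rule that[of x y l "h z a * f z a / K" "- q a / K"])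
    show "0 < h z a * f z a / K" using ha fa K0 by simp
    fix k
    have "l ^ k * (q a + real k * (h z a * f z a)) = (mat_app S M ^^ k) q a"
      using powq aS by simp
    also have "\<dots> \<le> (mat_app S M ^^ k) (\<lambda>j. K * 1) a"
      using Kq M0 aS by (intro mat_pow_mono) auto
    also have "\<dots> = K * (mat_app S M ^^ k) (\<lambda>_. 1) a"
      by (simp only: mat_pow_scale)
    finally show "(real k * (h z a * f z a / K) - - q a / K) * l ^ k
      \<le> (mat_app S (\<lambda>i j. V i j * (if j = a then x else if j = b then y else 1)) ^^ k) (\<lambda>_. 1) a"
      using K0 by (simp add: M_def field_simps)
  next
    fix l' :: real assume l': "l < l'"
    define t where "t = 1 / l'"
    have "0 < l'" using l' xyl by linarith
    then have t: "0 < t" "t < z"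
      using l' z by (auto simp: t_def l_def divide_less_eq less_divide_eq mult.commute)
    \<comment> \<open>The return weights \<open>x * f t a\<close> and \<open>y * h t b\<close> equal
      1 at \<open>t = z\<close>; the explicit factor \<open>t\<close> pushes them strictly below 1
      for smaller \<open>t\<close>, and the denominators below become positive.\<close>
    have "f t a \<le> t / z * f z a"
      unfolding f_def using t z Va aS by (auto intro!: mult_left_mono resolvent_mono)
    then have xf: "x * f t a < 1"
      using fa t z mult_strict_right_mono[of "t / z" 1 "f z a"] by (simp add: x_def)
    have "h t b \<le> t / z * h z b"
      unfolding h_def using t z Vb bS by (auto intro!: mult_left_mono resolvent_mono)
    then have yh: "y * h t b < 1"
      using hb t z mult_strict_right_mono[of "t / z" 1 "h z b"] by (simp add: y_def)
    define N where "N = resolvent S B t (\<lambda>_. 1)"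
    have N1: "1 \<le> N i" if "i \<in> S" for i
      unfolding N_def using resolvent_ge[of "\<lambda>_. 1" i t] that t by simp
    have N_eq: "mat_app S B N i = (N i - 1) / t" if "i \<in> S" for i
      unfolding N_def using resolvent_eq[of "\<lambda>_. 1" i t] that t by simp
    \<comment> \<open>The vector \<open>w\<close> is to solve w = 1 + tMw. This forces \<beta> = y *
      w b and \<alpha> = x * w a; since \<open>f t b = 0\<close>, the first equation determines
      \<beta> alone and the second then gives \<alpha>. As w is at least 1, it majorizes the growth
      of the vector 1.\<close>
    define \<beta> where "\<beta> = y * N b / (1 - y * h t b)"
    define \<alpha> where "\<alpha> = (x * N a + \<beta> * x * h t a) / (1 - x * f t a)"
    have \<beta>: "0 \<le> \<beta>" "\<beta> * (1 - y * h t b) = y * N b"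
      using yh N1[OF bS] xyl by (auto simp: \<beta>_def)
    have \<alpha>: "0 \<le> \<alpha>" "\<alpha> * (1 - x * f t a) = x * N a + \<beta> * x * h t a"
      using xf N1[OF aS] xyl \<beta> h0[OF aS] t by (auto simp: \<alpha>_def)
    define w where "w = (\<lambda>i. \<alpha> * f t i + (\<beta> * h t i + N i))"
    have Mw: "mat_app S M w i \<le> l' * w i" if "i \<in> S" for i
    proof -
      have "mat_app S M w i = V i a * x * w a + V i b * y * w b
          + (\<alpha> * (f t i / t - V i a) + (\<beta> * (h t i / t - V i b) + (N i - 1) / t))"
        using that t unfolding M_app[of w]
        by (simp add: w_def mat_app_add mat_app_scale f_eq h_eq N_eq)
      also have "\<dots> = l' * w i - l'
          + V i a * (x * N a + \<beta> * x * h t a - \<alpha> * (1 - x * f t a))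
          + V i b * (y * N b - \<beta> * (1 - y * h t b))"
        using f_U[OF bU] by (simp add: w_def t_def algebra_simps)
      also have "\<dots> = l' * w i - l'" unfolding \<alpha> \<beta> by simp
      finally show ?thesis using l' xyl by simp
    qed
    have w1: "1 \<le> w i" if "i \<in> S" for i
      using N1[OF that] f0[OF that] h0[OF that] \<alpha>(1) \<beta>(1) t by (auto simp: w_def add_nonneg_nonneg add_increasing)
    have pow: "(mat_app S M ^^ k) (\<lambda>_. 1) i \<le> l' ^ k * w i" if "i \<in> S" for k i
      using that
    proof (induction k arbitrary: i)
      case (Suc k)
      have "(mat_app S M ^^ Suc k) (\<lambda>_. 1) i \<le> mat_app S M (\<lambda>j. l' ^ k * w j) i"
        using Suc M0 by (auto intro!: mat_app_mono)
      also have "\<dots> = l' ^ k * mat_app S M w i" by (simp add: mat_app_scale)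
      also have "\<dots> \<le> l' ^ k * (l' * w i)"
        using Mw[OF Suc.prems] l' xyl by (intro mult_left_mono) auto
      finally show ?case by (simp add: mult_ac)
    qed (use w1 in auto)
    have "(mat_app S M ^^ k) (\<lambda>_. 1) i \<le> (\<Sum>i\<in>S. w i) * l' ^ k" if "i \<in> S" for k i
    proof -
      have "w i \<le> (\<Sum>i\<in>S. w i)"
        using that fin w1 by (intro member_le_sum) (force simp: intro: order_trans[of 0 1])+
      then have "l' ^ k * w i \<le> l' ^ k * (\<Sum>i\<in>S. w i)"
        using l' xyl by (intro mult_left_mono) auto
      then show ?thesis using pow[OF that, of k] by (simp add: mult_ac)
    qed
    then show "\<exists>K. \<forall>k. \<forall>i\<in>S.
      (mat_app S (\<lambda>i j. V i j * (if j = a then x else if j = b then y else 1)) ^^ k) (\<lambda>_. 1) i \<le> K * l' ^ k"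
      unfolding M_def by blast
  qed (use xyl in auto)
qed

section \<open>Perron-Frobenius eigenvectors\<close>

lemma mat_pow_pos:
  assumes fin: "finite S" and Q0: "\<And>i j. i \<in> S \<Longrightarrow> j \<in> S \<Longrightarrow> 0 \<le> Q i j"
    and f0: "\<And>j. j \<in> S \<Longrightarrow> 0 \<le> f j"
    and path: "(i, j) \<in> {(i, j). i \<in> S \<and> j \<in> S \<and> 0 < Q i j}\<^sup>+" and "0 < f j"
  shows "\<exists>k. 0 < (mat_app S Q ^^ k) f i"
  using path
proof (induction rule: converse_trancl_induct)
  case (base i)
  then have "0 < Q i j * f j" using \<open>0 < f j\<close> by simp
  also have "\<dots> \<le> mat_app S Q f i" using base fin f0 Q0 by (intro mat_app_ge_term) auto
  finally have "0 < (mat_app S Q ^^ 1) f i" by simp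
  then show ?case by blast
next
  case (step i i')
  then obtain k where k: "0 < (mat_app S Q ^^ k) f i'" by auto
  then have "0 < Q i i' * (mat_app S Q ^^ k) f i'" using step by simp
  also have "\<dots> \<le> mat_app S Q ((mat_app S Q ^^ k) f) i"
    using step fin Q0 f0 by (intro mat_app_ge_term mat_pow_nonneg) auto
  finally have "0 < (mat_app S Q ^^ Suc k) f i" by simp
  then show ?case by blast
qed

text \<open>The Perron root as a maximum: the pairs of a ratio \<rho> and a normalized vector with
  \<rho> r \<le> Qr form a compact set, since summing the inequalities bounds \<rho> by the sum of
  all entries.\<close>

lemma collatz_wielandt_max:
  fixes Q :: "'b \<Rightarrow> 'b \<Rightarrow> real"
  assumes fin: "finite S" and "S \<noteq> {}" and "\<forall>i\<in>S. \<forall>j\<in>S. 0 \<le> Q i j"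
  shows "\<exists>\<rho> r. (\<forall>i\<in>S. 0 \<le> r i) \<and> (\<Sum>i\<in>S. r i) = 1 \<and> (\<forall>i\<in>S. \<rho> * r i \<le> mat_app S Q r i) \<and>
    (\<forall>\<rho>' r'. (\<forall>i\<in>S. 0 \<le> r' i) \<longrightarrow> 0 < (\<Sum>i\<in>S. r' i) \<longrightarrow>
      (\<forall>i\<in>S. \<rho>' * r' i \<le> mat_app S Q r' i) \<longrightarrow> \<rho>' \<le> \<rho>)"
proof -
  have Q0: "0 \<le> Q i j" if "i \<in> S" "j \<in> S" for i j using assms(3) that by blast
  define R where "R = (\<Sum>i\<in>S. \<Sum>j\<in>S. Q i j)"
  have R0: "0 \<le> R" unfolding R_def by (intro sum_nonneg Q0)
  \<comment> \<open>Coordinates outside \<open>S\<close> are pinned to 0, so that this set of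
    functions on the whole type is a product of compact sets.\<close>
  define D where "D = PiE UNIV (\<lambda>i. if i \<in> S then {0..1} else {0::real})"
  define K where "K = ({0..R} \<times> D) \<inter> ({q. (\<Sum>i\<in>S. snd q i) = 1}
    \<inter> (\<Inter>i\<in>S. {q. fst q * snd q i \<le> mat_app S Q (snd q) i}))"
  have "compactin (product_topology (\<lambda>_. euclidean) UNIV) D"
    unfolding D_def compactin_PiE by auto
  then have "compact D" by (simp add: euclidean_product_topology)
  have cont: "continuous_on UNIV (\<lambda>q :: real \<times> ('b \<Rightarrow> real). snd q i)" for i
    by (rule continuous_on_compose2[OF continuous_on_product_coordinates continuous_on_snd]) auto
  have "closed {q :: real \<times> ('b \<Rightarrow> real). (\<Sum>i\<in>S. snd q i) = 1}"
    by (intro closed_Collect_eq continuous_intros cont)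
  moreover have "closed {q :: real \<times> ('b \<Rightarrow> real). fst q * snd q i \<le> mat_app S Q (snd q) i}" for i
    unfolding mat_app_def by (intro closed_Collect_le continuous_intros cont)
  ultimately have "compact K"
    unfolding K_def using \<open>compact D\<close> by (intro compact_Int_closed compact_Times closed_Int closed_INT) auto
  obtain s where s: "s \<in> S" using assms by auto
  have "(0, \<lambda>i. if i = s then 1 else 0) \<in> K"
    using s R0 fin Q0 by (auto simp: K_def D_def mat_app_def intro!: sum_nonneg)
  then have "K \<noteq> {}" by auto
  then obtain q where q: "q \<in> K" "\<And>q'. q' \<in> K \<Longrightarrow> fst q' \<le> fst q"
    using continuous_attains_sup[OF \<open>compact K\<close> _ continuous_on_fst[OF continuous_on_id]] by blast
  show ?thesis
  proof (intro exI[of _ "fst q"] exI[of _ "snd q"] conjI allI impI)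
    show "\<forall>i\<in>S. 0 \<le> snd q i"
      using q(1) by (auto simp: K_def D_def mem_Times_iff PiE_def Pi_def split: if_splits)
    show "(\<Sum>i\<in>S. snd q i) = 1" "\<forall>i\<in>S. fst q * snd q i \<le> mat_app S Q (snd q) i"
      using q(1) by (auto simp: K_def)
    fix \<rho>' r'
    assume "\<forall>i\<in>S. 0 \<le> r' i" "0 < (\<Sum>i\<in>S. r' i)" "\<forall>i\<in>S. \<rho>' * r' i \<le> mat_app S Q r' i"
    then have r': "\<And>i. i \<in> S \<Longrightarrow> 0 \<le> r' i" "0 < (\<Sum>i\<in>S. r' i)"
      "\<And>i. i \<in> S \<Longrightarrow> \<rho>' * r' i \<le> mat_app S Q r' i" by auto
    have "0 \<le> fst q" using q(1) by (auto simp: K_def)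
    show "\<rho>' \<le> fst q"
    proof (cases "\<rho>' \<le> 0")
      case False
      define c where "c = 1 / (\<Sum>i\<in>S. r' i)"
      define r where "r = (\<lambda>i. if i \<in> S then c * r' i else 0)"
      have c: "0 < c" using r' by (simp add: c_def)
      have r0: "0 \<le> r i" for i using c r' by (simp add: r_def)
      have "(\<Sum>i\<in>S. r i) = c * (\<Sum>i\<in>S. r' i)" by (simp add: r_def sum_distrib_left)
      then have r1: "(\<Sum>i\<in>S. r i) = 1" using r' by (simp add: c_def)
      have rle: "r i \<le> 1" if "i \<in> S" for i
        using member_le_sum[OF that, of r] r0 fin r1 by simp
      have app: "mat_app S Q r i = c * mat_app S Q r' i" for i
        by (simp add: r_def mat_app_def sum_distrib_left mult_ac)
      have le: "\<rho>' * r i \<le> mat_app S Q r i" if "i \<in> S" for i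
        using r'(3)[OF that] c that by (simp add: app) (simp add: r_def mult_ac)
      have "\<rho>' = (\<Sum>i\<in>S. \<rho>' * r i)" by (simp add: r1 flip: sum_distrib_left)
      also have "\<dots> \<le> (\<Sum>i\<in>S. \<Sum>j\<in>S. Q i j * r j)"
        using le by (intro sum_mono) (simp add: mat_app_def)
      also have "\<dots> \<le> (\<Sum>i\<in>S. \<Sum>j\<in>S. Q i j * 1)"
        using rle Q0 by (intro sum_mono mult_left_mono) auto
      finally have "\<rho>' \<le> R" by (simp add: R_def)
      then have "(\<rho>', r) \<in> K"
        using False r1 le r0 rle by (auto simp: K_def D_def) (simp add: r_def)
      then show ?thesis using q(2) by force
    qed (use \<open>0 \<le> fst q\<close> in simp)
  qed
qed

text \<open>If the maximizer had a strict inequality somewhere, irreducibility would spread the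
  excess to every state and \<rho> could be increased. Positivity of the eigenvector follows from
  irreducibility in the same way.\<close>

lemma perron_eigenvector:
  fixes Q :: "'b \<Rightarrow> 'b \<Rightarrow> real"
  assumes fin: "finite S" and ne: "S \<noteq> {}" and Q0: "\<And>i j. i \<in> S \<Longrightarrow> j \<in> S \<Longrightarrow> 0 \<le> Q i j"
    and irred: "\<And>i j. i \<in> S \<Longrightarrow> j \<in> S \<Longrightarrow> (i, j) \<in> {(i, j). i \<in> S \<and> j \<in> S \<and> 0 < Q i j}\<^sup>+"
  shows "\<exists>\<rho> r. 0 < \<rho> \<and> (\<forall>i\<in>S. 0 < r i) \<and> (\<forall>i\<in>S. mat_app S Q r i = \<rho> * r i)"
proof -
  obtain \<rho> r where "\<forall>i\<in>S. 0 \<le> r i" and r1: "(\<Sum>i\<in>S. r i) = 1"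
    and "\<forall>i\<in>S. \<rho> * r i \<le> mat_app S Q r i"
    and max: "\<forall>\<rho>' r'. (\<forall>i\<in>S. 0 \<le> r' i) \<longrightarrow> 0 < (\<Sum>i\<in>S. r' i) \<longrightarrow>
      (\<forall>i\<in>S. \<rho>' * r' i \<le> mat_app S Q r' i) \<longrightarrow> \<rho>' \<le> \<rho>"
    using collatz_wielandt_max[OF fin ne, of Q] Q0 by blast
  then have r: "\<And>i. i \<in> S \<Longrightarrow> 0 \<le> r i" "(\<Sum>i\<in>S. r i) = 1"
    "\<And>i. i \<in> S \<Longrightarrow> \<rho> * r i \<le> mat_app S Q r i" by auto
  have eig: "mat_app S Q r i = \<rho> * r i" if i: "i \<in> S" for i
  proof (rule ccontr)
    assume "mat_app S Q r i \<noteq> \<rho> * r i"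
    define d where "d = (\<lambda>j. mat_app S Q r j - \<rho> * r j)"
    have d0: "0 \<le> d j" if "j \<in> S" for j using r that by (simp add: d_def)
    have di: "0 < d i" using \<open>mat_app S Q r i \<noteq> \<rho> * r i\<close> d0[OF i] by (simp add: d_def)
    have "\<forall>j\<in>S. \<exists>k. 0 < (mat_app S Q ^^ k) d j"
      using mat_pow_pos[of S Q d, OF fin Q0 d0 irred[OF _ i] di] by auto
    then obtain n where n: "\<And>j. j \<in> S \<Longrightarrow> 0 < (mat_app S Q ^^ n j) d j" by metis
    define N where "N = Max (n ` S)"
    have nN: "n j \<le> N" if "j \<in> S" for j using fin that by (simp add: N_def)
    \<comment> \<open>This is I + Q + ... + Q^N. The sum is used instead of a single power because
      \<open>Q\<close> may be periodic; it commutes with \<open>Q\<close> and makes the excess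
      \<open>d\<close> positive everywhere.\<close>
    define T where "T f = (\<lambda>j. \<Sum>k\<le>N. (mat_app S Q ^^ k) f j)" for f
    have powd: "(mat_app S Q ^^ k) d j = (mat_app S Q ^^ Suc k) r j - \<rho> * (mat_app S Q ^^ k) r j" for k j
    proof (induction k arbitrary: j)
      case (Suc k)
      have "(mat_app S Q ^^ Suc k) d j
          = mat_app S Q (\<lambda>j. (mat_app S Q ^^ Suc k) r j + (- \<rho>) * (mat_app S Q ^^ k) r j) j"
        using ext[of "(mat_app S Q ^^ k) d", OF Suc.IH] by simp
      also have "\<dots> = mat_app S Q ((mat_app S Q ^^ Suc k) r) j + (- \<rho>) * mat_app S Q ((mat_app S Q ^^ k) r) j"
        by (simp only: mat_app_add mat_app_scale)
      finally show ?case by simp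
    qed (simp add: d_def)
    have Td: "T d j = mat_app S Q (T r) j - \<rho> * T r j" for j
    proof -
      have "mat_app S Q (T r) j = (\<Sum>i\<in>S. \<Sum>k\<le>N. Q j i * (mat_app S Q ^^ k) r i)"
        unfolding T_def mat_app_def[of S Q "\<lambda>j. \<Sum>k\<le>N. (mat_app S Q ^^ k) r j"]
        by (simp only: sum_distrib_left)
      also have "\<dots> = (\<Sum>k\<le>N. \<Sum>i\<in>S. Q j i * (mat_app S Q ^^ k) r i)"
        by (rule sum.swap)
      also have "\<dots> = (\<Sum>k\<le>N. mat_app S Q ((mat_app S Q ^^ k) r) j)"
        unfolding mat_app_def[of S Q "(mat_app S Q ^^ _) r"] ..
      finally have "mat_app S Q (T r) j = (\<Sum>k\<le>N. mat_app S Q ((mat_app S Q ^^ k) r) j)" .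
      then show ?thesis by (simp add: T_def powd sum_subtractf sum_distrib_left)
    qed
    have Td_pos: "0 < T d j" if "j \<in> S" for j
    proof -
      have "(mat_app S Q ^^ n j) d j \<le> T d j"
        unfolding T_def using nN that Q0 d0 by (intro member_le_sum mat_pow_nonneg) auto
      then show ?thesis using n[OF that] by linarith
    qed
    have Tr: "r j \<le> T r j" if "j \<in> S" for j
      unfolding T_def using member_le_sum[of 0 "{..N}" "\<lambda>k. (mat_app S Q ^^ k) r j"] that Q0 r
      by (auto intro: mat_pow_nonneg)
    have Tr0: "0 \<le> T r j" if "j \<in> S" for j using Tr[OF that] r(1)[OF that] by simp
    have "(\<Sum>j\<in>S. r j) \<le> (\<Sum>j\<in>S. T r j)" by (intro sum_mono Tr)
    then have Tsum: "0 < (\<Sum>j\<in>S. T r j)" using r(2) by simp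
    \<comment> \<open>The smallest excess divided by an upper bound for the entries of
      \<open>T r\<close>, hence an amount by which \<rho> can be raised.\<close>
    define e where "e = Min ((T d) ` S) / (\<Sum>j\<in>S. T r j)"
    have e: "0 < e" unfolding e_def using Td_pos Tsum fin ne by simp
    have "(\<rho> + e) * T r j \<le> mat_app S Q (T r) j" if "j \<in> S" for j
    proof -
      have "e * T r j \<le> e * (\<Sum>j\<in>S. T r j)"
        using e Tr0 that fin by (intro mult_left_mono member_le_sum) auto
      also have "\<dots> = Min ((T d) ` S)" using Tsum by (simp add: e_def)
      also have "\<dots> \<le> T d j" using fin that by simp
      finally show ?thesis by (simp add: Td algebra_simps)
    qed
    then have "\<rho> + e \<le> \<rho>" using Tr0 Tsum by (intro max[rule_format]) auto
    then show False using e by simp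
  qed
  obtain j where j: "j \<in> S" "0 < r j"
    using r(1,2) by (metis less_eq_real_def sum.neutral zero_neq_one)
  have pow: "(mat_app S Q ^^ k) r i = \<rho> ^ k * r i" if "i \<in> S" for k i
    using that
  proof (induction k arbitrary: i)
    case (Suc k)
    have "(mat_app S Q ^^ Suc k) r i = mat_app S Q (\<lambda>j. \<rho> ^ k * r j) i"
      using Suc.IH by (simp cong: mat_app_cong)
    then show ?case using eig[OF Suc.prems] by (simp add: mat_app_scale)
  qed simp
  have rpos: "0 < r i" if iS: "i \<in> S" for i
  proof -
    obtain k where "0 < (mat_app S Q ^^ k) r i"
      using mat_pow_pos[of S Q r, OF fin Q0 r(1) irred[OF iS j(1)] j(2)] by auto
    then have "r i \<noteq> 0" using pow[OF iS] by auto
    then show ?thesis using r(1)[OF iS] by simp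
  qed
  have "0 < \<rho>"
  proof -
    obtain i where "i \<in> S" "0 < Q j i" using irred[OF j(1) j(1)] by (auto elim: converse_tranclE)
    then have "0 < mat_app S Q r j"
      using mat_app_ge_term[of S r Q j i] fin rpos Q0 j by (smt (verit) mult_pos_pos r(1))
    then show ?thesis using eig[OF j(1)] j by (simp add: zero_less_mult_iff)
  qed
  then show ?thesis using rpos eig by blast
qed

text \<open>Evaluating the product lQr from both sides shows that \<open>Q\<close> and its transpose
  have the same eigenvalue. The normalization makes the products \<open>l i * r i\<close> a
  probability vector, the stationary one of the chain built later.\<close>

lemma perron_pair:
  fixes Q :: "'b \<Rightarrow> 'b \<Rightarrow> real"
  assumes fin: "finite S" and ne: "S \<noteq> {}" and Q0: "\<And>i j. i \<in> S \<Longrightarrow> j \<in> S \<Longrightarrow> 0 \<le> Q i j"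
    and irred: "\<And>i j. i \<in> S \<Longrightarrow> j \<in> S \<Longrightarrow> (i, j) \<in> {(i, j). i \<in> S \<and> j \<in> S \<and> 0 < Q i j}\<^sup>+"
  obtains \<rho> r l where "0 < \<rho>" "\<And>i. i \<in> S \<Longrightarrow> 0 < r i" "\<And>i. i \<in> S \<Longrightarrow> 0 < l i"
    "\<And>i. i \<in> S \<Longrightarrow> (\<Sum>j\<in>S. Q i j * r j) = \<rho> * r i"
    "\<And>j. j \<in> S \<Longrightarrow> (\<Sum>i\<in>S. l i * Q i j) = \<rho> * l j"
    "(\<Sum>i\<in>S. l i * r i) = 1"
proof -
  obtain \<rho> r where r: "0 < \<rho>" "\<And>i. i \<in> S \<Longrightarrow> 0 < r i" "\<And>i. i \<in> S \<Longrightarrow> mat_app S Q r i = \<rho> * r i"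
    using perron_eigenvector[of S Q] fin ne Q0 irred by blast
  let ?E = "{(i, j). i \<in> S \<and> j \<in> S \<and> 0 < Q i j}"
  have conv: "{(i, j). i \<in> S \<and> j \<in> S \<and> 0 < Q j i} = ?E\<inverse>" by auto
  have "(i, j) \<in> {(i, j). i \<in> S \<and> j \<in> S \<and> 0 < Q j i}\<^sup>+" if "i \<in> S" "j \<in> S" for i j
    unfolding conv trancl_converse using irred[of j i] that by simp
  then have "\<exists>\<rho>' l. 0 < \<rho>' \<and> (\<forall>i\<in>S. 0 < l i) \<and> (\<forall>i\<in>S. mat_app S (\<lambda>i j. Q j i) l i = \<rho>' * l i)"
    using fin ne Q0 by (intro perron_eigenvector) auto
  then obtain \<rho>' l where l: "0 < \<rho>'" "\<And>i. i \<in> S \<Longrightarrow> 0 < l i"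
    "\<And>i. i \<in> S \<Longrightarrow> mat_app S (\<lambda>i j. Q j i) l i = \<rho>' * l i"
    by blast
  define c where "c = (\<Sum>i\<in>S. l i * r i)"
  have c: "0 < c" unfolding c_def using fin ne l r by (intro sum_pos mult_pos_pos) auto
  have "\<rho> * c = (\<Sum>i\<in>S. l i * mat_app S Q r i)"
    using r by (simp add: c_def sum_distrib_left mult_ac)
  also have "\<dots> = (\<Sum>j\<in>S. mat_app S (\<lambda>i j. Q j i) l j * r j)"
    by (simp add: mat_app_def sum_distrib_left sum_distrib_right) (subst sum.swap, simp add: mult_ac)
  also have "\<dots> = \<rho>' * c"
    using l by (simp add: c_def sum_distrib_left mult_ac)
  finally have eq: "\<rho>' = \<rho>" using c by simp
  show ?thesis
  proof (rule that[of \<rho> r "\<lambda>i. l i / c"])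
    show "(\<Sum>i\<in>S. l i / c * Q i j) = \<rho> * (l j / c)" if "j \<in> S" for j
    proof -
      have "(\<Sum>i\<in>S. l i / c * Q i j) = mat_app S (\<lambda>i j. Q j i) l j / c"
        by (simp add: mat_app_def sum_divide_distrib mult_ac)
      then show ?thesis using l(3)[OF that] eq by simp
    qed
    show "(\<Sum>i\<in>S. l i / c * r i) = 1"
      using c by (simp add: c_def flip: sum_divide_distrib)
  qed (use r l c in \<open>auto simp: mat_app_def\<close>)
qed

section \<open>Two-sided stationary Markov chains\<close>

definition chain_weight :: "('b \<Rightarrow> real) \<Rightarrow> ('b \<Rightarrow> 'b \<Rightarrow> real) \<Rightarrow> 'b list \<Rightarrow> real" where
  "chain_weight p P w = p (hd w) * (\<Prod>k<length w - 1. P (w ! k) (w ! Suc k))"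

locale stationary_chain =
  fixes B :: "nat set" and p :: "nat \<Rightarrow> real" and P :: "nat \<Rightarrow> nat \<Rightarrow> real"
  assumes finB: "finite B" and p: "probability_vector B p" and P: "stochastic_matrix B P"
    and stationary: "\<And>j. j \<in> B \<Longrightarrow> (\<Sum>i\<in>B. p i * P i j) = p j"
begin

abbreviation "wt \<equiv> chain_weight p P"

definition words :: "nat \<Rightarrow> nat list set" where
  "words n = {w. set w \<subseteq> B \<and> length w = n}"

lemma finite_words: "finite (words n)"
  unfolding words_def using finite_lists_length_eq[OF finB] .

lemma wt_nonneg:
  assumes "w \<in> words n" "1 \<le> n" shows "0 \<le> wt w"
proof -
  have "hd w \<in> B" using assms by (cases w) (auto simp: words_def)
  then show ?thesis
    using p P assms unfolding chain_weight_def
    by (intro mult_nonneg_nonneg prod_nonneg)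
      (auto simp: words_def stochastic_matrix_def probability_vector_def subset_iff)
qed

lemma wt_snoc:
  assumes "w \<noteq> []" shows "wt (w @ [y]) = wt w * P (last w) y"
proof -
  have "length w = Suc (length w - 1)" using assms by simp
  then obtain m where m: "length w = Suc m" by blast
  show ?thesis using assms m
    by (auto simp: chain_weight_def nth_append last_conv_nth intro!: prod.cong)
qed

lemma wt_Cons:
  assumes "w \<noteq> []" shows "wt (x # w) = p x * P x (hd w) * (\<Prod>k<length w - 1. P (w ! k) (w ! Suc k))"
proof -
  obtain m where m: "length w = Suc m" using assms by (cases w) auto
  show ?thesis using assms m
    by (simp add: chain_weight_def prod.lessThan_Suc_shift hd_conv_nth del: prod.lessThan_Suc)
qed

lemma sum_snoc:
  assumes "w \<in> words n" "1 \<le> n" shows "(\<Sum>y\<in>B. wt (w @ [y])) = wt w"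
proof -
  have w: "w \<noteq> []" "last w \<in> B" using assms by (auto simp: words_def dest!: subsetD[OF _ last_in_set])
  then have "(\<Sum>y\<in>B. P (last w) y) = 1" using P by (auto simp: stochastic_matrix_def probability_vector_def)
  then show ?thesis using w by (simp add: wt_snoc flip: sum_distrib_left)
qed

text \<open>Stationarity enters here. Together with \<open>sum_snoc\<close>, which rests on the row
  sums of \<open>P\<close>, it makes the laws of words consistent under shortening at either end, as
  a two-sided process requires.\<close>

lemma sum_Cons:
  assumes "w \<in> words n" "1 \<le> n" shows "(\<Sum>x\<in>B. wt (x # w)) = wt w"
proof -
  have w: "w \<noteq> []" "hd w \<in> B" using assms by (cases w; auto simp: words_def)+
  have "(\<Sum>x\<in>B. wt (x # w)) = (\<Sum>x\<in>B. p x * P x (hd w)) * (\<Prod>k<length w - 1. P (w ! k) (w ! Suc k))"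
    using w by (simp only: wt_Cons sum_distrib_right not_False_eq_True)
  then show ?thesis using stationary[OF w(2)] by (simp add: chain_weight_def)
qed

lemma sum_words_Suc:
  "(\<Sum>w\<in>words (Suc n). f w) = (\<Sum>w\<in>words n. \<Sum>y\<in>B. f (w @ [y]))"
proof -
  have "(\<Sum>w\<in>words n. \<Sum>y\<in>B. f (w @ [y])) = (\<Sum>(w, y)\<in>words n \<times> B. f (w @ [y]))"
    by (simp add: sum.cartesian_product)
  also have "\<dots> = (\<Sum>w\<in>words (Suc n). f w)"
    by (rule sum.reindex_bij_witness[of _ "\<lambda>w. (butlast w, last w)" "\<lambda>(w, y). w @ [y]"])
      (auto simp: words_def dest: in_set_butlastD intro!: append_butlast_last_id
        subsetD[OF _ last_in_set])
  finally show ?thesis by simp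
qed

lemma sum_wt: "(\<Sum>w\<in>words (Suc n). wt w) = 1"
proof (induction n)
  case 0
  have "words 0 = {[]}" by (auto simp: words_def)
  then show ?case using p by (simp add: sum_words_Suc chain_weight_def probability_vector_def)
next
  case (Suc n)
  then show ?case by (subst sum_words_Suc) (simp add: sum_snoc)
qed

section \<open>Laws of finite paths and their consistency\<close>

definition path_pmf :: "nat \<Rightarrow> nat list pmf" where
  "path_pmf n = embed_pmf (\<lambda>w. if w \<in> words n then wt w else 0)"

lemma pmf_path_pmf:
  assumes "1 \<le> n" shows "pmf (path_pmf n) w = (if w \<in> words n then wt w else 0)"
  unfolding path_pmf_def
proof (rule pmf_embed_pmf)
  obtain m where m: "n = Suc m" using assms by (cases n) auto
  have "(\<integral>\<^sup>+ w. ennreal (if w \<in> words n then wt w else 0) \<partial>count_space UNIV)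
      = (\<Sum>w\<in>words n. ennreal (if w \<in> words n then wt w else 0))"
    by (rule nn_integral_count_space'[OF finite_words]) auto
  also have "\<dots> = ennreal (\<Sum>w\<in>words n. wt w)"
    using wt_nonneg assms by (subst sum_ennreal[symmetric]) auto
  also have "\<dots> = 1" using sum_wt by (simp add: m)
  finally show "(\<integral>\<^sup>+ w. ennreal (if w \<in> words n then wt w else 0) \<partial>count_space UNIV) = 1" .
qed (use wt_nonneg assms in auto)

lemma set_path_pmf: "1 \<le> n \<Longrightarrow> set_pmf (path_pmf n) \<subseteq> words n"
  by (auto simp: set_pmf_eq pmf_path_pmf split: if_splits)

lemma pmf_map_path_pmf:
  assumes "1 \<le> n" "1 \<le> m"
    and "\<And>v. v \<in> words m \<Longrightarrow> (\<Sum>w\<in>{w \<in> words n. f w = v}. wt w) = wt v"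
    and "f ` words n \<subseteq> words m"
  shows "map_pmf f (path_pmf n) = path_pmf m"
proof (rule pmf_eqI)
  fix v
  have "pmf (map_pmf f (path_pmf n)) v = measure (path_pmf n) (f -` {v})" by (rule pmf_map)
  also have "\<dots> = measure (path_pmf n) {w \<in> words n. f w = v}"
    using set_path_pmf[OF assms(1)] by (intro measure_eq_AE) (auto simp: AE_measure_pmf_iff)
  also have "\<dots> = (\<Sum>w\<in>{w \<in> words n. f w = v}. wt w)"
    using finite_words assms by (subst measure_measure_pmf_finite) (auto simp: pmf_path_pmf)
  also have "\<dots> = pmf (path_pmf m) v"
    using assms by (auto simp: pmf_path_pmf intro!: sum.neutral)
  finally show "pmf (map_pmf f (path_pmf n)) v = pmf (path_pmf m) v" .
qed

lemma map_butlast_path_pmf: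
  assumes "1 \<le> n" shows "map_pmf butlast (path_pmf (Suc n)) = path_pmf n"
proof (rule pmf_map_path_pmf)
  fix v assume v: "v \<in> words n"
  have "{w \<in> words (Suc n). butlast w = v} = (\<lambda>y. v @ [y]) ` B"
  proof (intro equalityI subsetI)
    fix w assume "w \<in> {w \<in> words (Suc n). butlast w = v}"
    then have w: "set w \<subseteq> B" "w \<noteq> []" "butlast w = v" by (auto simp: words_def)
    then have "w = v @ [last w]" "last w \<in> B" by auto
    then show "w \<in> (\<lambda>y. v @ [y]) ` B" by blast
  qed (use v in \<open>auto simp: words_def\<close>)
  then show "(\<Sum>w\<in>{w \<in> words (Suc n). butlast w = v}. wt w) = wt v"
    using sum_snoc[OF v assms] by (simp add: sum.reindex inj_on_def)
qed (use assms in \<open>auto simp: words_def dest: in_set_butlastD\<close>)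

lemma map_tl_path_pmf:
  assumes "1 \<le> n" shows "map_pmf tl (path_pmf (Suc n)) = path_pmf n"
proof (rule pmf_map_path_pmf)
  fix v assume v: "v \<in> words n"
  have "{w \<in> words (Suc n). tl w = v} = (\<lambda>y. y # v) ` B"
  proof (intro equalityI subsetI)
    fix w assume "w \<in> {w \<in> words (Suc n). tl w = v}"
    then have w: "set w \<subseteq> B" "w \<noteq> []" "tl w = v" by (auto simp: words_def)
    then have "w = hd w # v" "hd w \<in> B" by auto
    then show "w \<in> (\<lambda>y. y # v) ` B" by blast
  qed (use v in \<open>auto simp: words_def\<close>)
  then show "(\<Sum>w\<in>{w \<in> words (Suc n). tl w = v}. wt w) = wt v"
    using sum_Cons[OF v assms] by (simp add: sum.reindex inj_on_def)
qed (use assms in \<open>auto simp: words_def length_Suc_conv\<close>)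

lemma map_take_path_pmf:
  assumes "1 \<le> n" shows "map_pmf (take n) (path_pmf (n + k)) = path_pmf n"
proof (induction k)
  case 0
  have "map_pmf (take n) (path_pmf n) = map_pmf id (path_pmf n)"
    using set_path_pmf[OF assms] by (intro map_pmf_cong) (auto simp: words_def)
  then show ?case by simp
next
  case (Suc k)
  have "map_pmf (take n) (path_pmf (n + Suc k)) = map_pmf (take n) (map_pmf butlast (path_pmf (Suc (n + k))))"
    unfolding pmf.map_comp using set_path_pmf[of "Suc (n + k)"]
    by (intro map_pmf_cong) (auto simp: words_def take_butlast)
  then show ?case using assms Suc by (simp add: map_butlast_path_pmf)
qed

lemma map_drop_path_pmf:
  assumes "1 \<le> n" shows "map_pmf (drop k) (path_pmf (n + k)) = path_pmf n"
proof (induction k)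
  case 0
  then show ?case by (simp add: drop_0 pmf.map_ident flip: id_def)
next
  case (Suc k)
  have "map_pmf (drop (Suc k)) (path_pmf (n + Suc k)) = map_pmf (drop k) (map_pmf tl (path_pmf (Suc (n + k))))"
    unfolding pmf.map_comp by (simp add: comp_def drop_Suc[abs_def])
  then show ?case using assms Suc by (simp add: map_tl_path_pmf)
qed

section \<open>Kolmogorov extension over the integers\<close>

definition window :: "int \<Rightarrow> int set \<Rightarrow> nat list \<Rightarrow> int \<Rightarrow> real" where
  "window s J w = (\<lambda>j\<in>J. real (w ! nat (j - s)))"

text \<open>A path of length \<open>n\<close> is placed on the interval [s, s + n), which is meant
  to contain \<open>J\<close>, and is read off on \<open>J\<close>.\<close>

definition marginal_pmf :: "int \<Rightarrow> nat \<Rightarrow> int set \<Rightarrow> (int \<Rightarrow> real) pmf" where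
  "marginal_pmf s n J = map_pmf (window s J) (path_pmf n)"

text \<open>Enlarging the interval of observation does not change the law on \<open>J\<close>: the
  path on the smaller interval arises from the longer one by cutting at both ends, and path laws are
  consistent under such cuts.\<close>

lemma marginal_pmf_mono:
  assumes "1 \<le> n" "J \<subseteq> {s..<s + int n}" "s' \<le> s" "s + int n \<le> s' + int n'"
  shows "marginal_pmf s n J = marginal_pmf s' n' J"
proof -
  define d where "d = nat (s - s')"
  obtain k where k: "n' = n + k + d" using assms by (intro that[of "n' - n - d"]) (simp add: d_def)
  have "path_pmf n = map_pmf (take n) (map_pmf (drop d) (path_pmf n'))"
    using assms by (simp add: k map_drop_path_pmf map_take_path_pmf)
  then have "marginal_pmf s n J = map_pmf (\<lambda>w. window s J (take n (drop d w))) (path_pmf n')"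
    by (simp add: marginal_pmf_def pmf.map_comp comp_def)
  also have "\<dots> = marginal_pmf s' n' J"
    unfolding marginal_pmf_def
  proof (rule map_pmf_cong[OF refl])
    fix w assume "w \<in> set_pmf (path_pmf n')"
    then have "length w = n'" using set_path_pmf[of n'] assms k by (auto simp: words_def)
    then show "window s J (take n (drop d w)) = window s' J w"
      using assms k by (auto simp: window_def fun_eq_iff nth_append d_def restrict_def subset_iff
        nat_add_distrib[symmetric] intro!: arg_cong[where f = "nth w"])
  qed
  finally show ?thesis .
qed

lemma marginal_pmf_restrict: "J \<subseteq> H \<Longrightarrow> map_pmf (\<lambda>f. restrict f J) (marginal_pmf s n H) = marginal_pmf s n J"
  unfolding marginal_pmf_def pmf.map_comp by (simp add: comp_def window_def[abs_def] Int_absorb1)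

definition radius :: "int set \<Rightarrow> nat" where
  "radius J = nat (Max (insert 0 (abs ` J)))"

lemma radius: "finite J \<Longrightarrow> J \<subseteq> {- int (radius J)..<- int (radius J) + int (2 * radius J + 1)}"
proof
  fix j assume "finite J" "j \<in> J"
  then have "\<bar>j\<bar> \<le> Max (insert 0 (abs ` J))" by (intro Max_ge) auto
  then have "\<bar>j\<bar> \<le> int (radius J)" unfolding radius_def by linarith
  then show "j \<in> {- int (radius J)..<- int (radius J) + int (2 * radius J + 1)}" by auto
qed

text \<open>The states are read as reals because the projective limit theorem needs a Polish state space.\<close>

definition marginals :: "int set \<Rightarrow> (int \<Rightarrow> real) measure" where
  "marginals J = distr (measure_pmf (marginal_pmf (- int (radius J)) (2 * radius J + 1) J)) (PiM J (\<lambda>_. borel))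
    (\<lambda>f. restrict f J)"

text \<open>The given window and the one chosen in the definition are compared through a symmetric
  window containing both.\<close>

lemma marginals_eq:
  assumes "1 \<le> n" "J \<subseteq> {s..<s + int n}"
  shows "marginals J = distr (measure_pmf (marginal_pmf s n J)) (PiM J (\<lambda>_. borel)) (\<lambda>f. restrict f J)"
proof -
  have J: "finite J" using assms(2) finite_subset by blast
  define N where "N = nat \<bar>s\<bar> + n + radius J"
  have "marginal_pmf s n J = marginal_pmf (- int N) (2 * N + 1) J"
    using assms by (intro marginal_pmf_mono) (auto simp: N_def)
  moreover have "marginal_pmf (- int (radius J)) (2 * radius J + 1) J = marginal_pmf (- int N) (2 * N + 1) J"
    using radius[OF J] by (intro marginal_pmf_mono) (auto simp: N_def)
  ultimately show ?thesis by (simp add: marginals_def)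
qed

text \<open>\<open>restrict\<close> changes nothing on the values of \<open>window\<close>, which
  are already extensional; it is inserted so that the map from a discrete space lands in the space
  of \<open>PiM\<close> everywhere.\<close>

lemma meas_restrict: "(\<lambda>f. restrict f J) \<in> measurable (measure_pmf M) (PiM J (\<lambda>_. borel :: real measure))"
  by (simp add: space_PiM)

lemma marginals_projective: "polish_projective UNIV marginals"
proof (intro polish_projective.intro projective_family.intro)
  fix J H :: "int set" assume JH: "J \<subseteq> H" "finite H"
  define s n where "s = - int (radius H)" and "n = 2 * radius H + 1"
  have n: "1 \<le> n" by (simp add: n_def)
  have H: "H \<subseteq> {s..<s + int n}" using radius[OF JH(2)] by (simp add: s_def n_def)
  have "distr (marginals H) (PiM J (\<lambda>_. borel)) (\<lambda>f. restrict f J)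
      = distr (measure_pmf (marginal_pmf s n H)) (PiM J (\<lambda>_. borel)) (\<lambda>f. restrict f J)"
    using JH H unfolding marginals_eq[OF n H]
    by (subst distr_distr) (auto simp: measurable_restrict_subset comp_def Int_absorb1 space_PiM)
  also have "\<dots> = distr (measure_pmf (map_pmf (\<lambda>f. restrict f J) (marginal_pmf s n H))) (PiM J (\<lambda>_. borel)) (\<lambda>f. restrict f J)"
    unfolding map_pmf_rep_eq by (subst distr_distr) (auto simp: comp_def space_PiM)
  also have "\<dots> = marginals J"
    using JH H by (simp only: marginal_pmf_restrict) (subst marginals_eq[of n J s], auto simp: n_def)
  finally show "marginals J = distr (marginals H) (PiM J (\<lambda>_. borel)) (\<lambda>f. restrict f J)" ..
next
  show "prob_space (marginals J)" for J
    unfolding marginals_def by (intro measure_pmf.prob_space_distr meas_restrict)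
qed

sublocale lim: polish_projective UNIV marginals
  by (rule marginals_projective)

definition chain_measure :: "(int \<Rightarrow> nat) measure" where
  "chain_measure = distr lim.lim borel (\<lambda>f i. nat \<lfloor>f i\<rfloor>)"

lemma sets_borel_int_nat: "sets (borel :: (int \<Rightarrow> nat) measure) = sets (PiM UNIV (\<lambda>_. borel))"
  by (simp add: sets_PiM_equal_borel)

lemma floor_measurable [measurable]: "(\<lambda>f i. nat \<lfloor>f i\<rfloor>) \<in> measurable lim.lim (borel :: (int \<Rightarrow> nat) measure)"
proof -
  have "(\<lambda>f i. nat \<lfloor>f i\<rfloor>) \<in> measurable (PiM UNIV (\<lambda>_. borel :: real measure)) (PiM UNIV (\<lambda>_::int. borel :: nat measure))"
    by (rule measurable_PiM_single') (auto simp: space_PiM)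
  then show ?thesis
    by (subst measurable_cong_sets[OF lim.sets_lim sets_borel_int_nat])
qed

lemma prob_space_chain: "prob_space chain_measure"
  unfolding chain_measure_def by (rule lim.P.prob_space_distr) measurable

lemma box_borel: "{x. \<forall>j\<in>J. x j \<in> A j} \<in> sets (borel :: (int \<Rightarrow> nat) measure)" if "finite J"
proof -
  have "prod_emb UNIV (\<lambda>_. borel) J (Pi\<^sub>E J A) \<in> sets (PiM UNIV (\<lambda>_::int. borel :: nat measure))"
    using that by (intro sets_PiM_I) (auto simp: sets_borel_eq_count_space)
  also have "prod_emb UNIV (\<lambda>_. borel) J (Pi\<^sub>E J A) = {x. \<forall>j\<in>J. x j \<in> A j}"
    by (auto simp: prod_emb_def)
  finally show ?thesis by (simp add: sets_borel_int_nat)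
qed

text \<open>The finite-dimensional distributions after the return from reals to naturals. Arbitrary
  \<open>J\<close> and \<open>A\<close> serve both cylinders and the test sets for shift
  invariance.\<close>

lemma emeasure_box:
  assumes "1 \<le> n" "J \<subseteq> {s..<s + int n}"
  shows "emeasure chain_measure {x. \<forall>j\<in>J. x j \<in> A j} = emeasure (path_pmf n) {w. \<forall>j\<in>J. w ! nat (j - s) \<in> A j}"
proof -
  have J: "finite J" using assms(2) finite_subset by blast
  define X :: "(int \<Rightarrow> real) set" where "X = Pi\<^sub>E J (\<lambda>j. (\<lambda>t. nat \<lfloor>t\<rfloor>) -` A j)"
  have "(\<lambda>t::real. nat \<lfloor>t\<rfloor>) -` A j \<in> sets borel" for j
  proof -
    have "(\<lambda>t::real. nat \<lfloor>t\<rfloor>) \<in> measurable borel (count_space UNIV)" by measurable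
    from measurable_sets[OF this, of "A j"] show ?thesis by simp
  qed
  then have X: "X \<in> sets (PiM J (\<lambda>_. borel))"
    unfolding X_def using J by (intro sets_PiM_I_finite) auto
  have "emeasure chain_measure {x. \<forall>j\<in>J. x j \<in> A j}
      = emeasure lim.lim ((\<lambda>f i. nat \<lfloor>f i\<rfloor>) -` {x. \<forall>j\<in>J. x j \<in> A j} \<inter> space lim.lim)"
    unfolding chain_measure_def by (intro emeasure_distr floor_measurable box_borel J)
  also have "(\<lambda>f i. nat \<lfloor>f i\<rfloor>) -` {x. \<forall>j\<in>J. x j \<in> A j} \<inter> space lim.lim = lim.emb UNIV J X"
    by (auto simp: prod_emb_def X_def space_PiM)
  also have "emeasure lim.lim \<dots> = emeasure (marginals J) X"
    using J X by (intro lim.emeasure_lim_emb) auto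
  also have "\<dots> = emeasure (measure_pmf (marginal_pmf s n J)) ((\<lambda>f. restrict f J) -` X \<inter> space (marginal_pmf s n J))"
    unfolding marginals_eq[OF assms] by (intro emeasure_distr meas_restrict X)
  also have "\<dots> = emeasure (path_pmf n) (window s J -` ((\<lambda>f. restrict f J) -` X))"
    by (simp add: marginal_pmf_def)
  also have "window s J -` ((\<lambda>f. restrict f J) -` X) = {w. \<forall>j\<in>J. w ! nat (j - s) \<in> A j}"
    by (auto simp: window_def X_def PiE_iff)
  finally show ?thesis .
qed

lemma word_at_box:
  fixes i :: int and w :: "'b list"
  defines "J \<equiv> {i..<i + int (length w)}"
  shows "{x. word_at x i (length w) = w} = {x. \<forall>j\<in>J. x j \<in> {w ! nat (j - i)}}"
proof (intro Collect_cong iffI ballI)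
    fix x j assume *: "word_at x i (length w) = w" "j \<in> J"
    have "word_at x i (length w) ! nat (j - i) = x j"
      using \<open>j \<in> J\<close> by (auto simp: word_at_def J_def)
    then show "x j \<in> {w ! nat (j - i)}" using * by simp
next
    fix x assume *: "\<forall>j\<in>J. x j \<in> {w ! nat (j - i)}"
    show "word_at x i (length w) = w"
      using * by (auto intro!: nth_equalityI simp: word_at_def J_def)
qed

lemma measure_cylinder:
  assumes "w \<noteq> []"
  shows "measure chain_measure {x. word_at x i (length w) = w} = (if set w \<subseteq> B then wt w else 0)"
proof -
  let ?J = "{i..<i + int (length w)}"
  note 1 = word_at_box[of i w]
  have "emeasure chain_measure {x. word_at x i (length w) = w}
      = emeasure (path_pmf (length w)) {v. \<forall>j\<in>?J. v ! nat (j - i) \<in> {w ! nat (j - i)}}"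
    unfolding 1 using assms by (intro emeasure_box) (auto simp: Suc_le_eq)
  also have "\<dots> = emeasure (path_pmf (length w)) {w}"
  proof (rule emeasure_eq_AE)
    show "AE v in path_pmf (length w). (v \<in> {v. \<forall>j\<in>?J. v ! nat (j - i) \<in> {w ! nat (j - i)}}) = (v \<in> {w})"
      unfolding AE_measure_pmf_iff
    proof
      fix v assume "v \<in> set_pmf (path_pmf (length w))"
      then have "length v = length w"
        using set_path_pmf[of "length w"] assms by (auto simp: words_def Suc_le_eq)
      moreover have "v ! k = w ! k"
        if "\<forall>j\<in>?J. v ! nat (j - i) = w ! nat (j - i)" "k < length w" for k
        using bspec[OF that(1), of "i + int k"] that(2) by simp
      ultimately show "(v \<in> {v. \<forall>j\<in>?J. v ! nat (j - i) \<in> {w ! nat (j - i)}}) = (v \<in> {w})"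
        by (auto intro: nth_equalityI)
    qed
  qed auto
  finally have "measure chain_measure {x. word_at x i (length w) = w} = pmf (path_pmf (length w)) w"
    by (simp add: measure_def pmf.rep_eq)
  then show ?thesis using assms by (simp add: pmf_path_pmf words_def Suc_le_eq)
qed

lemma shift_measurable: "shift_map \<in> measurable borel (borel :: (int \<Rightarrow> nat) measure)"
proof -
  have "shift_map \<in> measurable (PiM UNIV (\<lambda>_. borel)) (PiM UNIV (\<lambda>_::int. borel :: nat measure))"
    unfolding shift_map_def by (rule measurable_PiM_single') (auto simp: space_PiM)
  then show ?thesis by (subst measurable_cong_sets[OF sets_borel_int_nat sets_borel_int_nat])
qed

text \<open>Boxes determine the measure. The shift moves the window of a box by one place, while the
  law of a path depends only on its length.\<close>

lemma shift_chain: "distr chain_measure chain_measure shift_map = chain_measure"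
proof (rule measure_eqI_PiM_infinite[symmetric])
  interpret prob_space chain_measure by (rule prob_space_chain)
  show "sets chain_measure = sets (PiM UNIV (\<lambda>_. borel))"
    "sets (distr chain_measure chain_measure shift_map) = sets (PiM UNIV (\<lambda>_. borel))"
    by (simp_all add: chain_measure_def sets_borel_int_nat)
  show "finite_measure chain_measure" by unfold_locales
  fix A :: "int \<Rightarrow> nat set" and J :: "int set" assume J: "finite J"
  let ?E = "prod_emb UNIV (\<lambda>_. borel) J (Pi\<^sub>E J A)"
  have E: "?E = {x. \<forall>j\<in>J. x j \<in> A j}" by (auto simp: prod_emb_def)
  define s n where "s = - int (radius J)" and "n = 2 * radius J + 1"
  have s: "J \<subseteq> {s..<s + int n}" using radius[OF J] by (simp add: s_def n_def)
  have "emeasure (distr chain_measure chain_measure shift_map) ?E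
      = emeasure chain_measure (shift_map -` ?E \<inter> space chain_measure)"
    using box_borel[OF J, of A] shift_measurable
    by (intro emeasure_distr) (auto simp: E chain_measure_def)
  also have "shift_map -` ?E \<inter> space chain_measure = {x. \<forall>j\<in>(\<lambda>j. j + 1) ` J. x j \<in> A (j - 1)}"
    by (auto simp: E chain_measure_def shift_map_def)
  also have "emeasure chain_measure \<dots>
      = emeasure (path_pmf n) {w. \<forall>j\<in>(\<lambda>j. j + 1) ` J. w ! nat (j - (s + 1)) \<in> A (j - 1)}"
    using s by (intro emeasure_box) (auto simp: n_def)
  also have "\<dots> = emeasure (path_pmf n) {w. \<forall>j\<in>J. w ! nat (j - s) \<in> A j}"
    by simp
  also have "\<dots> = emeasure chain_measure ?E"
    unfolding E using s by (intro emeasure_box[symmetric]) (auto simp: n_def)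
  finally show "emeasure chain_measure ?E = emeasure (distr chain_measure chain_measure shift_map) ?E" ..
qed


lemma cylinder_borel: "{x. word_at x i (length w) = w} \<in> sets (borel :: (int \<Rightarrow> nat) measure)"
proof -
  have "{x. word_at x i (length w) = w} = {x. \<forall>j\<in>{i..<i + int (length w)}. x j \<in> {w ! nat (j - i)}}"
    by (rule word_at_box)
  then show ?thesis by (simp only: box_borel finite_atLeastLessThan_int)
qed

section \<open>Restriction to the paths of positive transition probability\<close>

definition support :: "(int \<Rightarrow> nat) set" where
  "support = {x. \<forall>i. x i \<in> B \<and> 0 < P (x i) (x (i + 1))}"

context
  assumes p_pos: "\<And>a. a \<in> B \<Longrightarrow> 0 < p a"
begin

lemma P_nonneg: "a \<in> B \<Longrightarrow> b \<in> B \<Longrightarrow> 0 \<le> P a b"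
  using P by (auto simp: stochastic_matrix_def probability_vector_def)

text \<open>Describes the complement as a countable union of null cylinders over words of length
  two, which yields measurability and full measure at once. As \<open>p\<close> is positive, weight
  zero of a word over \<open>B\<close> means transition probability zero.\<close>

lemma support_alt:
  "support = {x. \<forall>i. \<forall>w. length w = 2 \<longrightarrow> (if set w \<subseteq> B then wt w else 0) = 0 \<longrightarrow> word_at x i (length w) \<noteq> w}"
proof -
  have "(\<forall>w. length w = 2 \<longrightarrow> (if set w \<subseteq> B then wt w else 0) = 0 \<longrightarrow> word_at x i (length w) \<noteq> w)
      \<longleftrightarrow> (x i \<in> B \<and> x (i + 1) \<in> B \<and> 0 < P (x i) (x (i + 1)))" (is "?l \<longleftrightarrow> ?r") for x i
  proof -
    have v: "word_at x i 2 = [x i, x (i + 1)]"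
      by (simp add: word_at_def numeral_2_eq_2)
    have "?l \<longleftrightarrow> (if set (word_at x i 2) \<subseteq> B then wt (word_at x i 2) else 0) \<noteq> 0"
    proof
      assume ?l
      from this[THEN spec[of _ "word_at x i 2"]]
      show "(if set (word_at x i 2) \<subseteq> B then wt (word_at x i 2) else 0) \<noteq> 0"
        by (simp add: v v[unfolded numeral_2_eq_2])
    qed metis
    also have "\<dots> \<longleftrightarrow> (if {x i, x (i + 1)} \<subseteq> B then p (x i) * P (x i) (x (i + 1)) else 0) \<noteq> 0"
      by (simp add: v chain_weight_def)
    also have "\<dots> \<longleftrightarrow> ?r"
      using p_pos[of "x i"] P_nonneg[of "x i" "x (i + 1)"] by (auto simp: less_le)
    finally show ?thesis .
  qed
  then show ?thesis unfolding support_def by auto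
qed

lemma support_borel: "support \<in> sets borel"
proof -
  let ?bad = "{w. length w = 2 \<and> (if set w \<subseteq> B then wt w else 0) = 0}"
  have "support = UNIV - (\<Union>i. \<Union>w\<in>?bad. {x. word_at x i (length w) = w})"
    unfolding support_alt by auto
  moreover have U: "(\<Union>w\<in>?bad. {x. word_at x i (length w) = w}) \<in> sets borel" for i
    by (rule sets.countable_UN'[OF countableI_type]) (intro image_subsetI cylinder_borel)
  have "(\<Union>i. \<Union>w\<in>?bad. {x. word_at x i (length w) = w}) \<in> sets borel"
    by (rule sets.countable_UN'[OF countableI_type]) (intro image_subsetI U)
  ultimately show ?thesis by (simp only: borel_comp Compl_eq_Diff_UNIV[symmetric])
qed

lemma AE_support: "AE x in chain_measure. x \<in> support"
proof -
  interpret prob_space chain_measure by (rule prob_space_chain)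
  have "AE x in chain_measure. length w = 2 \<longrightarrow> (if set w \<subseteq> B then wt w else 0) = 0 \<longrightarrow> word_at x i (length w) \<noteq> w"
    for i w
  proof (cases "length w = 2 \<and> (if set w \<subseteq> B then wt w else 0) = 0")
    case True
    then have "w \<noteq> []" by auto
    then have "measure chain_measure {x. word_at x i (length w) = w} = (if set w \<subseteq> B then wt w else 0)"
      by (rule measure_cylinder)
    also have "\<dots> = 0" using True by blast
    finally have "measure chain_measure {x. word_at x i (length w) = w} = 0" .
    then have "{x. word_at x i (length w) = w} \<in> null_sets chain_measure"
      using cylinder_borel[of i w] by (simp add: null_sets_def emeasure_eq_measure) (simp add: chain_measure_def)
    then show ?thesis by (rule AE_I') auto
  qed auto
  then show ?thesis unfolding support_alt by (simp add: AE_all_countable)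
qed

lemma shift_support: "shift_map x \<in> support \<longleftrightarrow> x \<in> support"
proof -
  have "x \<in> support" if "shift_map x \<in> support"
    unfolding support_def
  proof (intro CollectI allI)
    fix i show "x i \<in> B \<and> 0 < P (x i) (x (i + 1))"
      using that[unfolded support_def mem_Collect_eq, THEN spec[of _ "i - 1"]] by (simp add: shift_map_def)
  qed
  moreover have "shift_map x \<in> support" if "x \<in> support"
    unfolding support_def
  proof (intro CollectI allI)
    fix i show "shift_map x i \<in> B \<and> 0 < P (shift_map x i) (shift_map x (i + 1))"
      using that[unfolded support_def mem_Collect_eq, THEN spec[of _ "i + 1"]] by (simp add: shift_map_def)
  qed
  ultimately show ?thesis by blast
qed

text \<open>The support has measure one and is shift invariant in both directions, so the
  restriction keeps the cylinder weights and the invariance and lives on a shift of finite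
  type.\<close>

lemma markov_on_support:
  defines "\<nu> \<equiv> restrict_space chain_measure support"
  shows "invariant_measure support \<nu>"
    and "\<And>i w. w \<noteq> [] \<Longrightarrow> set w \<subseteq> B \<Longrightarrow> measure \<nu> (cylinder support i w) = wt w"
proof -
  have sp: "space chain_measure = UNIV" "sets chain_measure = sets borel" by (simp_all add: chain_measure_def)
  have sup: "support \<in> sets chain_measure" using support_borel sp by simp
  have m: "emeasure \<nu> A = emeasure chain_measure A" if "A \<subseteq> support" for A
    unfolding \<nu>_def using sup that by (intro emeasure_restrict_space) (auto simp: sp)
  have space: "space \<nu> = support" by (simp add: \<nu>_def space_restrict_space sp)
  have sets: "sets \<nu> = sets (restrict_space borel support)"
    unfolding \<nu>_def by (intro sets_restrict_space_cong sp)
  interpret prob_space chain_measure by (rule prob_space_chain)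
  have one: "emeasure chain_measure support = 1"
    using AE_support sup by (intro emeasure_eq_1_AE)
  have shift: "shift_map \<in> measurable \<nu> \<nu>"
    unfolding \<nu>_def using shift_measurable shift_support
    by (intro measurable_restrict_space3) (auto simp: measurable_cong_sets[OF sp(2) sp(2)])
  have "distr \<nu> \<nu> shift_map = \<nu>"
  proof (rule measure_eqI)
    fix A assume "A \<in> sets (distr \<nu> \<nu> shift_map)"
    then have A: "A \<in> sets \<nu>" "A \<subseteq> support" using sets.sets_into_space[of A \<nu>] space by auto
    have Ac: "A \<in> sets chain_measure"
      using A sup by (auto simp: \<nu>_def sets_restrict_space_iff sp)
    have "emeasure (distr \<nu> \<nu> shift_map) A = emeasure \<nu> (shift_map -` A \<inter> support)"
      using A shift by (simp add: emeasure_distr space)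
    also have "\<dots> = emeasure chain_measure (shift_map -` A \<inter> space chain_measure)"
      using A(2) shift_support by (subst m) (auto simp: sp intro!: arg_cong[where f = "emeasure chain_measure"])
    also have "\<dots> = emeasure (distr chain_measure chain_measure shift_map) A"
      using Ac shift_measurable by (intro emeasure_distr[symmetric]) (auto simp: measurable_cong_sets[OF sp(2) sp(2)])
    also have "\<dots> = emeasure \<nu> A" using m A by (simp add: shift_chain)
    finally show "emeasure (distr \<nu> \<nu> shift_map) A = emeasure \<nu> A" .
  qed simp
  moreover have "prob_space \<nu>"
    using m[of support] one space by (intro prob_spaceI) auto
  ultimately show "invariant_measure support \<nu>"
    using shift sets by (auto simp: invariant_measure_def)
  fix i w assume w: "w \<noteq> []" "set w \<subseteq> B"
  have "measure \<nu> (cylinder support i w) = measure chain_measure (cylinder support i w)"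
    using m[of "cylinder support i w"] by (auto simp: measure_def cylinder_def)
  also have "\<dots> = measure chain_measure {x. word_at x i (length w) = w}"
    using AE_support sup cylinder_borel[of i w]
    by (intro measure_eq_AE) (auto simp: cylinder_def sp Collect_conj_eq)
  finally show "measure \<nu> (cylinder support i w) = wt w" using w measure_cylinder by simp
qed

end
end

section \<open>One-step shifts and block Markov measures\<close>

lemma length_word_at [simp]: "length (word_at x i n) = n"
  by (simp add: word_at_def)

lemma nth_word_at [simp]: "k < n \<Longrightarrow> word_at x i n ! k = x (i + int k)"
  by (simp add: word_at_def)

lemma word_at_0 [simp]: "word_at x i 0 = []"
  by (simp add: word_at_def)

lemma word_at_Suc: "word_at x i (Suc n) = x i # word_at x (i + 1) n"
  by (rule nth_equalityI) (auto simp: nth_Cons' algebra_simps of_nat_diff)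

lemma word_at_add: "word_at x i (m + n) = word_at x i m @ word_at x (i + int m) n"
  by (rule nth_equalityI) (auto simp: nth_append algebra_simps)

lemma word_at_Suc': "word_at x i (Suc n) = word_at x i n @ [x (i + int n)]"
  using word_at_add[of x i n 1] by (simp add: word_at_Suc)

lemma word_at_shift: "word_at (\<lambda>i. x (i + k)) i n = word_at x (i + k) n"
  by (rule nth_equalityI) (auto simp: algebra_simps)

lemma take_drop_word_at: "k + m \<le> n \<Longrightarrow> take m (drop k (word_at x i n)) = word_at x (i + int k) m"
  by (rule nth_equalityI) (auto simp: algebra_simps)

lemma word_at_eqI: "(\<And>k. k < n \<Longrightarrow> x (i + int k) = y (j + int k)) \<Longrightarrow> word_at x i n = word_at y j n"
  by (rule nth_equalityI) auto

lemma word_at_eq_iff: "word_at x i (length w) = w \<longleftrightarrow> (\<forall>k<length w. x (i + int k) = w ! k)"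
  by (auto simp: list_eq_iff_nth_eq)

lemma shift_funpow: "(shift_map ^^ n) x = (\<lambda>i. x (i + int n))"
  by (induction n) (auto simp: shift_map_def algebra_simps)

lemma language_word_at: "x \<in> X \<Longrightarrow> word_at x i n \<in> language X"
  unfolding language_def by (auto intro!: bexI[of _ x] exI[of _ i])

lemma language_factor:
  assumes "u @ v @ w \<in> language X" shows "v \<in> language X"
proof -
  obtain x i where x: "x \<in> X" "word_at x i (length (u @ v @ w)) = u @ v @ w"
    using assms by (auto simp: language_def)
  have "word_at x (i + int (length u)) (length v) = v"
    using x(2) by (simp add: word_at_add)
  then show ?thesis using language_word_at[OF x(1)] by metis
qed

lemma open_word_at:
  fixes w :: "'a::discrete_topology list"
  shows "open {x. word_at x i (length w) = w}"
proof -
  have "{x. word_at x i (length w) = w} = (\<Inter>k<length w. (\<lambda>x. x (i + int k)) -` {w ! k})"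
    by (auto simp: word_at_eq_iff)
  moreover have "open ((\<lambda>x :: 'a point. x (i + int k)) -` {w ! k})" for k
    by (intro open_vimage) (simp_all add: discrete_topology_class.open_discrete)
  ultimately show ?thesis by (auto intro!: open_INT)
qed

lemma continuous_on_word_at:
  fixes h :: "'a::discrete_topology list \<Rightarrow> 'b::topological_space"
  shows "continuous_on S (\<lambda>x. h (word_at x i n))"
proof -
  have "open ((\<lambda>x. h (word_at x i n)) -` U)" for U
  proof -
    have "(\<lambda>x. h (word_at x i n)) -` U
        = (\<Union>w\<in>{w. length w = n \<and> h w \<in> U}. {x. word_at x i (length w) = w})"
      by auto
    then show ?thesis by (simp only:) (intro open_UN ballI open_word_at)
  qed
  then have "continuous_on UNIV (\<lambda>x. h (word_at x i n))" by (simp add: continuous_on_open_vimage)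
  then show ?thesis by (rule continuous_on_subset) simp
qed

lemma cylinder_sets:
  fixes X :: "'a::discrete_topology point set"
  shows "cylinder X i w \<in> sets (borel_on X)"
proof -
  have "cylinder X i w = X \<inter> {x. word_at x i (length w) = w}" by (auto simp: cylinder_def)
  then show ?thesis using open_word_at[of i w] by (auto simp: sets_restrict_space)
qed

lemma measurable_restrict_continuous:
  assumes "continuous_on Z f" "f ` Z \<subseteq> X"
  shows "f \<in> measurable (borel_on Z) (borel_on X)"
  using assms by (intro measurable_restrict_space2 borel_measurable_continuous_on_restrict)
    (auto simp: space_restrict_space)

locale one_step_shift =
  fixes A :: "'a::discrete_topology set" and X :: "'a point set"
  assumes sft: "shift_of_finite_type A X" and one_step: "one_step X" and nonempty: "X \<noteq> {}"
begin

lemma finite_A: "finite A"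
  using sft by (simp add: shift_of_finite_type_def)

lemma X_full: "X \<subseteq> full_shift A"
  using sft by (auto simp: shift_of_finite_type_def)

lemma language_set: "w \<in> language X \<Longrightarrow> set w \<subseteq> A"
proof
  fix a assume "w \<in> language X" "a \<in> set w"
  then obtain x i k where x: "x \<in> X" "word_at x i (length w) = w" and k: "k < length w" "w ! k = a"
    by (auto simp: language_def in_set_conv_nth)
  then have "a = x (i + int k)" using nth_word_at[of k "length w" x i] by simp
  then show "a \<in> A" using x(1) X_full by (auto simp: full_shift_def)
qed

lemma language_glue: "c @ [a] \<in> language X \<Longrightarrow> a # w \<in> language X \<Longrightarrow> c @ a # w \<in> language X"
  using one_step[unfolded one_step_def, rule_format, of "[a]" c w] by simp

text \<open>The one-step property glues consecutive admissible pairs into words of the language, and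
  no forbidden word lies in the language. Membership thus becomes a condition on adjacent symbols,
  which makes shifting and gluing of points immediate.\<close>

lemma in_X_iff: "x \<in> X \<longleftrightarrow> (\<forall>i. [x i, x (i + 1)] \<in> language X)"
proof
  assume "x \<in> X"
  then have "word_at x i 2 \<in> language X" for i by (rule language_word_at)
  then show "\<forall>i. [x i, x (i + 1)] \<in> language X" by (simp add: word_at_Suc numeral_2_eq_2)
next
  assume *: "\<forall>i. [x i, x (i + 1)] \<in> language X"
  have lang: "word_at x i (Suc n) \<in> language X" for i n
  proof (induction n)
    case 0
    show ?case using language_factor[of "[]" "[x i]" "[x (i + 1)]" X] * by (simp add: word_at_Suc)
  next
    case (Suc n)
    have "[x (i + int n), x (i + int (Suc n))] \<in> language X"
      using *[rule_format, of "i + int n"] by (simp add: algebra_simps)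
    then show ?case
      using language_glue[of "word_at x i n" "x (i + int n)" "[x (i + int (Suc n))]"] Suc
      by (simp add: word_at_Suc')
  qed
  obtain F where F: "X = {x \<in> full_shift A. \<forall>w\<in>F. \<forall>i. word_at x i (length w) \<noteq> w}"
    using sft by (auto simp: shift_of_finite_type_def)
  have "x i \<in> A" for i
    using language_set[OF lang[of i 0]] by (simp add: word_at_Suc)
  moreover have "word_at x i (length w) \<noteq> w" if w: "w \<in> F" for w i
  proof
    assume eq: "word_at x i (length w) = w"
    \<comment> \<open>A forbidden empty word would occur in every point and make \<open>X\<close>
      empty.\<close>
    have "w \<noteq> []" using w nonempty F by auto
    then obtain n where "length w = Suc n" by (cases w) auto
    then have "w \<in> language X" using lang[of i n] eq by simp
    then show False using w F by (auto simp: language_def)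
  qed
  ultimately show "x \<in> X" using F by (auto simp: full_shift_def)
qed

lemma shift_in_X: "x \<in> X \<Longrightarrow> (\<lambda>i. x (i + k)) \<in> X"
  unfolding in_X_iff
proof
  fix i assume "\<forall>i. [x i, x (i + 1)] \<in> language X"
  from this[rule_format, of "i + k"] show "[x (i + k), x (i + 1 + k)] \<in> language X"
    by (simp add: ac_simps)
qed

lemma glue_in_X:
  assumes "x \<in> X" "y \<in> X" "x m = y m" shows "(\<lambda>i. if i \<le> m then x i else y i) \<in> X"
  unfolding in_X_iff
proof
  fix i
  have *: "[x i, x (i + 1)] \<in> language X" "[y i, y (i + 1)] \<in> language X"
    using assms(1,2) unfolding in_X_iff by blast+
  show "[if i \<le> m then x i else y i, if i + 1 \<le> m then x (i + 1) else y (i + 1)] \<in> language X"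
    by (cases i m rule: linorder_cases) (use * assms(3) in simp_all)
qed

lemma language_obtain:
  assumes "w \<in> language X" obtains x where "x \<in> X" "word_at x i (length w) = w"
proof -
  obtain x j where x: "x \<in> X" "word_at x j (length w) = w" using assms by (auto simp: language_def)
  show thesis
  proof (rule that)
    show "(\<lambda>l. x (l + (j - i))) \<in> X" by (rule shift_in_X[OF x(1)])
    show "word_at (\<lambda>l. x (l + (j - i))) i (length w) = w" using x(2) by (simp add: word_at_shift)
  qed
qed

end

lemma finite_pair_bounds:
  fixes l r :: "'b \<Rightarrow> real"
  assumes "finite S" "\<And>i. i \<in> S \<Longrightarrow> 0 < l i" "\<And>i. i \<in> S \<Longrightarrow> 0 < r i"
  obtains C1 C2 where "0 < C1" "0 < C2" "\<And>i j. i \<in> S \<Longrightarrow> j \<in> S \<Longrightarrow> C1 \<le> l i * r j \<and> l i * r j \<le> C2"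
proof -
  \<comment> \<open>The element 1 keeps the set nonempty, so that minimum and maximum make sense
    even for empty \<open>S\<close>.\<close>
  let ?V = "insert 1 ((\<lambda>(i, j). l i * r j) ` (S \<times> S))"
  have fin: "finite ?V" using assms by simp
  show thesis
  proof (rule that[of "Min ?V" "Max ?V"])
    show "0 < Min ?V" using fin assms by (subst Min_gr_iff) auto
    have "1 \<le> Max ?V" using fin by (intro Max_ge) auto
    then show "0 < Max ?V" by linarith
    show "Min ?V \<le> l i * r j \<and> l i * r j \<le> Max ?V" if "i \<in> S" "j \<in> S" for i j
      using fin that by (intro conjI Min_le Max_ge) (auto intro!: image_eqI[of _ _ "(i, j)"])
  qed
qed

section \<open>The Markov measure of a weighted block graph\<close>

locale block_markov = one_step_shift A X for A :: "'a::discrete_topology set" and X :: "'a point set" +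
  fixes q :: nat and g :: "'a list \<Rightarrow> real"
  assumes mix: "mixing X" and q: "1 \<le> q" and g: "\<And>w. 0 < g w"
begin

definition S :: "'a list set" where
  "S = {w \<in> language X. length w = q}"

text \<open>The higher block graph: \<open>c\<close> and \<open>d\<close> overlap in all but one
  symbol and together spell an admissible word of length q + 1.\<close>

definition edge :: "'a list \<Rightarrow> 'a list \<Rightarrow> bool" where
  "edge c d \<longleftrightarrow> hd c # d \<in> language X \<and> tl c = butlast d"

definition Q :: "'a list \<Rightarrow> 'a list \<Rightarrow> real" where
  "Q c d = (if edge c d then g d else 0)"

lemma finite_S: "finite S"
  by (rule finite_subset[OF _ finite_lists_length_eq[OF finite_A, of q]]) (auto simp: S_def dest: language_set)

lemma S_word_at: "x \<in> X \<Longrightarrow> word_at x i q \<in> S"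
  by (simp add: S_def language_word_at)

lemma S_nonempty: "S \<noteq> {}"
  using nonempty S_word_at by blast

lemma edge_word_at: "x \<in> X \<Longrightarrow> edge (word_at x i q) (word_at x (i + 1) q)"
proof -
  assume x: "x \<in> X"
  obtain m where m: "q = Suc m" using q by (cases q) auto
  have "word_at x i (Suc q) \<in> language X" by (rule language_word_at[OF x])
  moreover have "word_at x (i + 1) q = word_at x (i + 1) m @ [x (i + 1 + int m)]"
    unfolding m by (rule word_at_Suc')
  ultimately show ?thesis by (simp add: edge_def m word_at_Suc)
qed

lemma path_word_at: "x \<in> X \<Longrightarrow> (word_at x i q, word_at x (i + int (Suc n)) q) \<in> {(c, d). c \<in> S \<and> d \<in> S \<and> 0 < Q c d}\<^sup>+"
proof (induction n)
  case 0
  then show ?case using edge_word_at[OF 0] S_word_at[OF 0] g by (auto simp: Q_def)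
next
  case (Suc n)
  have "edge (word_at x (i + int (Suc n)) q) (word_at x (i + int (Suc (Suc n))) q)"
    using edge_word_at[OF Suc.prems, of "i + int (Suc n)"] by (simp add: algebra_simps)
  then show ?case using Suc S_word_at[OF Suc.prems] g by (intro trancl_into_trancl[OF Suc.IH]) (auto simp: Q_def)
qed

lemma Q_nonneg: "0 \<le> Q c d"
  using g[of d] by (simp add: Q_def)

text \<open>Mixing joins the two blocks inside one admissible word, and reading its
  \<open>q\<close>-blocks from left to right gives the path.\<close>

lemma irreducible:
  assumes "c \<in> S" "d \<in> S" shows "(c, d) \<in> {(c, d). c \<in> S \<and> d \<in> S \<and> 0 < Q c d}\<^sup>+"
proof -
  obtain v where v: "c @ v @ d \<in> language X"
    using mix assms unfolding mixing_def S_def by (metis (no_types, lifting) mem_Collect_eq order_refl)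
  obtain x where x: "x \<in> X" "word_at x 0 (length (c @ v @ d)) = c @ v @ d"
    using language_obtain[OF v] by blast
  have len: "length c = q" "length d = q" using assms by (auto simp: S_def)
  have "word_at x 0 q = c" "word_at x (int (q + length v)) q = d"
    using x(2) len by (simp_all add: word_at_add)
  moreover have "(word_at x 0 q, word_at x (0 + int (Suc (q + length v - 1))) q)
    \<in> {(c, d). c \<in> S \<and> d \<in> S \<and> 0 < Q c d}\<^sup>+"
    by (rule path_word_at[OF x(1)])
  ultimately show ?thesis using q by simp
qed

text \<open>The matrix \<open>Q\<close> is made stochastic by its right eigenvector. Along a path
  the values of \<open>r\<close> telescope; only the first value of \<open>l\<close> and the last
  value of \<open>r\<close> survive, and these are bounded away from 0 and infinity. Since
  \<open>Q\<close> weighs the target of an edge, the first block carries no factor \<open>g\<close>,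
  which explains \<open>Suc k\<close>.\<close>

lemma weighted_markov_measure:
  "\<exists>\<mu> \<rho> C1 C2. markov_measure X \<mu> \<and> fully_supported X \<mu> \<and> 0 < \<rho> \<and> 0 < C1 \<and> 0 < C2 \<and>
    (\<forall>w\<in>language X. \<forall>m. length w = q + m \<longrightarrow>
      C1 * ((\<Prod>k<m. g (take q (drop (Suc k) w))) / \<rho> ^ m) \<le> measure \<mu> (cylinder X 0 w) \<and>
      measure \<mu> (cylinder X 0 w) \<le> C2 * ((\<Prod>k<m. g (take q (drop (Suc k) w))) / \<rho> ^ m))"
proof -
  obtain \<rho> r l where \<rho>: "0 < \<rho>" and r: "\<And>c. c \<in> S \<Longrightarrow> 0 < r c" and l: "\<And>c. c \<in> S \<Longrightarrow> 0 < l c"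
    and Qr: "\<And>c. c \<in> S \<Longrightarrow> (\<Sum>d\<in>S. Q c d * r d) = \<rho> * r c"
    and lQ: "\<And>d. d \<in> S \<Longrightarrow> (\<Sum>c\<in>S. l c * Q c d) = \<rho> * l d"
    and lr: "(\<Sum>c\<in>S. l c * r c) = 1"
    by (rule perron_pair[of S Q]) (use finite_S S_nonempty Q_nonneg irreducible in blast)+
  define P where "P c d = Q c d * r d / (\<rho> * r c)" for c d
  have P_pos: "0 < P c d \<longleftrightarrow> edge c d" if "c \<in> S" "d \<in> S" for c d
    using that \<rho> r[of c] r[of d] g[of d] by (simp add: P_def Q_def zero_less_divide_iff)
  \<comment> \<open>Blocks are coded by naturals, the alphabet over which
    \<open>markov_measure\<close> takes the conjugate shift.\<close>
  obtain enc :: "'a list \<Rightarrow> nat" where enc: "inj_on enc S"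
    using finite_imp_inj_to_nat_seg[OF finite_S] by blast
  define dec where "dec = the_inv_into S enc"
  have dec: "dec (enc c) = c" if "c \<in> S" for c
    unfolding dec_def using enc that by (rule the_inv_into_f_f)
  define B where "B = enc ` S"
  have dec_S: "dec n \<in> S" "enc (dec n) = n" if "n \<in> B" for n using that dec by (auto simp: B_def)
  have sum_B: "(\<Sum>n\<in>B. f (dec n)) = (\<Sum>c\<in>S. f c)" for f :: "'a list \<Rightarrow> real"
    unfolding B_def using enc by (subst sum.reindex) (auto simp: dec)
  define p where "p c = l c * r c" for c
  interpret chain: stationary_chain B "\<lambda>n. p (dec n)" "\<lambda>m n. P (dec m) (dec n)"
  proof
    show "finite B" using finite_S by (simp add: B_def)
    show "probability_vector B (\<lambda>n. p (dec n))"
      using dec_S l r lr sum_B[of p] by (auto simp: probability_vector_def p_def less_imp_le)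
    show "stochastic_matrix B (\<lambda>m n. P (dec m) (dec n))"
      unfolding stochastic_matrix_def probability_vector_def
    proof (intro ballI conjI)
      fix m assume m: "m \<in> B"
      show "0 \<le> P (dec m) (dec n)" if "n \<in> B" for n
        using r[OF dec_S(1)[OF m]] r[OF dec_S(1)[OF that]] \<rho> Q_nonneg by (simp add: P_def)
      have "(\<Sum>n\<in>B. P (dec m) (dec n)) = (\<Sum>d\<in>S. Q (dec m) d * r d) / (\<rho> * r (dec m))"
        using sum_B[of "P (dec m)"] by (simp add: P_def sum_divide_distrib)
      then show "(\<Sum>n\<in>B. P (dec m) (dec n)) = 1"
        using Qr[OF dec_S(1)[OF m]] r[OF dec_S(1)[OF m]] \<rho> by simp
    qed
    fix n assume n: "n \<in> B"
    have "(\<Sum>m\<in>B. p (dec m) * P (dec m) (dec n)) = (\<Sum>c\<in>S. p c * P c (dec n))"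
      by (rule sum_B)
    also have "\<dots> = (\<Sum>c\<in>S. l c * Q c (dec n)) * r (dec n) / \<rho>"
      unfolding sum_distrib_right sum_divide_distrib using r \<rho>
      by (intro sum.cong refl) (force simp: p_def P_def field_simps)
    also have "\<dots> = p (dec n)" using lQ[OF dec_S(1)[OF n]] \<rho> by (simp add: p_def)
    finally show "(\<Sum>m\<in>B. p (dec m) * P (dec m) (dec n)) = p (dec n)" .
  qed
  have p_pos: "0 < p (dec n)" if "n \<in> B" for n using l r dec_S that by (simp add: p_def)
  define Z where "Z = chain.support"
  have Z: "z \<in> Z \<longleftrightarrow> (\<forall>i. z i \<in> B \<and> z (i + 1) \<in> B \<and> edge (dec (z i)) (dec (z (i + 1))))" for z
    unfolding Z_def chain.support_def using P_pos[OF dec_S(1) dec_S(1)] by auto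
  define \<nu> where "\<nu> = restrict_space chain.chain_measure Z"
  have inv: "invariant_measure Z \<nu>"
    and cyl: "\<And>i w. w \<noteq> [] \<Longrightarrow> set w \<subseteq> B \<Longrightarrow>
      measure \<nu> (cylinder Z i w) = chain_weight (\<lambda>n. p (dec n)) (\<lambda>m n. P (dec m) (dec n)) w"
    unfolding \<nu>_def Z_def using chain.markov_on_support[OF p_pos] by auto
  have Z_sft: "shift_of_finite_type B Z"
    unfolding shift_of_finite_type_def
  proof (intro conjI exI)
    let ?F = "(\<lambda>(m, n). [m, n]) ` {(m, n) \<in> B \<times> B. \<not> edge (dec m) (dec n)}"
    show "finite B" using chain.finB .
    then have "finite {(m, n) \<in> B \<times> B. \<not> edge (dec m) (dec n)}"
      by (auto intro: rev_finite_subset[of "B \<times> B"])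
    then show "finite ?F" by simp
    show "?F \<subseteq> lists B" by auto
    have "(\<forall>w\<in>?F. word_at z i (length w) \<noteq> w) \<longleftrightarrow> edge (dec (z i)) (dec (z (i + 1)))"
      if "z \<in> full_shift B" for z i
      using that by (auto simp: word_at_Suc full_shift_def image_iff)
    then show "Z = {z \<in> full_shift B. \<forall>w\<in>?F. \<forall>i. word_at z i (length w) \<noteq> w}"
      by (auto simp: Z full_shift_def) blast+
  qed
  have \<nu>_markov: "one_step_markov_measure B Z \<nu>"
    unfolding one_step_markov_measure_def
  proof (intro conjI exI[of _ "\<lambda>n. p (dec n)"] exI[of _ "\<lambda>m n. P (dec m) (dec n)"] ballI impI inv)
    show "probability_vector B (\<lambda>n. p (dec n))" by (rule chain.p)
    show "stochastic_matrix B (\<lambda>m n. P (dec m) (dec n))" by (rule chain.P)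
    fix w assume w: "w \<in> language Z" "w \<noteq> []"
    have "set w \<subseteq> B"
    proof
      fix n assume "n \<in> set w"
      then obtain k where k: "k < length w" "n = w ! k" by (auto simp: in_set_conv_nth)
      obtain z i where "z \<in> Z" "word_at z i (length w) = w" using w by (auto simp: language_def)
      then have "w ! k = z (i + int k)" using nth_word_at[OF k(1), of z i] by simp
      then show "n \<in> B" using k \<open>z \<in> Z\<close> Z by auto
    qed
    then show "measure \<nu> (cylinder Z 0 w)
        = p (dec (hd w)) * (\<Prod>k<length w - 1. P (dec (w ! k)) (dec (w ! Suc k)))"
      using cyl w by (simp add: chain_weight_def)
  qed
  \<comment> \<open>The higher block conjugacy: \<open>\<psi>\<close> records the block starting at
    each place, \<open>\<phi>\<close> keeps the first symbol of each recorded block.\<close>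
  define \<phi> where "\<phi> z = (\<lambda>i. hd (dec (z i)))" for z :: "nat point"
  define \<psi> where "\<psi> x = (\<lambda>i. enc (word_at x i q))" for x :: "'a point"
  obtain q' where q': "q = Suc q'" using q by (cases q) auto
  have \<phi>_word: "word_at (\<phi> z) i m = take m (dec (z i))" if z: "z \<in> Z" and m: "m \<le> q" for z i m
    using m
  proof (induction m arbitrary: i)
    case (Suc m)
    have e: "edge (dec (z i)) (dec (z (i + 1)))" and S: "dec (z i) \<in> S" "dec (z (i + 1)) \<in> S"
      using z dec_S by (auto simp: Z)
    have "dec (z i) \<noteq> []" using S q by (auto simp: S_def)
    then have "dec (z i) = \<phi> z i # tl (dec (z i))" by (simp add: \<phi>_def)
    then have "take (Suc m) (dec (z i)) = \<phi> z i # take m (butlast (dec (z (i + 1))))"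
      using e by (metis edge_def take_Suc_Cons)
    also have "take m (butlast (dec (z (i + 1)))) = take m (dec (z (i + 1)))"
      using Suc.prems S by (simp add: take_butlast S_def)
    finally show ?case using Suc by (simp add: word_at_Suc)
  qed simp
  have \<phi>_block: "word_at (\<phi> z) i q = dec (z i)" if "z \<in> Z" for z i
    using \<phi>_word[OF that order_refl, of i] that dec_S[of "z i"] by (simp add: S_def Z)
  have \<phi>_X: "\<phi> z \<in> X" if z: "z \<in> Z" for z
    unfolding in_X_iff
  proof
    fix i
    have e: "edge (dec (z i)) (dec (z (i + 1)))" and S: "dec (z (i + 1)) \<in> S"
      using z dec_S by (auto simp: Z)
    have "dec (z (i + 1)) \<noteq> []" using S q by (auto simp: S_def)
    then have "dec (z (i + 1)) = \<phi> z (i + 1) # tl (dec (z (i + 1)))" by (simp add: \<phi>_def)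
    then have "[] @ [\<phi> z i, \<phi> z (i + 1)] @ tl (dec (z (i + 1))) \<in> language X"
      using e by (simp add: edge_def \<phi>_def)
    then show "[\<phi> z i, \<phi> z (i + 1)] \<in> language X" by (rule language_factor)
  qed
  have \<psi>_Z: "\<psi> x \<in> Z" if "x \<in> X" for x
    using that edge_word_at S_word_at by (auto simp: Z \<psi>_def B_def dec)
  have \<psi>\<phi>: "\<psi> (\<phi> z) = z" if "z \<in> Z" for z
    using that \<phi>_block dec_S by (auto simp: \<psi>_def Z)
  have \<phi>\<psi>: "\<phi> (\<psi> x) = x" if "x \<in> X" for x
    using S_word_at[OF that] by (auto simp: \<phi>_def \<psi>_def dec q' word_at_Suc)
  have cont_\<phi>: "continuous_on Z \<phi>"
  proof (rule continuous_on_coordinatewise_then_product)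
    fix i show "continuous_on Z (\<lambda>z. \<phi> z i)"
      using continuous_on_word_at[of Z "\<lambda>w. hd (dec (hd w))" i 1] by (simp add: \<phi>_def word_at_Suc)
  qed
  have cont_\<psi>: "continuous_on X \<psi>"
    unfolding \<psi>_def by (intro continuous_on_coordinatewise_then_product continuous_on_word_at)
  have conj: "conjugacy \<phi> Z X"
    unfolding conjugacy_def
  proof (intro conjI exI ballI)
    show "homeomorphism Z X \<phi> \<psi>"
      using \<phi>_X \<psi>_Z \<phi>\<psi> \<psi>\<phi> cont_\<phi> cont_\<psi> by (auto simp: homeomorphism_def image_iff) metis+
    show "\<phi> (shift_map z) = shift_map (\<phi> z)" for z by (simp add: \<phi>_def shift_map_def)
  qed
  define \<mu> where "\<mu> = distr \<nu> (borel_on X) \<phi>"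
  have markov: "markov_measure X \<mu>"
    unfolding markov_measure_def using Z_sft \<nu>_markov conj \<mu>_def by blast
  have space_\<nu>: "space \<nu> = Z" and sets_\<nu>: "sets \<nu> = sets (borel_on Z)"
    using inv sets_eq_imp_space_eq[of \<nu> "borel_on Z"] by (auto simp: invariant_measure_def space_restrict_space)
  have meas_\<phi>: "\<phi> \<in> measurable \<nu> (borel_on X)"
    unfolding measurable_cong_sets[OF sets_\<nu> refl]
    using cont_\<phi> \<phi>_X by (intro measurable_restrict_continuous) auto
  have mu_cyl: "measure \<mu> (cylinder X i w) = l (take q w) * r (take q (drop m w)) *
      ((\<Prod>k<m. g (take q (drop (Suc k) w))) / \<rho> ^ m)"
    and w_S: "take q w \<in> S" "take q (drop m w) \<in> S"
    if w: "w \<in> language X" "length w = q + m" for i w m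
  proof -
    obtain x where x: "x \<in> X" "word_at x i (q + m) = w"
      using language_obtain[OF w(1), of i] w(2) by metis
    define c where "c k = take q (drop k w)" for k
    have c: "c k = word_at x (i + int k) q" if "k \<le> m" for k
      using that unfolding c_def x(2)[symmetric] by (intro take_drop_word_at) simp
    have cS: "c k \<in> S" if "k \<le> m" for k using c[OF that] S_word_at[OF x(1)] by simp
    show "take q w \<in> S" "take q (drop m w) \<in> S" using cS[of 0] cS[of m] by (simp_all add: c_def)
    have ce: "edge (c k) (c (Suc k))" if "k < m" for k
      using edge_word_at[OF x(1), of "i + int k"] that by (simp add: c algebra_simps)
    \<comment> \<open>A word of length q + m contains m + 1 overlapping blocks, so its cylinder in
      \<open>X\<close> corresponds to a cylinder of length m + 1 in \<open>Z\<close>.\<close>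
    define b where "b = map (\<lambda>k. enc (c k)) [0..<Suc m]"
    have b: "b \<noteq> []" "set b \<subseteq> B" "length b = Suc m" using cS by (auto simp: b_def B_def)
    have nth_b: "b ! k = enc (c k)" if "k \<le> m" for k
      using that unfolding b_def by (subst nth_map) (auto simp: less_Suc_eq_le simp del: upt_Suc)
    have "\<phi> -` cylinder X i w \<inter> Z = cylinder Z i b"
    proof (intro equalityI subsetI)
      fix z assume "z \<in> \<phi> -` cylinder X i w \<inter> Z"
      then have z: "z \<in> Z" "word_at (\<phi> z) i (q + m) = w" using w by (auto simp: cylinder_def)
      have "z (i + int k) = b ! k" if "k \<le> m" for k
      proof -
        have "c k = word_at (\<phi> z) (i + int k) q"
          using that unfolding c_def z(2)[symmetric] by (intro take_drop_word_at) simp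
        also have "\<dots> = dec (z (i + int k))" using \<phi>_block[OF z(1)] .
        finally show ?thesis using nth_b[OF that] dec_S z(1) by (simp add: Z)
      qed
      then have "word_at z i (length b) = b" unfolding word_at_eq_iff using b(3) by (simp add: less_Suc_eq_le)
      then show "z \<in> cylinder Z i b" using z(1) by (simp add: cylinder_def)
    next
      fix z assume "z \<in> cylinder Z i b"
      then have z: "z \<in> Z" "\<And>k. k \<le> m \<Longrightarrow> z (i + int k) = b ! k"
        using b by (auto simp: cylinder_def word_at_eq_iff less_Suc_eq_le)
      have blk: "word_at (\<phi> z) (i + int k) q = word_at x (i + int k) q" if "k \<le> m" for k
        using \<phi>_block[OF z(1)] z(2)[OF that] nth_b[OF that] cS[OF that] c[OF that] by (simp add: dec)
      have "\<phi> z (i + int j) = x (i + int j)" if "j < q + m" for j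
      proof -
        \<comment> \<open>Position \<open>j\<close> lies in the block that starts at
          \<open>min j m\<close>: its own block as long as one starts there, otherwise the last
          one.\<close>
        define k where "k = min j m"
        have k: "k \<le> m" "j - k < q" "k \<le> j" using that q by (auto simp: k_def)
        then have "word_at (\<phi> z) (i + int k) q ! (j - k) = word_at x (i + int k) q ! (j - k)"
          using blk by simp
        then show ?thesis using k by (simp add: of_nat_diff)
      qed
      then have "word_at (\<phi> z) i (q + m) = w" unfolding x(2)[symmetric] by (intro word_at_eqI)
      then show "z \<in> \<phi> -` cylinder X i w \<inter> Z" using z(1) \<phi>_X w by (auto simp: cylinder_def)
    qed
    then have "measure \<mu> (cylinder X i w) = measure \<nu> (cylinder Z i b)"
      unfolding \<mu>_def using measure_distr[OF meas_\<phi> cylinder_sets, of i w] by (simp add: space_\<nu>)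
    also have "\<dots> = p (c 0) * (\<Prod>k<m. P (c k) (c (Suc k)))"
    proof -
      have "hd b = enc (c 0)" using nth_b[of 0] b by (simp add: hd_conv_nth)
      moreover have "P (dec (b ! k)) (dec (b ! Suc k)) = P (c k) (c (Suc k))" if "k < m" for k
        using that nth_b[of k] nth_b[of "Suc k"] cS[of k] cS[of "Suc k"] by (simp add: dec)
      ultimately show ?thesis using cyl[OF b(1,2)] b(3) cS[of 0] by (simp add: chain_weight_def dec)
    qed
    also have "\<dots> = l (c 0) * r (c m) * ((\<Prod>k<m. g (c (Suc k))) / \<rho> ^ m)"
    proof -
      have "r (c 0) * (\<Prod>k<n. P (c k) (c (Suc k))) = r (c n) * ((\<Prod>k<n. g (c (Suc k))) / \<rho> ^ n)"
        if "n \<le> m" for n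
        using that
      proof (induction n)
        case (Suc n)
        have "P (c n) (c (Suc n)) = g (c (Suc n)) * r (c (Suc n)) / (\<rho> * r (c n))"
          using ce[of n] Suc.prems by (simp add: P_def Q_def)
        moreover have "0 < r (c n)" using r cS[of n] Suc.prems by simp
        moreover have IH: "r (c 0) * (\<Prod>k<n. P (c k) (c (Suc k))) = r (c n) * ((\<Prod>k<n. g (c (Suc k))) / \<rho> ^ n)"
          using Suc by simp
        have "r (c 0) * (\<Prod>k<Suc n. P (c k) (c (Suc k)))
            = r (c n) * ((\<Prod>k<n. g (c (Suc k))) / \<rho> ^ n) * P (c n) (c (Suc n))"
          unfolding IH[symmetric] by simp
        ultimately show ?case using \<rho> by (simp add: mult_ac)
      qed simp
      from this[of m] show ?thesis by (simp only: p_def mult.assoc order_refl)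
    qed
    finally show "measure \<mu> (cylinder X i w) = l (take q w) * r (take q (drop m w)) *
      ((\<Prod>k<m. g (take q (drop (Suc k) w))) / \<rho> ^ m)" by (simp add: c_def)
  qed
  have "prob_space \<mu>"
    unfolding \<mu>_def using inv meas_\<phi> by (intro prob_space.prob_space_distr) (auto simp: invariant_measure_def)
  then interpret mu: prob_space \<mu> .
  have full: "fully_supported X \<mu>"
    unfolding fully_supported_def
  proof (intro allI impI)
    fix i w assume "cylinder X i w \<noteq> {}"
    then obtain x where x: "x \<in> X" "word_at x i (length w) = w" by (auto simp: cylinder_def)
    \<comment> \<open>The exact formula is for words of length at least \<open>q\<close>, so a short
      word is extended along a point of its cylinder.\<close>
    define v where "v = word_at x i (q + length w)"
    have v: "v \<in> language X" "length v = q + length w"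
      using x by (auto simp: v_def language_word_at)
    have "0 < measure \<mu> (cylinder X i v)"
      unfolding mu_cyl[OF v] using w_S[OF v] l r g \<rho> by (intro mult_pos_pos divide_pos_pos prod_pos) auto
    also have "\<dots> \<le> measure \<mu> (cylinder X i w)"
    proof (rule mu.finite_measure_mono)
      show "cylinder X i v \<subseteq> cylinder X i w"
        using x(2) by (auto simp: cylinder_def v_def word_at_eq_iff)
          (metis add.commute nth_word_at trans_less_add2)
      show "cylinder X i w \<in> sets \<mu>" by (simp add: \<mu>_def cylinder_sets)
    qed
    finally show "0 < measure \<mu> (cylinder X i w)" .
  qed
  obtain C1 C2 where C: "0 < C1" "0 < C2"
    "\<And>c d. c \<in> S \<Longrightarrow> d \<in> S \<Longrightarrow> C1 \<le> l c * r d \<and> l c * r d \<le> C2"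
    using finite_pair_bounds[of S l r] finite_S l r by blast
  have "C1 * ((\<Prod>k<m. g (take q (drop (Suc k) w))) / \<rho> ^ m) \<le> measure \<mu> (cylinder X 0 w) \<and>
      measure \<mu> (cylinder X 0 w) \<le> C2 * ((\<Prod>k<m. g (take q (drop (Suc k) w))) / \<rho> ^ m)"
    if w: "w \<in> language X" "length w = q + m" for w m
  proof -
    have "0 \<le> (\<Prod>k<m. g (take q (drop (Suc k) w))) / \<rho> ^ m"
      using g \<rho> by (intro divide_nonneg_nonneg prod_nonneg) (auto simp: less_imp_le)
    then show ?thesis
      unfolding mu_cyl[OF w] using C(3)[OF w_S[OF w]] by (intro conjI mult_right_mono) auto
  qed
  then show ?thesis using markov full \<rho> C(1,2) by blast
qed

end

section \<open>Linked blocks over a periodic point\<close>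

lemma periodic_int:
  fixes f :: "int \<Rightarrow> 'b"
  assumes "\<And>n. f (n + P) = f n" shows "f (n + k * P) = f n"
proof (induction k rule: int_induct[of _ 0])
  case (step1 i)
  then show ?case using assms[of "n + i * P"] by (simp add: algebra_simps)
next
  case (step2 i)
  then show ?case using assms[of "n + (i - 1) * P"] by (simp add: algebra_simps)
qed simp

text \<open>The remainder of a period modulo the least period is again a period, hence zero.\<close>

lemma least_period:
  fixes f :: "int \<Rightarrow> 'b"
  assumes "0 < L" "\<And>n. f (n + int L) = f n"
  obtains q where "1 \<le> q" "\<And>n. f (n + int q) = f n"
    "\<And>s. (\<And>n. f (n + int s) = f n) \<Longrightarrow> q dvd s"
proof -
  let ?per = "\<lambda>s. 1 \<le> s \<and> (\<forall>n. f (n + int s) = f n)"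
  define q where "q = (LEAST s. ?per s)"
  have q: "?per q" unfolding q_def using assms by (intro LeastI[of ?per L]) auto
  have "q dvd s" if s: "\<And>n. f (n + int s) = f n" for s
  proof (rule ccontr)
    assume "\<not> q dvd s"
    then have "1 \<le> s mod q" by (simp add: dvd_eq_mod_eq_0 Suc_le_eq)
    have "f (n + int (s mod q)) = f n" for n
    proof -
      have "int s = int (s mod q) + int (s div q) * int q"
        by (metis mod_div_mult_eq of_nat_add of_nat_mult)
      then have "f (n + int (s mod q)) = f (n + int s)"
        using periodic_int[of f "int q" "n + int (s mod q)" "int (s div q)"] q by (simp add: algebra_simps)
      then show ?thesis using s by simp
    qed
    then have "q \<le> s mod q" unfolding q_def using \<open>1 \<le> s mod q\<close>
      by (intro Least_le) (simp add: q_def)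
    then show False using q mod_less_divisor[of q s] by linarith
  qed
  then show thesis using that q by blast
qed

lemma block_map_apply: "block_map p x i = p (x i)"
  by (simp add: block_map_def)

text \<open>Take an element of one class outside the other, together with the representative
  generating the other class. A transition in both directions would place the element in that class
  too, so the way back is missing; transitivity of the relation does not enter.\<close>

lemma class_transition_pair:
  assumes "C \<in> right_classes X \<phi> y" "C' \<in> right_classes X \<phi> y" "C \<noteq> C'" "class_transition X \<phi> y C C'"
  obtains x x' where "x \<in> fibre X \<phi> y" "x' \<in> fibre X \<phi> y"
    "right_transition X \<phi> y x x'" "\<not> right_transition X \<phi> y x' x"
proof -
  let ?R = "right_equivalence X \<phi> y"
  have refl: "(x, x) \<in> ?R" if "x \<in> fibre X \<phi> y" for x
    using that by (auto simp: right_equivalence_def right_transition_def right_bridge_def intro!: exI[of _ x] gt_ex)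
  obtain u u' where u: "u \<in> fibre X \<phi> y" "C = ?R `` {u}" "u' \<in> fibre X \<phi> y" "C' = ?R `` {u'}"
    using assms(1,2) by (auto simp: right_classes_def elim!: quotientE)
  have CF: "C \<subseteq> fibre X \<phi> y" "C' \<subseteq> fibre X \<phi> y" using u by (auto simp: right_equivalence_def)
  have uC: "u \<in> C" "u' \<in> C'" using u refl by auto
  have tr: "right_transition X \<phi> y x x'" if "x \<in> C" "x' \<in> C'" for x x'
    using assms(4) that by (simp add: class_transition_def)
  consider e where "e \<in> C" "e \<notin> C'" | e where "e \<in> C'" "e \<notin> C" using assms(3) by blast
  then show thesis
  proof cases
    case 1
    then have "\<not> right_transition X \<phi> y u' e"
      using tr[OF 1(1) uC(2)] u CF by (auto simp: right_equivalence_def)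
    then show thesis using that[of e u'] 1 tr uC CF by blast
  next
    case 2
    then have "\<not> right_transition X \<phi> y e u"
      using tr[OF uC(1) 2(1)] u CF by (auto simp: right_equivalence_def)
    then show thesis using that[of u e] 2 tr uC CF by blast
  qed
qed

text \<open>The transition relation of the word of \<open>y\<close> on [m, n] as a relation between
  end states. The witness need not lie over \<open>y\<close> outside the interval, so relations over
  equal words coincide.\<close>

definition link :: "'a point set \<Rightarrow> ('a \<Rightarrow> 'b) \<Rightarrow> (int \<Rightarrow> 'b) \<Rightarrow> int \<Rightarrow> int \<Rightarrow> 'a \<Rightarrow> 'a \<Rightarrow> bool" where
  "link X p y m n c d \<longleftrightarrow> (\<exists>z\<in>X. (\<forall>i. m \<le> i \<and> i \<le> n \<longrightarrow> p (z i) = y i) \<and> z m = c \<and> z n = d)"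

lemma link_point: "z \<in> X \<Longrightarrow> (\<And>i. m \<le> i \<Longrightarrow> i \<le> n \<Longrightarrow> p (z i) = y i) \<Longrightarrow> link X p y m n (z m) (z n)"
  unfolding link_def by blast

context one_step_shift
begin

lemma link_trans:
  assumes "link X p y m n c d" "link X p y n k d e" "m \<le> n" "n \<le> k"
  shows "link X p y m k c e"
proof -
  obtain z where z: "z \<in> X" "\<And>i. m \<le> i \<and> i \<le> n \<Longrightarrow> p (z i) = y i" "z m = c" "z n = d"
    using assms(1) by (auto simp: link_def)
  obtain z' where z': "z' \<in> X" "\<And>i. n \<le> i \<and> i \<le> k \<Longrightarrow> p (z' i) = y i" "z' n = d" "z' k = e"
    using assms(2) by (auto simp: link_def)
  show ?thesis unfolding link_def
  proof (intro bexI conjI)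
    show "(\<lambda>i. if i \<le> n then z i else z' i) \<in> X" using z z' by (intro glue_in_X) auto
  qed (use z z' assms(3,4) in auto)
qed

lemma link_shift:
  assumes "link X p y m n c d" "\<And>i. m \<le> i \<Longrightarrow> i \<le> n \<Longrightarrow> y' (i + s) = y i"
  shows "link X p y' (m + s) (n + s) c d"
proof -
  obtain z where z: "z \<in> X" "\<And>i. m \<le> i \<and> i \<le> n \<Longrightarrow> p (z i) = y i" "z m = c" "z n = d"
    using assms(1) by (auto simp: link_def)
  have "(\<lambda>i. z (i + - s)) \<in> X" using z(1) by (rule shift_in_X)
  moreover have "p (z (i - s)) = y' i" if "m + s \<le> i" "i \<le> n + s" for i
    using z(2)[of "i - s"] assms(2)[of "i - s"] that by simp
  ultimately show ?thesis unfolding link_def using z by (intro bexI[of _ "\<lambda>i. z (i + - s)"]) auto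
qed

text \<open>Ramsey's theorem makes the linking relation between chosen times constant, hence idempotent.\<close>

lemma transition_idempotent:
  assumes x: "x \<in> fibre X (block_map p) y" "x' \<in> fibre X (block_map p) y"
    and tr: "right_transition X (block_map p) y x x'"
    and ntr: "\<not> right_transition X (block_map p) y x' x"
  obtains i j a b where "i < j" "y j = y i"
    "\<And>c d e. link X p y i j c d \<Longrightarrow> link X p y i j d e \<Longrightarrow> link X p y i j c e"
    "link X p y i j a a" "link X p y i j b b" "link X p y i j a b" "\<not> link X p y i j b a"
proof -
  have X: "x \<in> X" "x' \<in> X" and "block_map p x = y" "block_map p x' = y"
    using x by (auto simp: fibre_def)
  then have px: "p (x i) = y i" "p (x' i) = y i" for i
    using block_map_apply[of p x i] block_map_apply[of p x' i] by simp_all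
  have xA: "x i \<in> A" "x' i \<in> A" for i using X X_full by (auto simp: full_shift_def)
  obtain m0 where m0: "\<And>z. \<not> right_bridge X (block_map p) y m0 x' x z"
    using ntr by (auto simp: right_transition_def)
  \<comment> \<open>Such a link, glued between the past of \<open>x'\<close> and the future of
    \<open>x\<close>, would be a right \<open>m0\<close>-bridge.\<close>
  have nolink: "\<not> link X p y m n (x' m) (x n)" if "m0 \<le> m" "m < n" for m n
  proof
    assume "link X p y m n (x' m) (x n)"
    then obtain z where z: "z \<in> X" "\<And>i. m \<le> i \<and> i \<le> n \<Longrightarrow> p (z i) = y i" "z m = x' m" "z n = x n"
      by (auto simp: link_def)
    define u where "u = (\<lambda>i. if i \<le> m then x' i else if i \<le> n then z i else x i)"
    have "(\<lambda>i. if i \<le> n then z i else x i) \<in> X" using z X by (intro glue_in_X) auto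
    then have "u \<in> X"
      unfolding u_def using z X that glue_in_X[of x' "\<lambda>i. if i \<le> n then z i else x i" m] by simp
    moreover have "block_map p u = y"
      using z(2) px by (auto simp: u_def block_map_def)
    ultimately have "right_bridge X (block_map p) y m0 x' x u"
      using that z by (auto simp: right_bridge_def fibre_def u_def intro!: exI[of _ n])
    then show False using m0 by blast
  qed
  have yeslink: "\<exists>n>m. \<forall>k\<ge>n. link X p y m k (x m) (x' k)" for m
  proof -
    obtain z n where z: "z \<in> X" "block_map p z = y" "n > m" "\<And>i. i \<le> m \<Longrightarrow> z i = x i" "\<And>i. i \<ge> n \<Longrightarrow> z i = x' i"
      using tr[unfolded right_transition_def, THEN spec[of _ m]]
      by (auto simp: right_bridge_def fibre_def)
    have "link X p y m k (x m) (x' k)" if "k \<ge> n" for k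
      using link_point[of z X m k p y] z that by (auto simp: block_map_def)
    then show ?thesis using z by blast
  qed
  define T where "T i = m0 + int i" for i :: nat
  \<comment> \<open>The colour of a pair of times: the linking relation between them and the states
    of both points at either time. Including the states makes the distinguished pair the same at all
    selected times.\<close>
  define G where "G i j = ({(c, d) \<in> A \<times> A. link X p y (T i) (T j) c d}, x (T i), x' (T i), x (T j), x' (T j))" for i j
  define K where "K = Pow (A \<times> A) \<times> A \<times> A \<times> A \<times> A"
  have "finite K" using finite_A by (simp add: K_def)
  from finite_imp_inj_to_nat_seg[OF this] obtain enc :: "_ \<Rightarrow> nat" and s
    where enc: "enc ` K = {i. i < s}" "inj_on enc K" by (elim exE conjE)
  have GK: "G i j \<in> K" for i j using xA by (auto simp: G_def K_def)
  have "\<exists>H t. H \<subseteq> UNIV \<and> infinite H \<and> t < s \<and>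
      (\<forall>i\<in>H. \<forall>j\<in>H. i \<noteq> j \<longrightarrow> enc (G (Min {i, j}) (Max {i, j})) = t)"
    using enc GK by (intro Ramsey2) auto
  then obtain H t where Hinf: "infinite H"
    and "\<forall>i\<in>H. \<forall>j\<in>H. i \<noteq> j \<longrightarrow> enc (G (Min {i, j}) (Max {i, j})) = t"
    by (elim exE conjE)
  then have H: "infinite H"
    "\<And>i j. i \<in> H \<Longrightarrow> j \<in> H \<Longrightarrow> i \<noteq> j \<Longrightarrow> enc (G (Min {i, j}) (Max {i, j})) = t"
    by simp_all
  have Ht: "enc (G i j) = t" if "i \<in> H" "j \<in> H" "i < j" for i j
    using H(2)[OF that(1,2)] that(3) by (simp add: min_def max_def)
  have Geq: "G i j = G i' j'" if "i \<in> H" "j \<in> H" "i < j" "i' \<in> H" "j' \<in> H" "i' < j'" for i j i' j'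
    using inj_onD[OF enc(2) _ GK GK, of i j i' j'] Ht[OF that(1-3)] Ht[OF that(4-6)] by simp
  obtain i where i: "i \<in> H" using H(1) by (metis finite.emptyI ex_in_conv)
  obtain j where j: "j \<in> H" "i < j" using H(1) by (metis infinite_nat_iff_unbounded)
  obtain k where k: "k \<in> H" "j < k" using H(1) by (metis infinite_nat_iff_unbounded)
  have linkA: "link X p y m n c d \<Longrightarrow> c \<in> A \<and> d \<in> A" for m n c d
    using X_full by (auto simp: link_def full_shift_def)
  have leq: "link X p y (T i) (T j) c d \<longleftrightarrow> link X p y (T i') (T j') c d"
    and seq: "x (T i') = x (T i)" "x' (T i') = x' (T i)" "x (T j') = x (T j)" "x' (T j') = x' (T j)"
    if "i' \<in> H" "j' \<in> H" "i' < j'" for c d i' j'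
    using Geq[OF i j that] linkA by (auto simp: G_def set_eq_iff) blast+
  have sj: "x (T j) = x (T i)" "x' (T j) = x' (T i)" using seq(1,2)[OF j(1) k] by auto
  have all: "x (T n) = x (T i)" "x' (T n) = x' (T i)" if "n \<in> H" for n
  proof -
    obtain n' where "n' \<in> H" "n < n'" using H(1) by (metis infinite_nat_iff_unbounded)
    then show "x (T n) = x (T i)" "x' (T n) = x' (T i)" using seq(1,2)[OF that] by auto
  qed
  have Tij: "T i < T j" "T j < T k" using j k by (auto simp: T_def)
  show thesis
  proof (rule that[of "T i" "T j" "x (T i)" "x' (T i)"])
    show "T i < T j" by (rule Tij)
    show "y (T j) = y (T i)" using px(1) sj by metis
    \<comment> \<open>The relation from \<open>j\<close> to \<open>k\<close> and that from
      \<open>i\<close> to \<open>k\<close> have the same colour as the one from \<open>i\<close> to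
      \<open>j\<close>, so composing two links yields one of the same kind.\<close>
    show "link X p y (T i) (T j) c e" if "link X p y (T i) (T j) c d" "link X p y (T i) (T j) d e" for c d e
    proof -
      have "link X p y (T j) (T k) d e" using that(2) leq[OF j(1) k] by simp
      then have "link X p y (T i) (T k) c e" using that(1) Tij
        by (intro link_trans[of p y "T i" "T j" c d "T k" e]) auto
      then show ?thesis using leq[OF i k(1)] j k by simp
    qed
    show "link X p y (T i) (T j) (x (T i)) (x (T i))"
      using link_point[of x X "T i" "T j" p y] X px sj by simp
    show "link X p y (T i) (T j) (x' (T i)) (x' (T i))"
      using link_point[of x' X "T i" "T j" p y] X px sj by simp
    show "\<not> link X p y (T i) (T j) (x' (T i)) (x (T i))"
      using nolink[of "T i" "T j"] Tij sj by (auto simp: T_def)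
    obtain n where n: "n > T i" "\<And>k. k \<ge> n \<Longrightarrow> link X p y (T i) k (x (T i)) (x' k)"
      using yeslink by blast
    \<comment> \<open>The bridge out of \<open>x\<close> may take long to reach \<open>x'\<close>. A
      selected time beyond its end carries the link, and equality of colours brings it back to
      \<open>j\<close>.\<close>
    obtain h where h: "h \<in> H" "nat (n - m0) < h" using H(1) by (metis infinite_nat_iff_unbounded)
    then have "T h \<ge> n" by (simp add: T_def)
    moreover have "i < h" using n(1) h by (simp add: T_def)
    ultimately show "link X p y (T i) (T j) (x (T i)) (x' (T i))"
      using n(2)[of "T h"] all[OF h(1)] leq[OF i h(1)] by simp
  qed
qed

section \<open>The graph of blocks over a periodic point\<close>

definition blocks_over :: "('a \<Rightarrow> 'b) \<Rightarrow> (int \<Rightarrow> 'b) \<Rightarrow> nat \<Rightarrow> 'a list set" where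
  "blocks_over p U q = {c \<in> language X. length c = q \<and> map p c = word_at U 0 q}"

definition succ_over :: "('a \<Rightarrow> 'b) \<Rightarrow> (int \<Rightarrow> 'b) \<Rightarrow> nat \<Rightarrow> ('a list \<times> 'a list) set" where
  "succ_over p U q = {(c, d). c \<in> blocks_over p U q \<and> d \<in> blocks_over p U q \<and> c @ d \<in> language X}"

lemma map_word_at: "map p (word_at z i n) = word_at (\<lambda>j. p (z j)) i n"
  by (rule nth_equalityI) auto

lemma block_in_blocks_over:
  assumes z: "z \<in> X" "\<And>i. p (z i) = U i" and per: "\<And>n. U (n + int q) = U n"
  shows "word_at z (k * int q) q \<in> blocks_over p U q"
proof -
  have "word_at U (k * int q) q = word_at U 0 q"
    using periodic_int[of U "int q", OF per] by (intro word_at_eqI) (simp add: add.commute)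
  then show ?thesis using z by (simp add: blocks_over_def language_word_at map_word_at)
qed

lemma path_in_succ_over:
  assumes z: "z \<in> X" "\<And>i. p (z i) = U i" and per: "\<And>n. U (n + int q) = U n"
  shows "(word_at z (k * int q) q, word_at z ((k + 1 + int n) * int q) q) \<in> (succ_over p U q)\<^sup>+"
proof -
  have step: "(word_at z (k * int q) q, word_at z ((k + 1) * int q) q) \<in> succ_over p U q" for k
    using block_in_blocks_over[of z p U q k, OF z per] block_in_blocks_over[of z p U q "k + 1", OF z per]
      language_word_at[OF z(1), of "k * int q" "q + q"]
    by (simp add: succ_over_def word_at_add distrib_right)
  show ?thesis
  proof (induction n)
    case 0
    show ?case using step[of k] by auto
  next
    case (Suc n)
    then show ?case using step[of "k + 1 + int n"] by (simp add: algebra_simps trancl_into_trancl)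
  qed
qed

text \<open>A link over one period also prescribes the symbol at time \<open>q\<close>; it is
  supplied by the first symbol of \<open>d\<close>, because \<open>U\<close> takes the same value at
  0 and \<open>q\<close>.\<close>

lemma succ_over_link:
  assumes q: "1 \<le> q" and per: "\<And>n. U (n + int q) = U n" and cd: "(c, d) \<in> succ_over p U q"
  shows "link X p U 0 (int q) (hd c) (hd d)"
proof -
  obtain z where z: "z \<in> X" "word_at z 0 (length (c @ d)) = c @ d"
    using cd language_obtain[of "c @ d" 0] by (auto simp: succ_over_def)
  have c: "word_at z 0 q = c" "word_at z (int q) q = d" "map p c = word_at U 0 q" "map p d = word_at U 0 q"
    using z(2) cd by (auto simp: succ_over_def blocks_over_def word_at_add)
  obtain q' where q': "q = Suc q'" using q by (cases q) auto
  have hd: "z 0 = hd c" "z (int q) = hd d"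
    using c(1,2) by (auto simp: q' word_at_Suc)
  have "p (z i) = U i" if "0 \<le> i" "i \<le> int q" for i
  proof (cases "i = int q")
    case True
    have "d \<noteq> []" using c(2) by (auto simp: q' word_at_Suc)
    then have "p (hd d) = hd (word_at U 0 q)" using c(4) by (simp flip: hd_map)
    then show ?thesis using True hd(2) per[of 0] by (simp add: q' word_at_Suc)
  next
    case False
    then have "nat i < q" using that by simp
    then have "word_at (\<lambda>j. p (z j)) 0 q ! nat i = word_at U 0 q ! nat i"
      using c by (metis map_word_at)
    then show ?thesis using \<open>nat i < q\<close> that by simp
  qed
  then show ?thesis using link_point[of z X 0 "int q" p U] z(1) hd by simp
qed

lemma link_comp:
  assumes per: "\<And>n. U (n + int q) = U n"
    and "link X p U 0 (int (i * q)) c d" "link X p U 0 (int (j * q)) d e"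
  shows "link X p U 0 (int ((i + j) * q)) c e"
proof -
  have "link X p U (0 + int (i * q)) (int (j * q) + int (i * q)) d e"
    using assms(3) periodic_int[of U "int q" _ "int i", OF per]
    by (intro link_shift[of p U 0 "int (j * q)" d e U]) auto
  then have "link X p U (int (i * q)) (int (i * q) + int (j * q)) d e" by (simp add: add.commute)
  from link_trans[OF assms(2) this] show ?thesis by (simp add: distrib_right)
qed

lemma succ_over_trancl_link:
  assumes q: "1 \<le> q" and per: "\<And>n. U (n + int q) = U n"
    and cd: "(c, d) \<in> (succ_over p U q)\<^sup>+"
  shows "\<exists>j\<ge>1. link X p U 0 (int (j * q)) (hd c) (hd d)"
  using cd
proof (induction rule: trancl_induct)
  case (base d)
  then show ?case using succ_over_link[of q U, OF q per] by (intro exI[of _ 1]) auto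
next
  case (step d e)
  then obtain j where j: "1 \<le> j" "link X p U 0 (int (j * q)) (hd c) (hd d)" by blast
  have "link X p U 0 (int (1 * q)) (hd d) (hd e)"
    using succ_over_link[of q U, OF q per step.hyps(2)] by simp
  then have "link X p U 0 (int ((j + 1) * q)) (hd c) (hd e)"
    using j by (intro link_comp[of U q, OF per])
  then show ?case by (intro exI[of _ "j + 1"]) auto
qed

lemma periodic_point:
  assumes L: "0 < L" and per: "\<And>n. U (n + int L) = U n" and lk: "link X p U 0 (int L) c c"
  obtains z where "z \<in> X" "\<And>n. p (z n) = U n" "\<And>n. z (n + int L) = z n" "z 0 = c"
proof -
  obtain z where z: "z \<in> X" "\<And>i. 0 \<le> i \<and> i \<le> int L \<Longrightarrow> p (z i) = U i" "z 0 = c" "z (int L) = c"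
    using lk by (auto simp: link_def)
  define u where "u n = z (n mod int L)" for n
  show thesis
  proof (rule that[of u])
    show "u \<in> X" unfolding in_X_iff
    proof
      fix n
      have "z (n mod int L + 1) = u (n + 1)"
      proof (cases "n mod int L + 1 = int L")
        case True
        then have "(n + 1) mod int L = 0" by (metis mod_add_left_eq mod_self)
        then show ?thesis using True z by (simp add: u_def)
      next
        case False
        have "n mod int L < int L" "0 \<le> n mod int L" using L by simp_all
        then have "(n mod int L + 1) mod int L = n mod int L + 1"
          using False by (intro mod_pos_pos_trivial) auto
        then have "(n + 1) mod int L = n mod int L + 1" by (simp add: mod_add_left_eq)
        then show ?thesis by (simp add: u_def)
      qed
      moreover have "[z (n mod int L), z (n mod int L + 1)] \<in> language X"
        using z(1) in_X_iff by blast
      ultimately show "[u n, u (n + 1)] \<in> language X" by (simp add: u_def)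
    qed
    show "p (u n) = U n" for n
    proof -
      have "p (u n) = U (n mod int L)"
        unfolding u_def using L by (intro z(2)) (simp add: less_imp_le)
      also have "\<dots> = U n"
        using periodic_int[of U "int L" "n mod int L" "n div int L", OF per] by simp
      finally show ?thesis .
    qed
  qed (use z in \<open>auto simp: u_def\<close>)
qed

text \<open>\<open>U\<close> repeats the word of \<open>y\<close> on [i, j), of length L = m q. The
  blocks are cut from periodic points through the linked states \<open>c\<close> and
  \<open>d\<close>, so a path from \<open>b\<close> back to \<open>a\<close> would link
  \<open>d\<close> to \<open>c\<close> over some multiple of \<open>q\<close>. Such a link has to be
  excluded although the idempotent relation speaks about multiples of \<open>L\<close> only.\<close>

lemma periodic_linked_blocks:
  assumes ex: "x \<in> fibre X (block_map p) y" "x' \<in> fibre X (block_map p) y"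
    "right_transition X (block_map p) y x x'" "\<not> right_transition X (block_map p) y x' x"
  obtains q U a b where "1 \<le> q" "\<And>n. U (n + int q) = U n"
    "\<And>s. (\<And>n. U (n + int s) = U n) \<Longrightarrow> q dvd s" "U \<in> block_map p ` X"
    "(a, a) \<in> (succ_over p U q)\<^sup>+" "(b, b) \<in> (succ_over p U q)\<^sup>+"
    "(a, b) \<in> (succ_over p U q)\<^sup>+" "(b, a) \<notin> (succ_over p U q)\<^sup>+"
proof -
  obtain i j c d where ij: "i < j" "y j = y i"
    and tr: "\<And>c d e. link X p y i j c d \<Longrightarrow> link X p y i j d e \<Longrightarrow> link X p y i j c e"
    and lk: "link X p y i j c c" "link X p y i j d d" "link X p y i j c d" "\<not> link X p y i j d c"
    by (rule transition_idempotent[OF ex]) blast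
  define L where "L = nat (j - i)"
  have L: "0 < L" "int L = j - i" using ij by (auto simp: L_def)
  define U where "U n = y (i + n mod int L)" for n
  have UL: "U (n + int L) = U n" for n by (simp add: U_def)
  have Uy: "U n = y (n + i)" if "0 \<le> n" "n \<le> int L" for n
  proof (cases "n = int L")
    case True
    then show ?thesis using ij L by (simp add: U_def)
  next
    case False
    then show ?thesis using that by (simp add: U_def add.commute)
  qed
  have M: "link X p U 0 (int L) e f \<longleftrightarrow> link X p y i j e f" for e f
  proof
    assume "link X p U 0 (int L) e f"
    then have "link X p y (0 + i) (int L + i) e f" using Uy by (intro link_shift[of p U 0 "int L" e f y i]) auto
    then show "link X p y i j e f" using L by simp
  next
    assume "link X p y i j e f"
    then have "link X p U (i + - i) (j + - i) e f" using Uy L by (intro link_shift[of p y i j e f U "- i"]) auto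
    then show "link X p U 0 (int L) e f" using L by simp
  qed
  obtain q where q: "1 \<le> q" and per: "\<And>n. U (n + int q) = U n"
    and least: "\<And>s. (\<And>n. U (n + int s) = U n) \<Longrightarrow> q dvd s"
    using least_period[of L U, OF L(1) UL] by metis
  obtain m where m: "L = m * q" using least[OF UL] by (metis dvd_def mult.commute)
  have m1: "1 \<le> m" using m L by (cases m) auto
  define R where "R n e f \<longleftrightarrow> link X p U 0 (int (n * q)) e f" for n e f
  have comp: "R (n + n') e g" if "R n e f" "R n' f g" for n n' e f g
    using that unfolding R_def by (rule link_comp[of U q, OF per])
  have Rm: "R m e f \<longleftrightarrow> link X p y i j e f" for e f using M m by (simp add: R_def)
  \<comment> \<open>Transitivity of the relation over one length \<open>L\<close> collapses any
    positive number of copies to a single one.\<close>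
  have Rmul: "R m e f" if "R (Suc n * m) e f" for n e f
    using that
  proof (induction n arbitrary: f)
    case (Suc n)
    define N where "N = int (Suc n * m * q)"
    have N: "0 \<le> N" "int (Suc (Suc n) * m * q) = N + int L"
      by (simp_all add: N_def m algebra_simps)
    obtain z where z: "z \<in> X" "\<And>i. 0 \<le> i \<Longrightarrow> i \<le> N + int L \<Longrightarrow> p (z i) = U i"
      "z 0 = e" "z (N + int L) = f"
      using Suc.prems unfolding R_def link_def N(2) by blast
    have "link X p U 0 N (z 0) (z N)" using z(1,2) by (intro link_point) auto
    then have "R (Suc n * m) e (z N)" by (simp only: R_def z(3) N_def)
    then have 1: "R m e (z N)" by (rule Suc.IH)
    have "link X p U N (N + int L) (z N) (z (N + int L))" using z(1,2) N by (intro link_point) auto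
    then have "link X p U (N + - N) (N + int L + - N) (z N) f"
      unfolding z(4)
    proof (rule link_shift)
      show "U (i + - N) = U i" for i
        using periodic_int[of U "int q" i "- int (Suc n * m)", OF per] by (simp only: N_def of_nat_mult mult_minus_left mult.assoc)
    qed
    then have "R m (z N) f" by (simp add: R_def m)
    then show ?case using 1 tr Rm by blast
  qed simp
  have Rpow: "R (n * k) e e" if "R k e e" "R 0 e e" for n k e
    by (induction n) (use that comp in auto)
  \<comment> \<open>Going round \<open>d \<rightarrow> c \<rightarrow> d\<close> often enough makes the total length a multiple of \<open>m\<close>.\<close>
  have no: "\<not> R n d c" if "1 \<le> n" for n
  proof
    assume n: "R n d c"
    have "R m c d" "R m d d" using lk Rm by auto
    have "R (n + m) d d" using comp[OF n \<open>R m c d\<close>] .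
    moreover have "R 0 d d"
      using \<open>R m d d\<close> by (force simp: R_def link_def)
    ultimately have "R ((m - 1) * (n + m) + n) d c" using comp[OF Rpow n] by blast
    moreover have "(m - 1) * (n + m) + n = Suc (n + m - 2) * m"
    proof -
      show ?thesis by (cases m; cases n) (use m1 that in \<open>auto simp: algebra_simps\<close>)
    qed
    ultimately have "R m d c" using Rmul by simp
    then show False using lk Rm by blast
  qed
  obtain \<alpha> where \<alpha>: "\<alpha> \<in> X" "\<And>n. p (\<alpha> n) = U n" "\<And>n. \<alpha> (n + int L) = \<alpha> n" "\<alpha> 0 = c"
    by (rule periodic_point[of L U p c, OF L(1) UL]) (use M lk(1) in blast)+
  obtain \<beta> where \<beta>: "\<beta> \<in> X" "\<And>n. p (\<beta> n) = U n" "\<And>n. \<beta> (n + int L) = \<beta> n" "\<beta> 0 = d"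
    by (rule periodic_point[of L U p d, OF L(1) UL]) (use M lk(2) in blast)+
  obtain z where z: "z \<in> X" "\<And>i. 0 \<le> i \<and> i \<le> int L \<Longrightarrow> p (z i) = U i" "z 0 = c" "z (int L) = d"
    using lk(3) M[of c d] by (auto simp: link_def)
  define u where "u = (\<lambda>i. if i \<le> 0 then \<alpha> i else if i \<le> int L then z i else \<beta> i)"
  have \<beta>L: "\<beta> (int L) = d" using \<beta>(3)[of 0] \<beta>(4) by simp
  have "(\<lambda>i. if i \<le> int L then z i else \<beta> i) \<in> X" using z \<beta> \<beta>L by (intro glue_in_X) auto
  then have "u \<in> X" unfolding u_def using \<alpha>(1,4) z(3) L
    by (intro glue_in_X[of \<alpha> "\<lambda>i. if i \<le> int L then z i else \<beta> i" 0]) auto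
  have pu: "p (u n) = U n" for n using \<alpha> \<beta> z by (auto simp: u_def)
  define a b where "a = word_at \<alpha> 0 q" and "b = word_at \<beta> 0 q"
  have qL: "q \<le> L" using m m1 by simp
  have \<alpha>n: "\<alpha> (- int L + k) = \<alpha> k" for k
    using \<alpha>(3)[of "- int L + k"] by simp
  have a1: "word_at \<alpha> (int L) q = a"
    unfolding a_def using \<alpha>(3) by (intro word_at_eqI) (simp add: add.commute)
  have a2: "word_at \<alpha> (- int L) q = a"
    unfolding a_def using \<alpha>n by (intro word_at_eqI) simp
  \<comment> \<open>After time 0 the point \<open>u\<close> may leave \<open>\<alpha>\<close> at
    once, so its block at 0 need not be \<open>a\<close>. The path from \<open>a\<close> to
    \<open>b\<close> starts one length \<open>L\<close> earlier, where a whole block of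
    \<open>u\<close> lies in its past, and so takes 2m steps.\<close>
  have a3: "word_at u (- int L) q = a"
    unfolding a2[symmetric] using qL by (intro word_at_eqI) (simp add: u_def)
  have b1: "word_at \<beta> (int L) q = b"
    unfolding b_def using \<beta>(3) by (intro word_at_eqI) (simp add: add.commute)
  have b2: "word_at u (int L) q = b"
    unfolding b1[symmetric] using z(4) \<beta>L L(1) by (intro word_at_eqI) (auto simp: u_def)
  have path: "(word_at v (k * int q) q, word_at v ((k + 1 + int n) * int q) q) \<in> (succ_over p U q)\<^sup>+"
    if "v \<in> X" "\<And>n. p (v n) = U n" for v k n
    using path_in_succ_over[of v p U q k n] that per by blast
  have mq: "(0 + 1 + int (m - 1)) * int q = int L" using m m1 by (simp add: of_nat_diff)
  have mq2: "(- int m + 1 + int (2 * m - 1)) * int q = int L" using m m1 by (simp add: of_nat_diff)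
  have mq3: "- int m * int q = - int L" using m by simp
  show thesis
  proof (rule that[of q U a b, OF q per least])
    show "U \<in> block_map p ` X" using \<alpha> by (auto simp: block_map_def image_iff intro!: bexI[of _ \<alpha>])
    show "(a, a) \<in> (succ_over p U q)\<^sup>+"
      using path[of \<alpha> 0 "m - 1", OF \<alpha>(1,2)] unfolding mq by (simp add: a1 flip: a_def)
    show "(b, b) \<in> (succ_over p U q)\<^sup>+"
      using path[of \<beta> 0 "m - 1", OF \<beta>(1,2)] unfolding mq by (simp add: b1 flip: b_def)
    show "(a, b) \<in> (succ_over p U q)\<^sup>+"
      using path[of u "- int m" "2 * m - 1", OF \<open>u \<in> X\<close> pu] unfolding mq2 mq3 by (simp add: a3 b2)
    show "(b, a) \<notin> (succ_over p U q)\<^sup>+"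
    proof
      assume "(b, a) \<in> (succ_over p U q)\<^sup>+"
      then obtain n where "1 \<le> n" "link X p U 0 (int (n * q)) (hd b) (hd a)"
        using succ_over_trancl_link[of q U b a p, OF q per] by blast
      moreover have "hd b = d" "hd a = c" using q \<alpha>(4) \<beta>(4) by (cases q; simp add: a_def b_def word_at_Suc)+
      ultimately show False using no by (simp add: R_def)
    qed
  qed
qed

end

section \<open>Counting words over a periodic point\<close>

lemma not_geometric:
  fixes T :: "nat \<Rightarrow> real"
  assumes c: "0 < c" and l: "0 < l" and lower: "\<And>k. (real k * c - C) * l ^ k \<le> T k"
    and upper: "\<And>l'. l < l' \<Longrightarrow> \<exists>K. \<forall>k. T k \<le> K * l' ^ k"
    and c1: "0 < c1" and \<eta>: "0 < \<eta>" and T: "\<And>k. c1 * \<eta> ^ k \<le> T k" "\<And>k. T k \<le> c2 * \<eta> ^ k"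
  shows False
proof (cases "\<eta> \<le> l")
  case True
  have c2: "0 < c2" using T[of 0] c1 by simp
  obtain k where k: "(c2 + C) / c < real k" using reals_Archimedean2 by blast
  have "(real k * c - C) * l ^ k \<le> c2 * \<eta> ^ k" using lower T(2) order_trans by blast
  also have "\<dots> \<le> c2 * l ^ k" using True \<eta> c2 by (intro mult_left_mono power_mono) auto
  finally have "real k * c - C \<le> c2" using l by simp
  then show False using k c by (simp add: field_simps)
next
  case False
  define l' where "l' = (l + \<eta>) / 2"
  have l': "l < l'" "l' < \<eta>" "0 < l'" using False l by (auto simp: l'_def)
  obtain K where K: "\<And>k. T k \<le> K * l' ^ k" using upper[OF l'(1)] by blast
  have "0 < K" using K[of 0] T(1)[of 0] c1 by simp
  then obtain k where k: "(l' / \<eta>) ^ k < c1 / K"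
    using real_arch_pow_inv[of "c1 / K" "l' / \<eta>"] c1 \<eta> l' by auto
  have "c1 * \<eta> ^ k \<le> K * l' ^ k" using K T(1) order_trans by blast
  then show False using k \<open>0 < K\<close> \<eta> by (simp add: power_divide field_simps)
qed

lemma prod_lessThan_add:
  fixes h :: "nat \<Rightarrow> 'b::comm_monoid_mult"
  shows "(\<Prod>i<m + n. h i) = (\<Prod>i<m. h i) * (\<Prod>i<n. h (m + i))"
  by (induction n) (simp_all add: mult.assoc)

lemma (in one_step_shift) finite_blocks_over: "finite (blocks_over p U n)"
  by (rule finite_subset[OF _ finite_lists_length_eq[OF finite_A, of n]])
    (auto simp: blocks_over_def dest: language_set)

locale marked_fibre = one_step_shift A X for A :: "'a::discrete_topology set" and X :: "'a point set" +
  fixes p :: "'a \<Rightarrow> 'b" and U :: "int \<Rightarrow> 'b" and q :: nat and g :: "'a list \<Rightarrow> real"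
  assumes q: "1 \<le> q" and per: "\<And>n. U (n + int q) = U n"
    and least: "\<And>s. (\<And>n. U (n + int s) = U n) \<Longrightarrow> q dvd s"
    and g_off: "\<And>w. w \<notin> blocks_over p U q \<Longrightarrow> g w = 1"
begin

text \<open>The product from the cylinder estimate of the block Markov measure: it runs over the
  blocks at offsets 1 to \<open>m\<close>, aligned with the period or not.\<close>

definition weight :: "nat \<Rightarrow> 'a list \<Rightarrow> real" where
  "weight m w = (\<Prod>k<m. g (take q (drop (Suc k) w)))"

definition trans_weight :: "'a list \<Rightarrow> 'a list \<Rightarrow> real" where
  "trans_weight c d = (if c @ d \<in> language X then 1 else 0) * g d"

abbreviation "S \<equiv> blocks_over p U q"

definition words_from :: "nat \<Rightarrow> 'a list \<Rightarrow> 'a list set" where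
  "words_from k c = {w \<in> blocks_over p U (q + k * q). take q w = c}"

lemma U_int: "U (n + k * int q) = U n"
  using periodic_int[of U "int q", OF per] .

text \<open>A block over \<open>U\<close> at offset \<open>s\<close> makes \<open>U\<close> agree
  with its shift by \<open>s\<close> on \<open>q\<close> consecutive places, hence everywhere. Then
  \<open>q\<close> divides \<open>s\<close>, which is impossible strictly between 0 and
  \<open>q\<close>.\<close>

lemma no_block_between:
  assumes w: "map p w = word_at U 0 n" and s: "1 \<le> s" "s < q" "s + q \<le> n"
  shows "take q (drop s w) \<notin> S"
proof
  assume "take q (drop s w) \<in> S"
  then have "take q (drop s (map p w)) = word_at U 0 q"
    by (simp add: blocks_over_def take_map drop_map)
  then have eq: "word_at U (int s) q = word_at U 0 q"
    unfolding w using take_drop_word_at[OF s(3), of U 0] by simp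
  have "U (n + int s) = U n" for n
  proof -
    have "nat (n mod int q) < q" using q by (simp add: nat_less_iff)
    then have "U (int s + int (nat (n mod int q))) = U (int (nat (n mod int q)))"
      using arg_cong[OF eq, of "\<lambda>v. v ! nat (n mod int q)"] by simp
    moreover have "int (nat (n mod int q)) = n mod int q" using q by simp
    ultimately have "U (int s + n mod int q) = U (n mod int q)" by simp
    then show ?thesis
      using U_int[of "int s + n mod int q" "n div int q"] U_int[of "n mod int q" "n div int q"]
      by (simp add: add.assoc) (simp add: add.commute)
  qed
  then have "q dvd s" by (rule least)
  then show False using s by (auto dest: dvd_imp_le)
qed

text \<open>Among the first \<open>q\<close> factors only the last belongs to an aligned block,
  namely the first block of \<open>w\<close>; the others are 1 by \<open>no_block_between\<close>
  and \<open>g_off\<close>.\<close>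

lemma weight_append:
  assumes c: "length c = q" and w: "c @ w \<in> blocks_over p U (q + Suc k * q)"
  shows "weight (Suc k * q) (c @ w) = g (take q w) * weight (k * q) w"
proof -
  let ?h = "\<lambda>i. g (take q (drop (Suc i) (c @ w)))"
  obtain q' where q': "q = Suc q'" using q by (cases q) auto
  have "weight (Suc k * q) (c @ w) = (\<Prod>i<q + k * q. ?h i)" by (simp add: weight_def)
  also have "\<dots> = (\<Prod>i<q. ?h i) * (\<Prod>i<k * q. ?h (q + i))"
    by (rule prod_lessThan_add)
  also have "(\<Prod>i<k * q. ?h (q + i)) = weight (k * q) w"
    using c by (simp add: weight_def)
  also have "(\<Prod>i<q. ?h i) = (\<Prod>i<q'. ?h i) * ?h q'" unfolding q' by simp
  also have "?h q' = g (take q w)" using c q' by simp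
  also have "(\<Prod>i<q'. ?h i) = 1"
  proof (rule prod.neutral, rule ballI)
    fix i assume "i \<in> {..<q'}"
    then have "take q (drop (Suc i) (c @ w)) \<notin> S"
      using w q' by (intro no_block_between[of "c @ w" "q + Suc k * q"]) (auto simp: blocks_over_def)
    then show "?h i = 1" by (rule g_off)
  qed
  finally show ?thesis by simp
qed

text \<open>By the one-step property it depends only on the start of \<open>w\<close> whether
  \<open>c\<close> may precede it; this lets a sum over words become a matrix product.\<close>

lemma append_blocks_over:
  assumes c: "c \<in> S" and w: "length w = q + k * q"
  shows "c @ w \<in> blocks_over p U (q + Suc k * q) \<longleftrightarrow>
    w \<in> blocks_over p U (q + k * q) \<and> c @ take q w \<in> language X"
proof -
  have len: "length c = q" "map p c = word_at U 0 q" using c by (auto simp: blocks_over_def)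
  have "word_at U 0 (q + Suc k * q) = word_at U 0 q @ word_at U (int q) (q + k * q)"
    using word_at_add[of U 0 q "q + k * q"] by (simp add: add_ac)
  also have "word_at U (int q) (q + k * q) = word_at U 0 (q + k * q)"
    using U_int[of _ 1] by (intro word_at_eqI) (simp add: add.commute)
  finally have m: "map p (c @ w) = word_at U 0 (q + Suc k * q) \<longleftrightarrow> map p w = word_at U 0 (q + k * q)"
    using len by simp
  have "c @ w \<in> language X \<longleftrightarrow> w \<in> language X \<and> c @ take q w \<in> language X"
  proof (intro iffI conjI)
    assume cw: "c @ w \<in> language X"
    show "w \<in> language X" using language_factor[of c w "[]"] cw by simp
    show "c @ take q w \<in> language X"
      using language_factor[of "[]" "c @ take q w" "drop q w"] cw by simp
  next
    assume *: "w \<in> language X \<and> c @ take q w \<in> language X"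
    obtain t v where tv: "w = t # v" using w q by (cases w) auto
    obtain q' where q': "q = Suc q'" using q by (cases q) auto
    have "c @ [t] \<in> language X"
      using language_factor[of "[]" "c @ [t]" "take q' v"] * by (simp add: tv q')
    then show "c @ w \<in> language X" using * tv language_glue by blast
  qed
  then show ?thesis using m w len by (auto simp: blocks_over_def)
qed

lemma take_in_S:
  assumes "w \<in> blocks_over p U (q + k)" shows "take q w \<in> S"
proof -
  have "take q w \<in> language X"
    using language_factor[of "[]" "take q w" "drop q w"] assms by (simp add: blocks_over_def)
  moreover have "map p (take q w) = take q (word_at U 0 (q + k))"
    using assms by (simp add: blocks_over_def flip: take_map)
  ultimately show ?thesis
    using assms take_drop_word_at[of 0 q "q + k" U 0] by (simp add: blocks_over_def)
qed

lemma words_from_Suc: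
  assumes c: "c \<in> S"
  shows "words_from (Suc k) c = (\<Union>d\<in>{d \<in> S. c @ d \<in> language X}. (@) c ` words_from k d)"
proof (intro equalityI subsetI)
  fix v assume v: "v \<in> words_from (Suc k) c"
  define w where "w = drop q v"
  have vw: "v = c @ w" and lw: "length w = q + k * q"
    using v append_take_drop_id[of q v] by (auto simp: words_from_def w_def blocks_over_def)
  have "w \<in> blocks_over p U (q + k * q)" "c @ take q w \<in> language X"
    using v append_blocks_over[OF c lw] by (auto simp: words_from_def vw)
  then show "v \<in> (\<Union>d\<in>{d \<in> S. c @ d \<in> language X}. (@) c ` words_from k d)"
    using take_in_S vw by (auto simp: words_from_def)
next
  fix v assume "v \<in> (\<Union>d\<in>{d \<in> S. c @ d \<in> language X}. (@) c ` words_from k d)"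
  then obtain w where w: "v = c @ w" "w \<in> blocks_over p U (q + k * q)" "c @ take q w \<in> language X"
    by (auto simp: words_from_def)
  then have "length w = q + k * q" by (simp add: blocks_over_def)
  then show "v \<in> words_from (Suc k) c"
    using append_blocks_over[OF c, of w k] w c by (auto simp: words_from_def) (auto simp: blocks_over_def)
qed

lemma finite_words_from: "finite (words_from k c)"
  using finite_blocks_over[of p U] by (auto simp: words_from_def)

text \<open>Removing the first block leaves a word that starts with a successor \<open>d\<close>,
  and the weight loses exactly the factor \<open>g d\<close>. This is one application of the
  transition matrix.\<close>

lemma sum_weight_from:
  "c \<in> S \<Longrightarrow> (\<Sum>w\<in>words_from k c. weight (k * q) w) = (mat_app S trans_weight ^^ k) (\<lambda>_. 1) c"
proof (induction k arbitrary: c)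
  case 0
  then have "words_from 0 c = {c}" by (auto simp: words_from_def blocks_over_def)
  then show ?case by (simp add: weight_def)
next
  case (Suc k)
  let ?D = "{d \<in> S. c @ d \<in> language X}"
  have len: "length c = q" using Suc.prems by (simp add: blocks_over_def)
  have finD: "finite ?D" using finite_blocks_over[of p U q] by simp
  have "(\<Sum>w\<in>words_from (Suc k) c. weight (Suc k * q) w)
      = (\<Sum>d\<in>?D. \<Sum>w\<in>(@) c ` words_from k d. weight (Suc k * q) w)"
    unfolding words_from_Suc[OF Suc.prems]
    using finite_words_from finD by (intro sum.UNION_disjoint) (auto simp: words_from_def)
  also have "\<dots> = (\<Sum>d\<in>?D. g d * (\<Sum>w\<in>words_from k d. weight (k * q) w))"
  proof (rule sum.cong[OF refl])
    fix d assume d: "d \<in> ?D"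
    have "weight (Suc k * q) (c @ w) = g d * weight (k * q) w" if w: "w \<in> words_from k d" for w
    proof -
      have "c @ w \<in> words_from (Suc k) c" unfolding words_from_Suc[OF Suc.prems] using d w by blast
      then show ?thesis using weight_append[OF len, of w k] w by (simp add: words_from_def)
    qed
    then show "(\<Sum>w\<in>(@) c ` words_from k d. weight (Suc k * q) w)
        = g d * (\<Sum>w\<in>words_from k d. weight (k * q) w)"
      by (subst sum.reindex) (auto simp: sum_distrib_left inj_on_def)
  qed
  also have "\<dots> = (\<Sum>d\<in>S. trans_weight c d * (mat_app S trans_weight ^^ k) (\<lambda>_. 1) d)"
  proof (rule sum.mono_neutral_cong_left)
    show "\<forall>d\<in>S - ?D. trans_weight c d * (mat_app S trans_weight ^^ k) (\<lambda>_. 1) d = 0"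
      by (simp add: trans_weight_def[of c])
    show "g d * (\<Sum>w\<in>words_from k d. weight (k * q) w) = trans_weight c d * (mat_app S trans_weight ^^ k) (\<lambda>_. 1) d"
      if "d \<in> ?D" for d
      using that by (simp add: trans_weight_def[of c] Suc.IH)
  qed (auto simp: finite_blocks_over)
  finally show ?case by (simp add: mat_app_def[of S trans_weight "(mat_app S trans_weight ^^ k) (\<lambda>_. 1)"])
qed

lemma sum_weight:
  "(\<Sum>w\<in>blocks_over p U (q + k * q). weight (k * q) w) = (\<Sum>c\<in>S. (mat_app S trans_weight ^^ k) (\<lambda>_. 1) c)"
proof -
  have "blocks_over p U (q + k * q) = (\<Union>c\<in>S. words_from k c)"
    using take_in_S by (auto simp: words_from_def)
  then have "(\<Sum>w\<in>blocks_over p U (q + k * q). weight (k * q) w)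
      = (\<Sum>c\<in>S. \<Sum>w\<in>words_from k c. weight (k * q) w)"
    using finite_words_from finite_blocks_over
    by (simp only:) (intro sum.UNION_disjoint, auto simp: words_from_def)
  then show ?thesis by (simp add: sum_weight_from)
qed

end

text \<open>Over whole periods of a periodic point the Birkhoff sums are exactly linear, so the
  Gibbs bounds turn into powers of one number \<open>\<Theta>\<close>. The word covers k + 1
  periods, hence the exponent \<open>Suc k\<close>.\<close>

lemma gibbs_periodic:
  assumes gibbs: "gibbs_measure_for Y f \<nu>" and U: "U \<in> Y" and q: "1 \<le> q"
    and per: "\<And>n. U (n + int q) = U n"
  obtains K1 K2 \<Theta> where "0 < K1" "0 < \<Theta>"
    "\<And>k. K1 * \<Theta> ^ Suc k \<le> measure \<nu> (cylinder Y 0 (word_at U 0 (q + k * q)))"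
    "\<And>k. measure \<nu> (cylinder Y 0 (word_at U 0 (q + k * q))) \<le> K2 * \<Theta> ^ Suc k"
proof -
  obtain K1 K2 Pr where K: "0 < K1" "0 < K2"
    and *: "\<forall>z\<in>Y. \<forall>n\<ge>1. let r = measure \<nu> (cylinder Y 0 (word_at z 0 n))
        / exp (- real n * Pr + (\<Sum>j<n. f ((shift_map ^^ j) z))) in K1 < r \<and> r < K2"
    using gibbs by (auto simp: gibbs_measure_for_def)
  define \<Theta> where "\<Theta> = exp (- real q * Pr + (\<Sum>j<q. f ((shift_map ^^ j) U)))"
  have shift: "(shift_map ^^ (k * q + j)) U = (shift_map ^^ j) U" for k j
    using periodic_int[of U "int q" _ "int k", OF per]
    by (simp add: shift_funpow fun_eq_iff) (metis add.assoc add.commute)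
  have sum: "(\<Sum>j<k * q. f ((shift_map ^^ j) U)) = real k * (\<Sum>j<q. f ((shift_map ^^ j) U))" for k
  proof -
    have "(\<Sum>j<k * q. f ((shift_map ^^ j) U)) = (\<Sum>i<k. \<Sum>j\<in>{i * q..<i * q + q}. f ((shift_map ^^ j) U))"
      by (rule sum.nat_group[symmetric])
    also have "\<dots> = (\<Sum>i<k. \<Sum>j<q. f ((shift_map ^^ j) U))"
    proof (rule sum.cong[OF refl])
      fix i
      show "(\<Sum>j\<in>{i * q..<i * q + q}. f ((shift_map ^^ j) U)) = (\<Sum>j<q. f ((shift_map ^^ j) U))"
        by (rule sum.reindex_bij_witness[of _ "\<lambda>j. i * q + j" "\<lambda>j. j - i * q"])
          (auto simp: shift simp flip: shift[of i "_ - i * q"])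
    qed
    finally show ?thesis by simp
  qed
  have exp_eq: "exp (- real (q + k * q) * Pr + (\<Sum>j<q + k * q. f ((shift_map ^^ j) U))) = \<Theta> ^ Suc k" for k
  proof -
    have "- real (q + k * q) * Pr + (\<Sum>j<q + k * q. f ((shift_map ^^ j) U))
        = real (Suc k) * (- real q * Pr + (\<Sum>j<q. f ((shift_map ^^ j) U)))"
      using sum[of "Suc k"] by (simp add: algebra_simps)
    then show ?thesis unfolding \<Theta>_def by (simp only: exp_of_nat_mult)
  qed
  have r: "K1 < measure \<nu> (cylinder Y 0 (word_at U 0 (q + k * q))) / \<Theta> ^ Suc k
      \<and> measure \<nu> (cylinder Y 0 (word_at U 0 (q + k * q))) / \<Theta> ^ Suc k < K2" for k
    using bspec[OF * U, rule_format, of "q + k * q"] q unfolding exp_eq Let_def by simp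
  have \<Theta>: "0 < \<Theta>" by (simp add: \<Theta>_def)
  show thesis
    by (rule that[of K1 \<Theta> K2]) (use r K \<Theta> in \<open>auto simp: less_divide_eq divide_less_eq less_imp_le\<close>)
qed

lemma markov_measure_space:
  assumes "markov_measure X \<mu>" shows "prob_space \<mu>" "sets \<mu> = sets (borel_on X)"
proof -
  obtain B :: "nat set" and Z \<nu> \<phi> where Z: "one_step_markov_measure B Z \<nu>" "conjugacy \<phi> Z X"
    and \<mu>: "\<mu> = distr \<nu> (borel_on X) \<phi>"
    using assms unfolding markov_measure_def by blast
  have \<nu>: "prob_space \<nu>" "sets \<nu> = sets (borel_on Z)"
    using Z(1) by (auto simp: one_step_markov_measure_def invariant_measure_def)
  have "\<phi> \<in> measurable (borel_on Z) (borel_on X)"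
    using Z(2) by (intro measurable_restrict_continuous) (auto simp: conjugacy_def homeomorphism_def)
  then have "\<phi> \<in> measurable \<nu> (borel_on X)" by (simp add: measurable_cong_sets[OF \<nu>(2) refl])
  then show "prob_space \<mu>" unfolding \<mu> by (rule prob_space.prob_space_distr[OF \<nu>(1)])
  show "sets \<mu> = sets (borel_on X)" by (simp add: \<mu>)
qed

text \<open>The preimage of a cylinder of \<open>Y\<close> splits into the disjoint cylinders of the
  admissible words above it.\<close>

lemma measure_image_cylinder:
  assumes X: "one_step_shift A X" and \<mu>: "prob_space \<mu>" "sets \<mu> = sets (borel_on X)"
    and \<pi>: "factor_map (block_map p) X Y"
  shows "measure (distr \<mu> (borel_on Y) (block_map p)) (cylinder Y 0 (word_at U 0 n))
    = (\<Sum>w\<in>one_step_shift.blocks_over X p U n. measure \<mu> (cylinder X 0 w))"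
proof -
  interpret one_step_shift A X by fact
  interpret prob_space \<mu> by fact
  have im: "block_map p ` X = Y" and cont: "continuous_on X (block_map p)"
    using \<pi> by (auto simp: factor_map_def)
  have meas: "block_map p \<in> measurable \<mu> (borel_on Y)"
    unfolding measurable_cong_sets[OF \<mu>(2) refl]
    using cont im by (intro measurable_restrict_continuous) auto
  have space: "space \<mu> = X"
    using sets_eq_imp_space_eq[OF \<mu>(2)] by (simp add: space_restrict_space)
  have "measure (distr \<mu> (borel_on Y) (block_map p)) (cylinder Y 0 (word_at U 0 n))
      = measure \<mu> (block_map p -` cylinder Y 0 (word_at U 0 n) \<inter> X)"
    using measure_distr[OF meas cylinder_sets] by (simp add: space)
  also have "block_map p -` cylinder Y 0 (word_at U 0 n) \<inter> X = (\<Union>w\<in>blocks_over p U n. cylinder X 0 w)"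
  proof (intro equalityI subsetI)
    fix x assume x: "x \<in> block_map p -` cylinder Y 0 (word_at U 0 n) \<inter> X"
    then have "map p (word_at x 0 n) = word_at U 0 n"
      by (simp add: cylinder_def map_word_at block_map_def)
    then have "word_at x 0 n \<in> blocks_over p U n"
      using x by (simp add: blocks_over_def language_word_at)
    then show "x \<in> (\<Union>w\<in>blocks_over p U n. cylinder X 0 w)"
      using x by (intro UN_I[of "word_at x 0 n"]) (auto simp: cylinder_def)
  next
    fix x assume "x \<in> (\<Union>w\<in>blocks_over p U n. cylinder X 0 w)"
    then have x: "x \<in> X" "map p (word_at x 0 n) = word_at U 0 n"
      by (auto simp: cylinder_def blocks_over_def)
    then show "x \<in> block_map p -` cylinder Y 0 (word_at U 0 n) \<inter> X"
      using im by (auto simp: cylinder_def map_word_at block_map_def)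
  qed
  also have "measure \<mu> \<dots> = (\<Sum>w\<in>blocks_over p U n. measure \<mu> (cylinder X 0 w))"
  proof (rule finite_measure_finite_Union)
    show "(\<lambda>w. cylinder X 0 w) ` blocks_over p U n \<subseteq> sets \<mu>"
      by (auto simp: \<mu>(2) cylinder_sets)
    show "disjoint_family_on (\<lambda>w. cylinder X 0 w) (blocks_over p U n)"
      by (auto simp: disjoint_family_on_def cylinder_def blocks_over_def)
  qed (rule finite_blocks_over)
  finally show ?thesis .
qed

theorem corollary5p6:
  fixes A :: "'a::discrete_topology set"
    and X Y :: "'a point set"
    and p :: "'a \<Rightarrow> 'a"
  assumes "finite A"
    and "shift_of_finite_type A X" and "one_step X" and "mixing X"
    and "sofic A Y"
    and "p ` A \<subseteq> A" and "factor_map (block_map p) X Y"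
    and "\<exists>y\<in>Y. \<exists>C\<in>right_classes X (block_map p) y. \<exists>C'\<in>right_classes X (block_map p) y.
           C \<noteq> C' \<and> class_transition X (block_map p) y C C'"
  shows "\<exists>\<mu>. markov_measure X \<mu> \<and> fully_supported X \<mu> \<and>
           \<not> gibbs_measure Y (distr \<mu> (borel_on Y) (block_map p))"
proof -
  obtain y C C' where y: "y \<in> Y" and C: "C \<in> right_classes X (block_map p) y"
    "C' \<in> right_classes X (block_map p) y" "C \<noteq> C'" "class_transition X (block_map p) y C C'"
    using assms(8) by blast
  have im: "block_map p ` X = Y" using assms(7) by (simp add: factor_map_def)
  have X: "one_step_shift A X" using assms(2,3) y im by unfold_locales auto
  interpret one_step_shift A X by fact
  obtain x x' where x: "x \<in> fibre X (block_map p) y" "x' \<in> fibre X (block_map p) y"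
    "right_transition X (block_map p) y x x'" "\<not> right_transition X (block_map p) y x' x"
    by (rule class_transition_pair[OF C])
  obtain q U a b where q: "1 \<le> q" and per: "\<And>n. U (n + int q) = U n"
    and least: "\<And>s. (\<And>n. U (n + int s) = U n) \<Longrightarrow> q dvd s" and U: "U \<in> block_map p ` X"
    and ab: "(a, a) \<in> (succ_over p U q)\<^sup>+" "(b, b) \<in> (succ_over p U q)\<^sup>+"
      "(a, b) \<in> (succ_over p U q)\<^sup>+" "(b, a) \<notin> (succ_over p U q)\<^sup>+"
    by (rule periodic_linked_blocks[OF x]) blast
  define S where "S = blocks_over p U q"
  define V :: "'a list \<Rightarrow> 'a list \<Rightarrow> real" where "V c d = (if c @ d \<in> language X then 1 else 0)" for c d
  have E: "succ_over p U q = {(c, d). c \<in> S \<and> d \<in> S \<and> 0 < V c d}"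
    by (auto simp: succ_over_def S_def V_def)
  have V0: "0 \<le> V c d" for c d by (simp add: V_def)
  have finS: "finite S" unfolding S_def by (rule finite_blocks_over)
  have abS: "a \<in> S" "b \<in> S" using ab(1,2) unfolding E by (auto elim: tranclE)
  obtain u v l c D where uv: "0 < u" "0 < v" and lc: "0 < l" "0 < c"
    and lower: "\<And>k. (real k * c - D) * l ^ k
      \<le> (mat_app S (\<lambda>i j. V i j * (if j = a then u else if j = b then v else 1)) ^^ k) (\<lambda>_. 1) a"
    and upper: "\<And>l'. l < l' \<Longrightarrow> \<exists>K. \<forall>k. \<forall>i\<in>S.
      (mat_app S (\<lambda>i j. V i j * (if j = a then u else if j = b then v else 1)) ^^ k) (\<lambda>_. 1) i \<le> K * l' ^ k"
    by (rule jordan_growth[of S V a b, OF finS V0 ab[unfolded E]]) blast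
  \<comment> \<open>With weight 1 on all other words, \<open>g\<close> is trivial off the blocks
    over \<open>U\<close>, and the transition matrix of \<open>marked_fibre\<close> becomes the
    weighted matrix of \<open>jordan_growth\<close>.\<close>
  define g where "g w = (if w = a then u else if w = b then v else 1)" for w
  have g: "0 < g w" for w using uv by (simp add: g_def)
  interpret fib: marked_fibre A X p U q g
    by unfold_locales (use q per least abS in \<open>auto simp: g_def S_def\<close>)
  interpret blk: block_markov A X q g
    by unfold_locales (use assms(4) q g in auto)
  obtain \<mu> \<rho> C1 C2 where \<mu>: "markov_measure X \<mu>" "fully_supported X \<mu>" and C12: "0 < \<rho>" "0 < C1" "0 < C2"
    and cyl: "\<And>w m. w \<in> language X \<Longrightarrow> length w = q + m \<Longrightarrow>
      C1 * (fib.weight m w / \<rho> ^ m) \<le> measure \<mu> (cylinder X 0 w) \<and>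
      measure \<mu> (cylinder X 0 w) \<le> C2 * (fib.weight m w / \<rho> ^ m)"
    using blk.weighted_markov_measure unfolding fib.weight_def[symmetric] by blast
  define T where "T k = (\<Sum>c\<in>S. (mat_app S fib.trans_weight ^^ k) (\<lambda>_. 1) c)" for k
  have tw: "fib.trans_weight = (\<lambda>i j. V i j * (if j = a then u else if j = b then v else 1))"
    by (simp add: fun_eq_iff fib.trans_weight_def V_def g_def)
  have tw0: "0 \<le> fib.trans_weight c d" for c d
    using g[of d] by (simp add: fib.trans_weight_def)
  have "\<not> gibbs_measure Y (distr \<mu> (borel_on Y) (block_map p))" (is "\<not> gibbs_measure Y ?\<nu>")
  proof
    assume "gibbs_measure Y ?\<nu>"
    then obtain f where f: "gibbs_measure_for Y f ?\<nu>" by (auto simp: gibbs_measure_def)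
    obtain K1 K2 \<Theta> where K: "0 < K1" "0 < \<Theta>"
      "\<And>k. K1 * \<Theta> ^ Suc k \<le> measure ?\<nu> (cylinder Y 0 (word_at U 0 (q + k * q)))"
      "\<And>k. measure ?\<nu> (cylinder Y 0 (word_at U 0 (q + k * q))) \<le> K2 * \<Theta> ^ Suc k"
      by (rule gibbs_periodic[of Y f ?\<nu> U q, OF f _ q per]) (use U im in blast)+
    note \<mu>_space = markov_measure_space[OF \<mu>(1)]
    have \<nu>: "C1 * (T k / \<rho> ^ (k * q)) \<le> measure ?\<nu> (cylinder Y 0 (word_at U 0 (q + k * q))) \<and>
        measure ?\<nu> (cylinder Y 0 (word_at U 0 (q + k * q))) \<le> C2 * (T k / \<rho> ^ (k * q))" for k
    proof -
      have "C * (T k / \<rho> ^ (k * q))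
          = (\<Sum>w\<in>blocks_over p U (q + k * q). C * (fib.weight (k * q) w / \<rho> ^ (k * q)))" for C
        unfolding T_def S_def fib.sum_weight[symmetric] by (simp add: sum_distrib_left sum_divide_distrib)
      then show ?thesis
        unfolding measure_image_cylinder[OF X \<mu>_space assms(7)]
        using cyl by (auto intro!: sum_mono simp: blocks_over_def)
    qed
    \<comment> \<open>The cylinder over k + 1 periods is comparable both to \<Theta>^(k+1) and to T
      k / \<rho>^(kq). Hence \<open>T k\<close> is comparable to the powers of \<Theta> \<rho>^q,
      and the surplus factor \<open>\<Theta>\<close> goes into the constants.\<close>
    show False
    proof (rule not_geometric[of c l D T "K1 * \<Theta> / C2" "\<Theta> * \<rho> ^ q" "K2 * \<Theta> / C1"])
      fix k
      have nn: "0 \<le> (mat_app S fib.trans_weight ^^ k) (\<lambda>_. 1) i" if "i \<in> S" for i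
        using that tw0 by (intro mat_pow_nonneg) auto
      \<comment> \<open>The linear factor is known for the words that start with \<open>a\<close>;
        as all weights are nonnegative, this one row bounds the total from below.\<close>
      have "(mat_app S fib.trans_weight ^^ k) (\<lambda>_. 1) a \<le> T k"
        unfolding T_def using abS finS nn by (intro member_le_sum) auto
      then show "(real k * c - D) * l ^ k \<le> T k" using lower[of k] unfolding tw by linarith
      have pw: "\<rho> ^ (k * q) = (\<rho> ^ q) ^ k" by (metis mult.commute power_mult)
      have "K1 * \<Theta> ^ Suc k \<le> C2 * (T k / \<rho> ^ (k * q))" using K(3)[of k] \<nu>[of k] by linarith
      then show "K1 * \<Theta> / C2 * (\<Theta> * \<rho> ^ q) ^ k \<le> T k"
        using C12 by (simp add: pw power_mult_distrib field_simps)
      have "C1 * (T k / \<rho> ^ (k * q)) \<le> K2 * \<Theta> ^ Suc k" using K(4)[of k] \<nu>[of k] by linarith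
      then show "T k \<le> K2 * \<Theta> / C1 * (\<Theta> * \<rho> ^ q) ^ k"
        using C12 by (simp add: pw power_mult_distrib field_simps)
    next
      fix l' assume "l < l'"
      then obtain K where "\<forall>k. \<forall>i\<in>S. (mat_app S fib.trans_weight ^^ k) (\<lambda>_. 1) i \<le> K * l' ^ k"
        using upper unfolding tw by blast
      then have "T k \<le> (\<Sum>i\<in>S. K * l' ^ k)" for k unfolding T_def by (intro sum_mono) blast
      then show "\<exists>K. \<forall>k. T k \<le> K * l' ^ k" by (intro exI[of _ "real (card S) * K"]) (simp add: mult.assoc)
    qed (use K C12 lc in auto)
  qed
  then show ?thesis using \<mu> by blast
qed

end
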